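(* Let $X$ be a spectrally positive Lévy process, let $c_1,c_2\ge 0$, and let $T$ be an exponential random variable with mean $1/\lambda>0$ independent of $X$. Let $c(t)=c_1t$ for $t\in[0,T]$ and $c(t)=c_2(t-T)+c_1T$ for $t\in(T,\infty)$. For $i=1,2$ put $\varphi_i(\gamma)=\ln\mathbb{E}\exp(-\gamma(X(1)-c_i))$, $\gamma\ge0$, and let $\overleftarrow{\varphi}_i$ be the inverse function of $\varphi_i$. Let $\gamma>\overleftarrow{\varphi}_1(\lambda)$, and consider the supremum of $X(t)-c(t)$ over $t<T+V$. (i) If $V=\infty$, then $$\mathbb{E}e^{-\gamma\sup_{t<\infty}(X(t)-c(t))}=\frac{\gamma\lambda\,\varphi_2'(0)\,[\varphi_2(\gamma)-\varphi_2(\overleftarrow{\varphi}_1(\lambda))]}{\varphi_2(\gamma)\,(\varphi_1(\gamma)-\lambda)\,\varphi_2(\overleftarrow{\varphi}_1(\lambda))}.$$ (ii) If $V$ is an exponentially distributed random variable with mean $1/\theta>0$ independent of $X$ and $T$, then $$\mathbb{E}e^{-\gamma\sup_{t<T+V}(X(t)-c(t))}=\gamma\lambda\theta\;\frac{\dfrac{\overleftarrow{\varphi}_2(\theta)-\overleftarrow{\varphi}_1(\lambda)}{\theta-\varphi_2(\overleftarrow{\varphi}_1(\lambda))}-\dfrac{\overleftarrow{\varphi}_1(\lambda)\,[\overleftarrow{\varphi}_2(\theta)-\gamma]}{\gamma\,[\theta-\varphi_2(\gamma)]}}{\overleftarrow{\varphi}_1(\lambda)\,\overleftarrow{\varphi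}_2(\theta)\,[\varphi_1(\gamma)-\lambda]}.$$
   Context: All processes are real-valued with time parameter $t\in[0,\infty)$. A spectrally positive Lévy process is a Lévy process with no negative jumps. The drift $c(t)$ is piecewise linear, with slope $c_1$ up to the random time $T$ and slope $c_2$ afterwards. $\sup_{t<r}$ means the supremum over $0\le t<r$. $\varphi_2'(0)$ denotes the derivative of $\varphi_2$ at $0$.
   Formalization: Each φ_i is assumed to attain every positive value (so its inverse exists); (i) assumes φ_2'(0) exists and is ≥ 0, since otherwise the supremum is infinite and the formula fails; in (ii) quotients with vanishing denominators are read by continuity. *)

theory Defs
  imports "HOL-Probability.Probability"
begin

text \<open>
  Processes are functions \<open>real \<Rightarrow> 'a \<Rightarrow> real\<close>, of which only the values at times \<open>t \<ge> 0\<close> matter.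
  All paths, not just almost all, are required to be right-continuous with left limits: the
  probability space need not be complete, and path functionals such as the supremum have to be
  measurable.
\<close>

locale levy_process = prob_space M for M :: "'a measure" +
  fixes X :: "real \<Rightarrow> 'a \<Rightarrow> real"
  assumes measurable_X: "\<And>t. 0 \<le> t \<Longrightarrow> X t \<in> borel_measurable M"
    and start_zero: "AE \<omega> in M. X 0 \<omega> = 0"
    and indep_increments:
      "\<And>(n::nat) (t :: nat \<Rightarrow> real). 0 \<le> t 0 \<Longrightarrow> (\<And>i. i < n \<Longrightarrow> t i < t (Suc i)) \<Longrightarrow>
         indep_vars (\<lambda>_. borel) (\<lambda>i \<omega>. X (t (Suc i)) \<omega> - X (t i) \<omega>) {..<n}"
    and stationary_increments:
      "\<And>s h. 0 \<le> s \<Longrightarrow> 0 \<le> h \<Longrightarrow> distr M borel (\<lambda>\<omega>. X (s + h) \<omega> - X s \<omega>) = distr M borel (X h)"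
    and right_continuous:
      "\<And>\<omega> t. \<omega> \<in> space M \<Longrightarrow> 0 \<le> t \<Longrightarrow> continuous (at_right t) (\<lambda>s. X s \<omega>)"
    and left_limits:
      "\<And>\<omega> t. \<omega> \<in> space M \<Longrightarrow> 0 < t \<Longrightarrow> \<exists>l. ((\<lambda>s. X s \<omega>) \<longlongrightarrow> l) (at_left t)"

locale spectrally_positive_levy_process = levy_process +
  assumes no_negative_jumps:
    "AE \<omega> in M. \<forall>t>0. \<forall>l. ((\<lambda>s. X s \<omega>) \<longlongrightarrow> l) (at_left t) \<longrightarrow> l \<le> X t \<omega>"

text \<open>The whole path on \<open>[0,\<infinity>)\<close> as a random element of the product space.\<close>

definition trajectory :: "(real \<Rightarrow> 'a \<Rightarrow> real) \<Rightarrow> 'a \<Rightarrow> real \<Rightarrow> real" where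
  "trajectory X \<omega> = (\<lambda>t\<in>{0..}. X t \<omega>)"

abbreviation path_space :: "(real \<Rightarrow> real) measure" where
  "path_space \<equiv> Pi\<^sub>M {0..} (\<lambda>_. borel)"

text \<open>
  The library's \<open>indep_var\<close> only covers random elements with values in one and the same type.
\<close>

definition indep_random_elements ::
    "'a measure \<Rightarrow> 'b measure \<Rightarrow> ('a \<Rightarrow> 'b) \<Rightarrow> 'c measure \<Rightarrow> ('a \<Rightarrow> 'c) \<Rightarrow> bool" where
  "indep_random_elements M A Y B Z \<longleftrightarrow> Y \<in> measurable M A \<and> Z \<in> measurable M B \<and>
     prob_space.indep_set M (sets (vimage_algebra (space M) Y A)) (sets (vimage_algebra (space M) Z B))"

definition laplace_exponent :: "'a measure \<Rightarrow> (real \<Rightarrow> 'a \<Rightarrow> real) \<Rightarrow> real \<Rightarrow> real \<Rightarrow> real" where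
  "laplace_exponent M X c \<gamma> = ln (\<integral>\<omega>. exp (- \<gamma> * (X 1 \<omega> - c)) \<partial>M)"

definition piecewise_drift :: "real \<Rightarrow> real \<Rightarrow> real \<Rightarrow> real \<Rightarrow> real" where
  "piecewise_drift c1 c2 T t = (if t \<le> T then c1 * t else c2 * (t - T) + c1 * T)"

definition sup_before :: "(real \<Rightarrow> real) \<Rightarrow> ereal \<Rightarrow> ereal" where
  "sup_before f r = (SUP t\<in>{t. 0 \<le> t \<and> ereal t < r}. ereal (f t))"

text \<open>
  \<open>exp (- \<gamma> s)\<close> for \<open>\<gamma> > 0\<close>, with the usual convention for \<open>s = \<infinity>\<close>. The value \<open>-\<infinity>\<close> is the
  supremum over an empty time set and occurs with probability zero only.
\<close>

definition exp_neg :: "real \<Rightarrow> ereal \<Rightarrow> real" where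
  "exp_neg \<gamma> s = (if s = \<infinity> then 0 else exp (- \<gamma> * real_of_ereal s))"

text \<open>
  The quotient \<open>u x / v x\<close>, continued by continuity to the zeros of the denominator. Without this,
  \<open>x / 0 = 0\<close> would give removable singularities a wrong value.
\<close>

definition quot_ext :: "(real \<Rightarrow> real) \<Rightarrow> (real \<Rightarrow> real) \<Rightarrow> real \<Rightarrow> real" where
  "quot_ext u v x = (if v x = 0 then Lim (at x) (\<lambda>y. u y / v y) else u x / v x)"

text \<open>
  The inverse of a Laplace exponent \<open>\<phi>\<close> is represented by \<open>inv_into {0..} \<phi>\<close> at arguments \<open>q > 0\<close>.
  As \<open>\<phi>\<close> is convex on \<open>[0,\<infinity>)\<close> with \<open>\<phi> 0 = 0\<close>, the equation \<open>\<phi> \<gamma> = q\<close> has at most one solution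
  \<open>\<gamma> \<ge> 0\<close> for such \<open>q\<close>, even when \<open>\<phi>\<close> first decreases; so no choice is involved, and
  \<open>inv_into {0..} \<phi> q\<close> is the usual right inverse. A solution exists for every \<open>q > 0\<close> unless the
  process with drift is a subordinator.
\<close>

definition inverse_defined :: "(real \<Rightarrow> real) \<Rightarrow> bool" where
  "inverse_defined \<phi> \<longleftrightarrow> {0<..} \<subseteq> \<phi> ` {0..}"

end

(*
  The theorem is proved by discretising time with mesh 2^-n. For a random walk W with running
  maximum M and a geometric killing time, time reversal followed by the strong Markov property at
  the first passage below -x shows that M and M - W are independent, the latter having the law of
  the negative of the running minimum. In the limit, spectral positivity forbids overshoots below
  -x, so the tail of the negative of the infimum is multiplicative, hence exponential, with rate
  psi(q). Comparing with E exp(-gamma Y(e_q)) = q / (q - phi(gamma)) gives the transform of the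
  supremum at an exponential time for gamma < psi(q). The same independence evaluates the transform
  of max(S, Y + Z), where Z is the supremum of the process after the first leg; applied to two
  independent exponential clocks of one process it extends the formula to all gamma, and applied to
  the drifts c1 and c2 it gives the theorem. Part (i) is the limit V = infinity of the formula for
  deterministic V.
*)

theory Submission
  imports Defs
begin

section \<open>Wiener-Hopf factorisation for random walks\<close>

text \<open>The factorisation alone does not reach large \<gamma>: with r = psi(q) and I the
  infimum, E exp(- \<gamma> I) = r / (r - \<gamma>) becomes infinite at \<gamma> = r, and nothing
  can be divided out from there on. The remedy is that an Exp(q) time is an Exp(p) time, followed
  with probability (p - q) / p by an independent Exp(q) time. For p so large that \<gamma> < psi(p)
  this yields a linear equation for the transform at q. Its second unknown, the value at psi(p),
  comes from the same equation at \<gamma> = psi(q), where the coefficient q - phi(\<gamma>)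
  vanishes. Two more obstacles shape the development. Finiteness of phi is not among the hypotheses;
  it is extracted from the exponential law of the infimum, whose rate is unbounded in q. And the
  supremum runs over a time interval open at T + V, whereas the grid limits are taken over closed
  intervals; the two are compared through monotonicity in the length of the second leg. Expectations
  are kept in \<open>ennreal\<close> as long as infinite values can occur, and exp(- \<gamma> S) is
  treated as an infimum of exponentials.\<close>

definition walk :: "(nat \<Rightarrow> real) \<Rightarrow> nat \<Rightarrow> real" where
  "walk w k = (\<Sum>j<k. w j)"

definition walk_max :: "(nat \<Rightarrow> real) \<Rightarrow> nat \<Rightarrow> real" where
  "walk_max w k = Max (walk w ` {..k})"

definition walk_min :: "(nat \<Rightarrow> real) \<Rightarrow> nat \<Rightarrow> real" where
  "walk_min w k = Min (walk w ` {..k})"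

definition shift_seq :: "nat \<Rightarrow> (nat \<Rightarrow> real) \<Rightarrow> nat \<Rightarrow> real" where
  "shift_seq k w = (\<lambda>j. w (k + j))"

text \<open>Only the first \<open>k\<close> steps are reversed and all later ones stay in place, so
  that the map permutes the coordinates of the whole sequence and preserves the product law.\<close>

definition reverse_seq :: "nat \<Rightarrow> (nat \<Rightarrow> real) \<Rightarrow> nat \<Rightarrow> real" where
  "reverse_seq k w = (\<lambda>j. w (if j < k then k - 1 - j else j))"

definition first_below :: "real \<Rightarrow> (nat \<Rightarrow> real) \<Rightarrow> nat \<Rightarrow> bool" where
  "first_below x w j \<longleftrightarrow> walk w j < - x \<and> (\<forall>i<j. - x \<le> walk w i)"

text \<open>
  \<open>\<rho> ^ \<kappa>\<close> for the first passage time \<open>\<kappa>\<close> below \<open>- x\<close>, and \<open>0\<close> if there is none.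
\<close>

definition hit_discount :: "real \<Rightarrow> real \<Rightarrow> (nat \<Rightarrow> real) \<Rightarrow> ennreal" where
  "hit_discount \<rho> x w = (\<Squnion>k\<in>{k. walk w k < - x}. ennreal (\<rho> ^ k))"

section \<open>Walks, running extrema and first passage\<close>

lemma walk_0 [simp]: "walk w 0 = 0"
  by (simp add: walk_def)

lemma walk_max_0 [simp]: "walk_max w 0 = 0"
  by (simp add: walk_max_def)

lemma walk_min_0 [simp]: "walk_min w 0 = 0"
  by (simp add: walk_min_def)

lemma walk_max_Suc: "walk_max w (Suc k) = max (walk_max w k) (walk w (Suc k))"
  by (simp add: walk_max_def atMost_Suc max.commute)

lemma walk_min_Suc: "walk_min w (Suc k) = min (walk_min w k) (walk w (Suc k))"
  by (simp add: walk_min_def atMost_Suc min.commute)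

lemma walk_max_ge: "walk w k \<le> walk_max w k"
  by (auto simp: walk_max_def)

lemma walk_max_nonneg: "0 \<le> walk_max w k"
  unfolding walk_max_def by (rule Max_ge) (auto intro!: image_eqI[of _ _ 0])

lemma walk_comb: "j \<le> k \<Longrightarrow> walk (comb_seq k w w') j = walk w j"
  unfolding walk_def by (intro sum.cong) (auto simp: comb_seq_def)

lemma walk_max_comb: "j \<le> k \<Longrightarrow> walk_max (comb_seq k w w') j = walk_max w j"
  unfolding walk_max_def by (intro arg_cong[where f = Max] image_cong) (auto simp: walk_comb)

lemma walk_shift: "walk w (k + j) = walk w k + walk (shift_seq k w) j"
  by (induction j) (auto simp: walk_def shift_seq_def)

lemma shift_comb [simp]: "shift_seq k (comb_seq k w w') = w'"
  by (auto simp: shift_seq_def comb_seq_def)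

lemma first_below_comb: "first_below x (comb_seq k w w') k \<longleftrightarrow> first_below x w k"
  by (auto simp: first_below_def walk_comb)

lemma walk_min_less_iff: "walk_min w k < c \<longleftrightarrow> (\<exists>j\<le>k. walk w j < c)"
  by (auto simp: walk_min_def Min_less_iff)

lemma first_below_unique: "first_below x w i \<Longrightarrow> first_below x w j \<Longrightarrow> i = j"
  by (rule linorder_cases[of i j]) (auto simp: first_below_def)

text \<open>At its first passage below \<open>- x\<close> the walk sits at a new strict minimum, so
  every later minimum is attained from that time on and is counted from the current
  position.\<close>

lemma walk_min_shift:
  assumes "first_below x w j" "0 \<le> x"
  shows "walk_min w (j + i) = walk w j + walk_min (shift_seq j w) i"
proof (induction i)
  case 0
  have "walk_min w j = walk w j"
    unfolding walk_min_def using assms by (intro Min_eqI) (force simp: first_below_def le_less)+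
  then show ?case by simp
next
  case (Suc i)
  then show ?case by (simp add: walk_min_Suc) (simp add: walk_shift[of w j "Suc i", simplified] min_add_distrib_right)
qed

lemma ex_first_below:
  assumes "walk w k < - x"
  shows "\<exists>j\<le>k. first_below x w j"
proof (intro exI conjI)
  let ?j = "LEAST j. walk w j < - x"
  show "?j \<le> k" using assms by (rule Least_le)
  show "first_below x w ?j"
    unfolding first_below_def using assms by (auto intro: LeastI dest: not_less_Least simp: not_less)
qed

lemma hit_discount_first:
  assumes "first_below x w j" "0 \<le> \<rho>" "\<rho> \<le> 1"
  shows "hit_discount \<rho> x w = ennreal (\<rho> ^ j)"
  unfolding hit_discount_def
proof (rule antisym)
  show "(\<Squnion>k\<in>{k. walk w k < - x}. ennreal (\<rho> ^ k)) \<le> ennreal (\<rho> ^ j)"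
  proof (rule SUP_least)
    fix k assume "k \<in> {k. walk w k < - x}"
    then have "j \<le> k" using assms(1) by (force simp: first_below_def not_less[symmetric])
    then show "ennreal (\<rho> ^ k) \<le> ennreal (\<rho> ^ j)"
      using assms by (intro ennreal_leI power_decreasing) auto
  qed
  show "ennreal (\<rho> ^ j) \<le> (\<Squnion>k\<in>{k. walk w k < - x}. ennreal (\<rho> ^ k))"
    using assms by (intro SUP_upper) (auto simp: first_below_def)
qed

lemma hit_discount_none:
  assumes "\<And>j. \<not> first_below x w j"
  shows "hit_discount \<rho> x w = 0"
proof -
  have "{k. walk w k < - x} = {}" using ex_first_below[of w _ x] assms by blast
  then show ?thesis by (simp add: hit_discount_def bot_ennreal)
qed

text \<open>The first passage time is unique, so at most one summand is non-zero. In this form the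
  expectation can be taken term by term and each event depends on finitely many steps.\<close>

lemma hit_discount_eq_suminf:
  assumes "0 \<le> \<rho>" "\<rho> \<le> 1"
  shows "hit_discount \<rho> x w = (\<Sum>j. ennreal (\<rho> ^ j) * indicator {w. first_below x w j} w)"
proof (cases "\<exists>j. first_below x w j")
  case True
  then obtain j where j: "first_below x w j" ..
  have "(\<Sum>i. ennreal (\<rho> ^ i) * indicator {w. first_below x w i} w) =
      (\<Sum>i\<in>{j}. ennreal (\<rho> ^ i) * indicator {w. first_below x w i} w)"
    using first_below_unique[OF j] by (intro suminf_finite) (auto simp: indicator_def)
  then show ?thesis using hit_discount_first[OF j assms] j by simp
next
  case False
  then show ?thesis by (simp add: hit_discount_none)
qed

lemma hit_discount_mono: "x \<le> y \<Longrightarrow> hit_discount \<rho> y w \<le> hit_discount \<rho> x w"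
  unfolding hit_discount_def by (intro SUP_subset_mono) auto

text \<open>The Cauchy product for non-negative terms: Fubini for counting measures exchanges the
  sums over \<open>k\<close> and \<open>j\<close>, and the inner sum is then shifted by
  \<open>j\<close>.\<close>

lemma ennreal_suminf_convolution:
  fixes a b :: "nat \<Rightarrow> ennreal"
  shows "(\<Sum>k. \<Sum>j\<le>k. a j * b (k - j)) = (\<Sum>j. a j) * (\<Sum>i. b i)"
proof -
  have "(\<Sum>k. \<Sum>j\<le>k. a j * b (k - j)) = (\<Sum>k. \<Sum>j. (if j \<le> k then a j * b (k - j) else 0))"
    by (intro suminf_cong, subst suminf_finite[of "{..k}" for k]) (auto intro!: sum.cong)
  also have "\<dots> = (\<integral>\<^sup>+k. (\<integral>\<^sup>+j. (if j \<le> k then a j * b (k - j) else 0) \<partial>count_space UNIV) \<partial>count_space UNIV)"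
    by (simp add: nn_integral_count_space_nat)
  also have "\<dots> = (\<integral>\<^sup>+j. (\<integral>\<^sup>+k. (if j \<le> k then a j * b (k - j) else 0) \<partial>count_space UNIV) \<partial>count_space UNIV)"
    by (rule pair_sigma_finite.Fubini'[symmetric])
       (auto intro!: pair_sigma_finite.intro sigma_finite_measure_count_space simp: pair_measure_countable)
  also have "\<dots> = (\<Sum>j. \<Sum>k. (if j \<le> k then a j * b (k - j) else 0))"
    by (simp add: nn_integral_count_space_nat)
  also have "\<dots> = (\<Sum>j. a j * (\<Sum>i. b i))"
  proof (intro suminf_cong)
    fix j
    have "(\<Sum>k. (if j \<le> k then a j * b (k - j) else 0)) = (\<Sum>i. a j * b i)"
      using suminf_offset[of "\<lambda>k. if j \<le> k then a j * b (k - j) else 0" j] by simp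
    then show "(\<Sum>k. (if j \<le> k then a j * b (k - j) else 0)) = a j * (\<Sum>i. b i)" by simp
  qed
  finally show ?thesis by simp
qed

section \<open>Walks with independent, identically distributed steps\<close>

locale random_walk = sequence_space M for M :: "real measure" +
  assumes sets_step [measurable_cong]: "sets M = sets borel"
begin

lemma measurable_coord [measurable]: "(\<lambda>w. w j) \<in> borel_measurable S"
proof -
  have "(\<lambda>w. w j) \<in> measurable S M" by measurable
  then show ?thesis using measurable_cong_sets[OF refl sets_step] by blast
qed

lemma measurable_into_S:
  assumes "\<And>j. (\<lambda>w. f w j) \<in> borel_measurable N"
  shows "f \<in> measurable N S"
proof -
  have "space M = UNIV" using sets_eq_imp_space_eq[OF sets_step] by simp
  then show ?thesis
    by (intro measurable_PiM_single') (auto simp: measurable_cong_sets[OF refl sets_step] assms)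
qed

lemma measurable_walk [measurable]: "(\<lambda>w. walk w k) \<in> borel_measurable S"
  unfolding walk_def by measurable

lemma measurable_walk_max [measurable]: "(\<lambda>w. walk_max w k) \<in> borel_measurable S"
  by (induction k) (simp_all add: walk_max_Suc)

lemma measurable_walk_min [measurable]: "(\<lambda>w. walk_min w k) \<in> borel_measurable S"
  by (induction k) (simp_all add: walk_min_Suc)

lemma measurable_shift [measurable]: "shift_seq k \<in> measurable S S"
  unfolding shift_seq_def by (rule measurable_into_S) measurable

lemma measurable_reverse [measurable]: "reverse_seq k \<in> measurable S S"
  unfolding reverse_seq_def by (rule measurable_into_S) measurable

lemma measurable_first_below [measurable]: "Measurable.pred S (\<lambda>w. first_below x w j)"
  unfolding first_below_def by measurable

lemma measurable_hit_discount [measurable (raw)]: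
  assumes [measurable]: "f \<in> borel_measurable N" "g \<in> measurable N S"
  shows "(\<lambda>a. hit_discount \<rho> (f a) (g a)) \<in> borel_measurable N"
proof -
  \<comment> \<open>The index set of the defining supremum depends on the path and the level.
    Extending it to all \<open>k\<close>, with value 0 where the walk is not below the level, turns
    it into a countable supremum of measurable functions.\<close>
  have "hit_discount \<rho> x w = (\<Squnion>k. if walk w k < - x then ennreal (\<rho> ^ k) else 0)" (is "?l = ?r") for x w
  proof (rule antisym)
    show "?l \<le> ?r"
      unfolding hit_discount_def
    proof (rule SUP_least)
      fix k assume "k \<in> {k. walk w k < - x}"
      then show "ennreal (\<rho> ^ k) \<le> ?r" by (intro SUP_upper2[of k]) auto
    qed
    show "?r \<le> ?l"
      unfolding hit_discount_def by (rule SUP_least) (auto intro: SUP_upper)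
  qed
  then have eq: "(\<lambda>a. hit_discount \<rho> (f a) (g a)) =
      (\<lambda>a. \<Squnion>k. if walk (g a) k < - f a then ennreal (\<rho> ^ k) else 0)"
    by blast
  show ?thesis unfolding eq by measurable
qed

lemma measurable_nn_integral_hit_discount [measurable]:
  "(\<lambda>x. \<integral>\<^sup>+w. hit_discount \<rho> x w \<partial>S) \<in> borel_measurable borel"
proof (rule borel_measurable_nn_integral)
  show "(\<lambda>(x, w). hit_discount \<rho> x w) \<in> borel_measurable (borel \<Otimes>\<^sub>M S)"
    unfolding split_beta' by (rule measurable_hit_discount) measurable
qed

section \<open>Time reversal and independence of past and future\<close>

lemma distr_reverse: "distr S S (reverse_seq k) = S"
proof -
  have "distr (PiM UNIV (\<lambda>_. M)) (PiM UNIV (\<lambda>_. M)) (\<lambda>w. \<lambda>n\<in>UNIV. w (if n < k then k - 1 - n else n)) = PiM (UNIV :: nat set) (\<lambda>_. M)"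
    by (rule distr_PiM_reindex[where f = "\<lambda>n. if n < k then k - 1 - n else n" and M = "\<lambda>_. M" and K = UNIV])
       (auto simp: inj_on_def prob_space_axioms M.prob_space_axioms)
  moreover have "(\<lambda>w. \<lambda>n\<in>UNIV. w (if n < k then k - 1 - n else n)) = reverse_seq k"
    by (auto simp: reverse_seq_def fun_eq_iff)
  ultimately show ?thesis by simp
qed

lemma walk_reverse: "j \<le> k \<Longrightarrow> walk (reverse_seq k w) j = walk w k - walk w (k - j)"
proof (induction j)
  case (Suc j)
  then have "walk w (k - j) = walk w (k - Suc j) + w (k - Suc j)"
    by (simp add: walk_def Suc_diff_Suc flip: sum.lessThan_Suc)
  with Suc show ?case by (simp add: walk_def) (simp add: reverse_seq_def)
qed simp

text \<open>The reversed walk at time \<open>j\<close> is W_k - W_(k - j). Maximising over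
  \<open>j\<close> subtracts the smallest value of the original walk.\<close>

lemma walk_max_reverse: "walk_max (reverse_seq k w) k = walk w k - walk_min w k"
proof -
  obtain j where j: "j \<le> k" "walk_min w k = walk w j"
  proof -
    have "walk_min w k \<in> walk w ` {..k}" unfolding walk_min_def by (rule Min_in) auto
    then show ?thesis using that by auto
  qed
  have le: "walk_min w k \<le> walk w i" if "i \<le> k" for i
    using that by (auto simp: walk_min_def)
  show ?thesis
    unfolding walk_max_def
  proof (rule Max_eqI)
    show "y \<le> walk w k - walk_min w k" if "y \<in> walk (reverse_seq k w) ` {..k}" for y
      using that le by (auto simp: walk_reverse)
    show "walk w k - walk_min w k \<in> walk (reverse_seq k w) ` {..k}"
      using j by (auto intro!: image_eqI[of _ _ "k - j"] simp: walk_reverse)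
  qed simp
qed

lemma nn_integral_reverse:
  assumes [measurable]: "f \<in> borel_measurable (borel \<Otimes>\<^sub>M borel)"
  shows "(\<integral>\<^sup>+w. f (walk_max w k, walk w k) \<partial>S) = (\<integral>\<^sup>+w. f (walk w k - walk_min w k, walk w k) \<partial>S)"
proof -
  have "(\<integral>\<^sup>+w. f (walk_max w k, walk w k) \<partial>S) = (\<integral>\<^sup>+w. f (walk_max w k, walk w k) \<partial>distr S S (reverse_seq k))"
    by (simp only: distr_reverse)
  also have "\<dots> = (\<integral>\<^sup>+w. f (walk_max (reverse_seq k w) k, walk (reverse_seq k w) k) \<partial>S)"
    by (subst nn_integral_distr) auto
  finally show ?thesis by (simp add: walk_max_reverse walk_reverse)
qed

text \<open>Gluing the first \<open>k\<close> coordinates of one sequence in front of an independent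
  one preserves the product law. The condition on \<open>G\<close> says that its first argument is
  read only up to \<open>k\<close>, so it cannot see the glued tail, while the shifted sequence is
  exactly that tail.\<close>

lemma nn_integral_split:
  assumes [measurable]: "G \<in> borel_measurable (S \<Otimes>\<^sub>M S)"
    and G: "\<And>w w' w''. G (comb_seq k w w', w'') = G (w, w'')"
  shows "(\<integral>\<^sup>+w. G (w, shift_seq k w) \<partial>S) = (\<integral>\<^sup>+w'. (\<integral>\<^sup>+w. G (w, w') \<partial>S) \<partial>S)"
proof -
  interpret SS: pair_sigma_finite S S by unfold_locales
  have "(\<integral>\<^sup>+w. G (w, shift_seq k w) \<partial>S) =
      (\<integral>\<^sup>+w. G (w, shift_seq k w) \<partial>distr (S \<Otimes>\<^sub>M S) S (\<lambda>(w, w'). comb_seq k w w'))"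
    by (simp only: PiM_comb_seq)
  also have "\<dots> = (\<integral>\<^sup>+p. G (case p of (w, w') \<Rightarrow> (w, w')) \<partial>(S \<Otimes>\<^sub>M S))"
    by (subst nn_integral_distr[OF measurable_comb_seq]) (auto intro!: nn_integral_cong simp: G)
  also have "\<dots> = (\<integral>\<^sup>+w'. (\<integral>\<^sup>+w. G (w, w') \<partial>S) \<partial>S)"
    by (subst SS.nn_integral_snd[symmetric]) auto
  finally show ?thesis .
qed

text \<open>The event is decided by the first \<open>j\<close> steps and the shifted sequence by the
  remaining ones, hence the product.\<close>

lemma nn_integral_first_below:
  assumes [measurable]: "f \<in> borel_measurable S"
  shows "(\<integral>\<^sup>+w. indicator {w. first_below x w j} w * f (shift_seq j w) \<partial>S) =
    (\<integral>\<^sup>+w. indicator {w. first_below x w j} w \<partial>S) * (\<integral>\<^sup>+w. f w \<partial>S)"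
proof -
  have "(\<integral>\<^sup>+w. indicator {w. first_below x w j} w * f (shift_seq j w) \<partial>S) =
      (\<integral>\<^sup>+w'. (\<integral>\<^sup>+w. indicator {w. first_below x w j} w * f w' \<partial>S) \<partial>S)"
    using nn_integral_split[of "\<lambda>(w, w'). indicator {w. first_below x w j} w * f w'" j]
    by (simp add: first_below_comb indicator_def)
  also have "\<dots> = (\<integral>\<^sup>+w'. (\<integral>\<^sup>+w. indicator {w. first_below x w j} w \<partial>S) * f w' \<partial>S)"
    by (intro nn_integral_cong nn_integral_multc) measurable
  also have "\<dots> = (\<integral>\<^sup>+w. indicator {w. first_below x w j} w \<partial>S) * (\<integral>\<^sup>+w. f w \<partial>S)"
    by (rule nn_integral_cmult) measurable
  finally show ?thesis .
qed

section \<open>Factorisation at the first passage\<close>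

lemma nn_integral_hit_discount:
  assumes "0 \<le> \<rho>" "\<rho> \<le> 1"
  shows "(\<integral>\<^sup>+w. hit_discount \<rho> x w \<partial>S) =
    (\<Sum>j. ennreal (\<rho> ^ j) * (\<integral>\<^sup>+w. indicator {w. first_below x w j} w \<partial>S))"
proof -
  have "(\<integral>\<^sup>+w. hit_discount \<rho> x w \<partial>S) = (\<Sum>j. \<integral>\<^sup>+w. ennreal (\<rho> ^ j) * indicator {w. first_below x w j} w \<partial>S)"
    unfolding hit_discount_eq_suminf[OF assms] by (rule nn_integral_suminf) measurable
  then show ?thesis by (subst (asm) nn_integral_cmult) auto
qed

text \<open>After the cut at the first passage \<open>j\<close>, the distance of the walk from its
  minimum at time \<open>k\<close> is the same quantity for the \<open>k - j\<close> steps after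
  \<open>j\<close>. Summed over \<open>k\<close> with geometric weights this is a Cauchy product,
  which separates the two factors. A second reversal turns the distance from the minimum back into
  the running maximum.\<close>

lemma wiener_hopf_indicator:
  fixes u :: "real \<Rightarrow> ennreal"
  assumes [measurable]: "u \<in> borel_measurable borel" and x: "0 \<le> x" and \<rho>: "0 \<le> \<rho>" "\<rho> \<le> 1"
  shows "(\<Sum>k. ennreal (\<rho> ^ k) * (\<integral>\<^sup>+w. u (walk_max w k) * indicator {x<..} (walk_max w k - walk w k) \<partial>S)) =
    (\<integral>\<^sup>+w. hit_discount \<rho> x w \<partial>S) * (\<Sum>k. ennreal (\<rho> ^ k) * (\<integral>\<^sup>+w. u (walk_max w k) \<partial>S))"
proof -
  define a where "a j = ennreal (\<rho> ^ j) * (\<integral>\<^sup>+w. indicator {w. first_below x w j} w \<partial>S)" for j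
  define b where "b i = ennreal (\<rho> ^ i) * (\<integral>\<^sup>+w. u (walk w i - walk_min w i) \<partial>S)" for i
  have *: "ennreal (\<rho> ^ k) * (\<integral>\<^sup>+w. u (walk_max w k) * indicator {x<..} (walk_max w k - walk w k) \<partial>S) =
      (\<Sum>j\<le>k. a j * b (k - j))" for k
  proof -
    \<comment> \<open>Pathwise: exactly one indicator on the right is 1 if the minimum up to
      \<open>k\<close> lies below \<open>- x\<close>, and none otherwise.\<close>
    have pw: "u (walk w k - walk_min w k) * indicator {x<..} (- walk_min w k) =
       (\<Sum>j\<le>k. indicator {w. first_below x w j} w *
          (\<lambda>w. u (walk w (k - j) - walk_min w (k - j))) (shift_seq j w))" for w
    proof (cases "\<exists>j\<le>k. first_below x w j")
      case True
      then obtain j where j: "j \<le> k" "first_below x w j" by blast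
      have "walk_min w k < - x" using j by (auto simp: walk_min_less_iff first_below_def)
      moreover have "walk w k - walk_min w k = walk (shift_seq j w) (k - j) - walk_min (shift_seq j w) (k - j)"
        using walk_min_shift[OF j(2) x, of "k - j"] walk_shift[of w j "k - j"] j(1) by simp
      moreover have "indicator {w. first_below x w i} w = (if i = j then 1 else 0 :: ennreal)" for i
        using first_below_unique[OF j(2), of i] j(2) by (cases "i = j") (auto simp: indicator_def)
      ultimately show ?thesis using j(1) by (simp add: if_distrib[of "\<lambda>x. x * _"] cong: if_cong)
    next
      case False
      then have "\<not> walk_min w k < - x"
        using ex_first_below[of w _ x] by (auto simp: walk_min_less_iff) (meson le_trans)
      with False show ?thesis by (simp add: indicator_def)
    qed
    have "(\<integral>\<^sup>+w. u (walk_max w k) * indicator {x<..} (walk_max w k - walk w k) \<partial>S) =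
        (\<integral>\<^sup>+w. u (walk w k - walk_min w k) * indicator {x<..} (- walk_min w k) \<partial>S)"
      using nn_integral_reverse[of "\<lambda>(m, y). u m * indicator {x<..} (m - y)" k] by simp
    also have "\<dots> = (\<Sum>j\<le>k. \<integral>\<^sup>+w. indicator {w. first_below x w j} w *
          (\<lambda>w. u (walk w (k - j) - walk_min w (k - j))) (shift_seq j w) \<partial>S)"
      unfolding pw by (rule nn_integral_sum) measurable
    also have "\<dots> = (\<Sum>j\<le>k. (\<integral>\<^sup>+w. indicator {w. first_below x w j} w \<partial>S) *
          (\<integral>\<^sup>+w. u (walk w (k - j) - walk_min w (k - j)) \<partial>S))"
      by (intro sum.cong refl nn_integral_first_below) measurable
    finally have eq: "(\<integral>\<^sup>+w. u (walk_max w k) * indicator {x<..} (walk_max w k - walk w k) \<partial>S) = \<dots>" .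
    have pow: "ennreal (\<rho> ^ k) = ennreal (\<rho> ^ j) * ennreal (\<rho> ^ (k - j))" if "j \<le> k" for j
      using that \<rho> by (simp flip: ennreal_mult' power_add)
    show ?thesis
      unfolding eq a_def b_def sum_distrib_left
      by (rule sum.cong) (auto simp: pow mult_ac)
  qed
  have b: "b = (\<lambda>k. ennreal (\<rho> ^ k) * (\<integral>\<^sup>+w. u (walk_max w k) \<partial>S))"
    unfolding b_def using nn_integral_reverse[of "\<lambda>(m, y). u m"] by simp
  have a: "a = (\<lambda>j. ennreal (\<rho> ^ j) * (\<integral>\<^sup>+w. indicator {w. first_below x w j} w \<partial>S))"
    unfolding a_def ..
  show ?thesis
    unfolding * ennreal_suminf_convolution nn_integral_hit_discount[OF \<rho>]
    by (simp only: a[symmetric] b[symmetric])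
qed

text \<open>The strong Markov property at the first passage below \<open>- x\<close>: the discount
  collected up to that time is independent of the walk that starts afresh there.\<close>

lemma renewal:
  assumes [measurable]: "f \<in> borel_measurable S" and \<rho>: "0 \<le> \<rho>" "\<rho> \<le> 1"
  shows "(\<integral>\<^sup>+w. (\<Sum>j. ennreal (\<rho> ^ j) * (indicator {w. first_below x w j} w * f (shift_seq j w))) \<partial>S) =
    (\<integral>\<^sup>+w. hit_discount \<rho> x w \<partial>S) * (\<integral>\<^sup>+w. f w \<partial>S)"
proof -
  have "(\<integral>\<^sup>+w. (\<Sum>j. ennreal (\<rho> ^ j) * (indicator {w. first_below x w j} w * f (shift_seq j w))) \<partial>S) =
      (\<Sum>j. ennreal (\<rho> ^ j) * (\<integral>\<^sup>+w. indicator {w. first_below x w j} w * f (shift_seq j w) \<partial>S))"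
    by (subst nn_integral_suminf) (auto simp: nn_integral_cmult)
  then show ?thesis
    unfolding nn_integral_hit_discount[OF \<rho>] by (simp add: nn_integral_first_below flip: mult.assoc)
qed

text \<open>A passage below \<open>- x\<close> followed by a further descent of more than
  \<open>y\<close> ends below \<open>- (x + y)\<close>. The discounts of the two legs multiply, and
  the actual passage below \<open>- (x + y)\<close> can only come earlier.\<close>

lemma hit_discount_supermultiplicative:
  assumes "0 \<le> x" "0 \<le> y" and \<rho>: "0 \<le> \<rho>" "\<rho> \<le> 1"
  shows "(\<integral>\<^sup>+w. hit_discount \<rho> x w \<partial>S) * (\<integral>\<^sup>+w. hit_discount \<rho> y w \<partial>S)
    \<le> (\<integral>\<^sup>+w. hit_discount \<rho> (x + y) w \<partial>S)"
proof -
  have "(\<Sum>j. ennreal (\<rho> ^ j) * (indicator {w. first_below x w j} w * hit_discount \<rho> y (shift_seq j w)))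
      \<le> hit_discount \<rho> (x + y) w" for w
  proof (cases "\<exists>j. first_below x w j")
    case True
    then obtain j where j: "first_below x w j" ..
    have ind: "indicator {w. first_below x w i} w = (if i = j then 1 else 0 :: ennreal)" for i
      using first_below_unique[OF j, of i] j by (cases "i = j") (auto simp: indicator_def)
    have "(\<Sum>i. ennreal (\<rho> ^ i) * (indicator {w. first_below x w i} w * hit_discount \<rho> y (shift_seq i w))) =
        ennreal (\<rho> ^ j) * hit_discount \<rho> y (shift_seq j w)"
      unfolding ind by (subst suminf_finite[of "{j}"]) auto
    also have "\<dots> \<le> hit_discount \<rho> (x + y) w"
      unfolding hit_discount_def SUP_mult_left_ennreal
    proof (rule SUP_least)
      fix k assume "k \<in> {k. walk (shift_seq j w) k < - y}"
      then have "walk w (j + k) < - (x + y)"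
        using j by (auto simp: walk_shift first_below_def)
      then show "ennreal (\<rho> ^ j) * ennreal (\<rho> ^ k) \<le> (\<Squnion>k\<in>{k. walk w k < - (x + y)}. ennreal (\<rho> ^ k))"
        using \<rho> by (intro SUP_upper2[of "j + k"]) (auto simp: ennreal_mult power_add)
    qed
    finally show ?thesis .
  qed simp
  then show ?thesis
    unfolding renewal[OF _ \<rho>, symmetric, of "hit_discount \<rho> y", simplified] by (intro nn_integral_mono)
qed

text \<open>The error term is the contribution of paths that overshoot the level by more than \<open>\<epsilon>\<close>.\<close>

lemma hit_discount_submultiplicative:
  assumes "0 \<le> x" "0 \<le> y" "0 \<le> \<epsilon>" and \<rho>: "0 \<le> \<rho>" "\<rho> \<le> 1"
  shows "(\<integral>\<^sup>+w. hit_discount \<rho> (x + y + \<epsilon>) w \<partial>S) \<le>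
    (\<integral>\<^sup>+w. hit_discount \<rho> x w \<partial>S) * (\<integral>\<^sup>+w. hit_discount \<rho> y w \<partial>S) +
    (\<integral>\<^sup>+w. hit_discount \<rho> x w * indicator {w. hit_discount \<rho> x w = hit_discount \<rho> (x + \<epsilon>) w} w \<partial>S)"
proof -
  have "hit_discount \<rho> (x + y + \<epsilon>) w \<le>
      (\<Sum>j. ennreal (\<rho> ^ j) * (indicator {w. first_below x w j} w * hit_discount \<rho> y (shift_seq j w))) +
      hit_discount \<rho> x w * indicator {w. hit_discount \<rho> x w = hit_discount \<rho> (x + \<epsilon>) w} w" for w
  proof (cases "\<exists>j. first_below x w j")
    case True
    then obtain j where j: "first_below x w j" ..
    show ?thesis
    proof (cases "- x - \<epsilon> \<le> walk w j")
      \<comment> \<open>Overshoot at most \<open>\<epsilon>\<close>: to get below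
        \<open>- (x + y + \<epsilon>)\<close> the walk still has to descend by more than
        \<open>y\<close> after time \<open>j\<close>.\<close>
      case True
      have ind: "indicator {w. first_below x w i} w = (if i = j then 1 else 0 :: ennreal)" for i
        using first_below_unique[OF j, of i] j by (cases "i = j") (auto simp: indicator_def)
      have "hit_discount \<rho> (x + y + \<epsilon>) w \<le> ennreal (\<rho> ^ j) * hit_discount \<rho> y (shift_seq j w)"
        unfolding hit_discount_def SUP_mult_left_ennreal
      proof (rule SUP_least)
        fix k assume k: "k \<in> {k. walk w k < - (x + y + \<epsilon>)}"
        then have "j \<le> k" using j assms by (force simp: first_below_def not_less[symmetric])
        then have "walk w k = walk w j + walk (shift_seq j w) (k - j)"
          using walk_shift[of w j "k - j"] by simp
        then have "walk (shift_seq j w) (k - j) < - y" using k True by simp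
        then show "ennreal (\<rho> ^ k) \<le> (\<Squnion>k\<in>{k. walk (shift_seq j w) k < - y}. ennreal (\<rho> ^ j) * ennreal (\<rho> ^ k))"
          using \<rho> \<open>j \<le> k\<close> by (intro SUP_upper2[of "k - j"]) (auto simp flip: ennreal_mult' power_add)
      qed
      also have "\<dots> = (\<Sum>i. ennreal (\<rho> ^ i) * (indicator {w. first_below x w i} w * hit_discount \<rho> y (shift_seq i w)))"
        unfolding ind by (subst suminf_finite[of "{j}"]) auto
      finally show ?thesis by (simp add: add_increasing2)
    next
      \<comment> \<open>A single step passes both levels, so the two discounts coincide and the
        error term accounts for the whole path.\<close>
      case False
      then have "first_below (x + \<epsilon>) w j" using j assms by (auto simp: first_below_def)
      then have "hit_discount \<rho> x w = hit_discount \<rho> (x + \<epsilon>) w"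
        using j \<rho> by (simp add: hit_discount_first)
      then show ?thesis
        using hit_discount_mono[of x "x + y + \<epsilon>" \<rho> w] assms by (simp add: add_increasing)
    qed
  next
    case False
    then show ?thesis
      using hit_discount_mono[of x "x + y + \<epsilon>" \<rho> w] assms by (simp add: hit_discount_none)
  qed
  moreover have [measurable]: "Measurable.pred S (\<lambda>w. hit_discount \<rho> x w = hit_discount \<rho> (x + \<epsilon>) w)"
    unfolding pred_def by (intro borel_measurable_eq measurable_hit_discount) measurable
  ultimately show ?thesis
    unfolding renewal[OF _ \<rho>, symmetric, of "hit_discount \<rho> y", simplified]
    by (subst nn_integral_add[symmetric]) (auto intro!: nn_integral_mono)
qed

text \<open>The hypothesis on \<open>v\<close> writes it as a constant plus a mixture of the
  indicators of \<open>{x<..}\<close>. By Tonelli the mixture is taken outside,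
  \<open>wiener_hopf_indicator\<close> applies for each level, and every indicator is replaced by
  the expected discount at that level.\<close>

lemma wiener_hopf:
  fixes u v wt :: "real \<Rightarrow> ennreal"
  assumes [measurable]: "u \<in> borel_measurable borel" "wt \<in> borel_measurable borel"
    and \<rho>: "0 \<le> \<rho>" "\<rho> \<le> 1"
    and v: "\<And>d. 0 \<le> d \<Longrightarrow> v d = v0 + (\<integral>\<^sup>+x. wt x * indicator {0..} x * indicator {x<..} d \<partial>lborel)"
  shows "(\<Sum>k. ennreal (\<rho> ^ k) * (\<integral>\<^sup>+w. u (walk_max w k) * v (walk_max w k - walk w k) \<partial>S)) =
    (v0 + (\<integral>\<^sup>+x. wt x * indicator {0..} x * (\<integral>\<^sup>+w. hit_discount \<rho> x w \<partial>S) \<partial>lborel)) *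
    (\<Sum>k. ennreal (\<rho> ^ k) * (\<integral>\<^sup>+w. u (walk_max w k) \<partial>S))"
proof -
  interpret LS: pair_sigma_finite lborel S ..
  have [measurable]: "Measurable.pred (borel \<Otimes>\<^sub>M S) (\<lambda>p. walk_max (snd p) k - walk (snd p) k \<in> {fst p <..})" for k
    unfolding greaterThan_iff by measurable
  define I where "I k x = (\<integral>\<^sup>+w. u (walk_max w k) * indicator {x<..} (walk_max w k - walk w k) \<partial>S)" for k x
  have [measurable]: "I k \<in> borel_measurable borel" for k
    unfolding I_def indicator_def by measurable
  have 1: "(\<integral>\<^sup>+w. u (walk_max w k) * v (walk_max w k - walk w k) \<partial>S) =
      v0 * (\<integral>\<^sup>+w. u (walk_max w k) \<partial>S) + (\<integral>\<^sup>+x. wt x * indicator {0..} x * I k x \<partial>lborel)" for k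
  proof -
    have "(\<integral>\<^sup>+w. u (walk_max w k) * v (walk_max w k - walk w k) \<partial>S) =
      (\<integral>\<^sup>+w. v0 * u (walk_max w k) + (\<integral>\<^sup>+x. wt x * indicator {0..} x *
        (u (walk_max w k) * indicator {x<..} (walk_max w k - walk w k)) \<partial>lborel) \<partial>S)"
    proof (rule nn_integral_cong)
      fix w
      have "u (walk_max w k) * v (walk_max w k - walk w k) = v0 * u (walk_max w k) +
        u (walk_max w k) * (\<integral>\<^sup>+x. wt x * indicator {0..} x * indicator {x<..} (walk_max w k - walk w k) \<partial>lborel)"
        by (subst v) (auto simp: walk_max_ge algebra_simps)
      then show "u (walk_max w k) * v (walk_max w k - walk w k) = v0 * u (walk_max w k) + (\<integral>\<^sup>+x. wt x * indicator {0..} x *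
        (u (walk_max w k) * indicator {x<..} (walk_max w k - walk w k)) \<partial>lborel)"
        by (subst (asm) nn_integral_cmult[symmetric]) (auto simp: mult_ac indicator_def)
    qed
    also have "\<dots> = v0 * (\<integral>\<^sup>+w. u (walk_max w k) \<partial>S) + (\<integral>\<^sup>+w. (\<integral>\<^sup>+x. wt x * indicator {0..} x *
        (u (walk_max w k) * indicator {x<..} (walk_max w k - walk w k)) \<partial>lborel) \<partial>S)"
      unfolding indicator_def by (subst nn_integral_add) (auto simp: nn_integral_cmult)
    also have "(\<integral>\<^sup>+w. (\<integral>\<^sup>+x. wt x * indicator {0..} x *
        (u (walk_max w k) * indicator {x<..} (walk_max w k - walk w k)) \<partial>lborel) \<partial>S) =
        (\<integral>\<^sup>+x. (\<integral>\<^sup>+w. wt x * indicator {0..} x *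
        (u (walk_max w k) * indicator {x<..} (walk_max w k - walk w k)) \<partial>S) \<partial>lborel)"
      unfolding indicator_def by (subst LS.Fubini') (auto simp: split_beta')
    also have "\<dots> = (\<integral>\<^sup>+x. wt x * indicator {0..} x * I k x \<partial>lborel)"
      unfolding I_def indicator_def by (intro nn_integral_cong nn_integral_cmult) auto
    finally show ?thesis .
  qed
  have "(\<Sum>k. ennreal (\<rho> ^ k) * (\<integral>\<^sup>+w. u (walk_max w k) * v (walk_max w k - walk w k) \<partial>S)) =
    (\<Sum>k. v0 * (ennreal (\<rho> ^ k) * (\<integral>\<^sup>+w. u (walk_max w k) \<partial>S))) +
    (\<Sum>k. (\<integral>\<^sup>+x. wt x * indicator {0..} x * (ennreal (\<rho> ^ k) * I k x) \<partial>lborel))"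
    unfolding 1 by (subst suminf_add) (auto simp: algebra_simps simp flip: nn_integral_cmult)
  also have "(\<Sum>k. (\<integral>\<^sup>+x. wt x * indicator {0..} x * (ennreal (\<rho> ^ k) * I k x) \<partial>lborel)) =
    (\<integral>\<^sup>+x. wt x * indicator {0..} x * (\<Sum>k. ennreal (\<rho> ^ k) * I k x) \<partial>lborel)"
    by (subst nn_integral_suminf[symmetric]) auto
  also have "\<dots> = (\<integral>\<^sup>+x. wt x * indicator {0..} x * (\<integral>\<^sup>+w. hit_discount \<rho> x w \<partial>S) *
     (\<Sum>k. ennreal (\<rho> ^ k) * (\<integral>\<^sup>+w. u (walk_max w k) \<partial>S)) \<partial>lborel)"
    unfolding I_def using wiener_hopf_indicator[OF _ _ \<rho>, of u]
    by (intro nn_integral_cong) (auto simp: indicator_def mult_ac)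
  also have "\<dots> = (\<integral>\<^sup>+x. wt x * indicator {0..} x * (\<integral>\<^sup>+w. hit_discount \<rho> x w \<partial>S) \<partial>lborel) *
     (\<Sum>k. ennreal (\<rho> ^ k) * (\<integral>\<^sup>+w. u (walk_max w k) \<partial>S))"
    by (rule nn_integral_multc) simp
  finally show ?thesis by (simp add: distrib_right)
qed

end

section \<open>Dyadic grids and exponential weights\<close>

lemma continuous_at_right_eps:
  fixes g :: "real \<Rightarrow> real"
  assumes "continuous (at_right t) g" "0 < e"
  obtains d where "0 < d" "\<And>s. t \<le> s \<Longrightarrow> s < t + d \<Longrightarrow> \<bar>g s - g t\<bar> < e"
proof -
  have "\<forall>\<^sub>F s in at_right t. dist (g s) (g t) < e"
    using assms by (auto simp: continuous_within tendsto_iff)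
  then obtain b where b: "t < b" "\<And>s. t < s \<Longrightarrow> s < b \<Longrightarrow> dist (g s) (g t) < e"
    by (auto simp: eventually_at_right_field)
  show thesis
  proof (rule that[of "b - t"])
    show "\<bar>g s - g t\<bar> < e" if "t \<le> s" "s < t + (b - t)" for s
      using b(2)[of s] that \<open>0 < e\<close> by (cases "s = t") (auto simp: dist_real_def)
  qed (use b in auto)
qed

text \<open>The index is the least one whose grid point is not before \<open>t\<close>. Minimality
  is part of the conclusion because it is what bounds the index by the last index of a finite
  grid.\<close>

lemma grid_point_between:
  fixes a t d :: real
  assumes "a \<le> t + d" "1 / 2 ^ n \<le> d"
  obtains i :: nat where "t \<le> a + i / 2 ^ n" "a + i / 2 ^ n \<le> t + d" "\<And>l. t \<le> a + real l / 2 ^ n \<Longrightarrow> i \<le> l"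
proof -
  define i where "i = nat \<lceil>(t - a) * 2 ^ n\<rceil>"
  have i1: "(t - a) * 2 ^ n \<le> i" unfolding i_def by linarith
  have least: "i \<le> l" if "t \<le> a + real l / 2 ^ n" for l :: nat
  proof -
    have "(t - a) * 2 ^ n \<le> real l" using that by (simp add: field_simps)
    then show ?thesis unfolding i_def by linarith
  qed
  have "a + i / 2 ^ n \<le> t + d"
  proof (cases "t \<le> a")
    case True
    then have "(t - a) * 2 ^ n \<le> 0" by (simp add: mult_nonpos_nonneg)
    then have "i = 0" unfolding i_def by simp
    then show ?thesis using assms by simp
  next
    case False
    then have "0 \<le> (t - a) * 2 ^ n" by simp
    then have "real i \<le> (t - a) * 2 ^ n + 1" unfolding i_def by linarith
    then have "real i / 2 ^ n \<le> t - a + 1 / 2 ^ n" by (simp add: field_simps)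
    then show ?thesis using assms(2) by linarith
  qed
  then show thesis using i1 least by (intro that[of i]) (auto simp: field_simps)
qed

lemma eventually_grid_fine: "0 < d \<Longrightarrow> \<forall>\<^sub>F n in sequentially. 1 / 2 ^ n \<le> (d :: real)"
proof -
  assume d: "0 < d"
  have "(\<lambda>n. 1 / 2 ^ n :: real) \<longlonglongrightarrow> 0"
    using LIMSEQ_realpow_zero[of "1/2 :: real"] by (simp add: power_one_over)
  from order_tendstoD(2)[OF this d] show ?thesis by eventually_elim auto
qed

text \<open>By right-continuity each value on the interval is approximated at later grid points, and
  grid points beyond \<open>b\<close> are controlled by right-continuity at \<open>b\<close> itself.
  The starting points \<open>s n\<close> may lie above \<open>a\<close>, since a second leg begins
  at the approximation of a time and not at the time itself.\<close>

lemma grid_Min_tendsto_INF: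
  fixes g :: "real \<Rightarrow> real" and l :: "nat \<Rightarrow> nat"
  assumes ab: "a \<le> b" and rc: "\<And>t. a \<le> t \<Longrightarrow> t \<le> b \<Longrightarrow> continuous (at_right t) g"
    and nonneg: "\<And>t. 0 \<le> g t"
    and s: "s \<longlonglongrightarrow> a" "\<And>n. a \<le> s n"
    and e: "(\<lambda>n. s n + l n / 2 ^ n) \<longlonglongrightarrow> b" "\<And>n. b \<le> s n + l n / 2 ^ n"
  shows "(\<lambda>n. MIN i\<in>{..l n}. g (s n + i / 2 ^ n)) \<longlonglongrightarrow> (INF t\<in>{a..b}. g t)"
proof (rule order_tendstoI)
  let ?I = "INF t\<in>{a..b}. g t"
  have bdd: "bdd_below (g ` {a..b})" using nonneg by (auto intro!: bdd_belowI)
  {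
    fix c assume "c < ?I"
    then have c: "c < g b" "\<And>t. t \<in> {a..b} \<Longrightarrow> c < g t"
      using ab bdd by (auto intro: less_le_trans[OF _ cINF_lower])
    obtain d where d: "0 < d" "\<And>t. b \<le> t \<Longrightarrow> t < b + d \<Longrightarrow> \<bar>g t - g b\<bar> < g b - c"
      using continuous_at_right_eps[OF rc[OF ab order_refl], of "g b - c"] c by auto
    have "\<forall>\<^sub>F n in sequentially. s n + l n / 2 ^ n < b + d"
      using e(1) d(1) by (intro order_tendstoD) auto
    then show "\<forall>\<^sub>F n in sequentially. c < (MIN i\<in>{..l n}. g (s n + i / 2 ^ n))"
    proof eventually_elim
      case (elim n)
      have "c < g (s n + i / 2 ^ n)" if "i \<le> l n" for i
      proof (cases "s n + i / 2 ^ n \<le> b")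
        case True
        then show ?thesis using s(2)[of n] by (intro c(2)) (auto intro: order_trans)
      next
        case False
        have "real i / 2 ^ n \<le> l n / 2 ^ n" using that by (simp add: divide_right_mono)
        with elim have "s n + i / 2 ^ n < b + d" by linarith
        with d(2)[of "s n + i / 2 ^ n"] False show ?thesis by auto
      qed
      then show ?case by (subst Min_gr_iff) auto
    qed
  }
  {
    fix c assume "?I < c"
    then obtain t where t: "a \<le> t" "t \<le> b" "g t < c"
      using ab bdd by (subst (asm) cINF_less_iff) auto
    obtain d where d: "0 < d" "\<And>u. t \<le> u \<Longrightarrow> u < t + d \<Longrightarrow> \<bar>g u - g t\<bar> < c - g t"
      using continuous_at_right_eps[OF rc[OF t(1,2)], of "c - g t"] t by auto
    have "\<forall>\<^sub>F n in sequentially. s n < t + d / 2"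
      using s(1) d(1) t by (intro order_tendstoD) auto
    moreover have "\<forall>\<^sub>F n in sequentially. 1 / 2 ^ n \<le> d / 2"
      using d by (intro eventually_grid_fine) auto
    ultimately show "\<forall>\<^sub>F n in sequentially. (MIN i\<in>{..l n}. g (s n + i / 2 ^ n)) < c"
    proof eventually_elim
      case (elim n)
      obtain i :: nat where i: "t \<le> s n + i / 2 ^ n" "s n + i / 2 ^ n \<le> t + d / 2"
          "\<And>l. t \<le> s n + real l / 2 ^ n \<Longrightarrow> i \<le> l"
        using grid_point_between[of "s n" t "d/2" n] elim by auto
      have "i \<le> l n" using i(3)[of "l n"] e(2)[of n] t by linarith
      moreover have "g (s n + i / 2 ^ n) < c" using d(2)[of "s n + i / 2 ^ n"] i d(1) by auto
      ultimately show ?case by (subst Min_less_iff) auto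
    qed
  }
qed

text \<open>
  Time \<open>t\<close> is always approximated from the right, by \<open>Suc (grid_index n t) / 2 ^ n\<close>, so that
  right-continuity of the paths suffices.
\<close>

definition grid_index :: "nat \<Rightarrow> real \<Rightarrow> nat" where
  "grid_index n t = nat \<lfloor>t * 2 ^ n\<rfloor>"

lemma grid_index_bounds:
  assumes "0 \<le> t"
  shows "t \<le> real (Suc (grid_index n t)) / 2 ^ n" "real (Suc (grid_index n t)) / 2 ^ n \<le> t + 1 / 2 ^ n"
proof -
  have 0: "0 \<le> t * 2 ^ n" using assms by simp
  then have "real (grid_index n t) \<le> t * 2 ^ n" "t * 2 ^ n \<le> real (Suc (grid_index n t))"
    unfolding grid_index_def by linarith+
  then show "t \<le> real (Suc (grid_index n t)) / 2 ^ n" "real (Suc (grid_index n t)) / 2 ^ n \<le> t + 1 / 2 ^ n"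
    by (auto simp: field_simps)
qed

lemma grid_index_tendsto:
  assumes "0 \<le> t"
  shows "(\<lambda>n. real (Suc (grid_index n t)) / 2 ^ n) \<longlonglongrightarrow> t"
proof (rule real_tendsto_sandwich[of "\<lambda>_. t" _ _ "\<lambda>n. t + 1 / 2 ^ n"])
  have "(\<lambda>n. 1 / 2 ^ n :: real) \<longlonglongrightarrow> 0"
    using LIMSEQ_realpow_zero[of "1/2 :: real"] by (simp add: power_one_over)
  then show "(\<lambda>n. t + 1 / 2 ^ n) \<longlonglongrightarrow> t" using tendsto_add[of "\<lambda>_. t" t] by force
qed (use grid_index_bounds[OF assms] in auto)

lemma grid_index_measurable [measurable]: "grid_index n \<in> measurable borel (count_space UNIV)"
  unfolding grid_index_def by measurable

section \<open>Exponential clocks\<close>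

abbreviation exp_weight :: "real \<Rightarrow> real \<Rightarrow> ennreal" where
  "exp_weight q t \<equiv> ennreal (q * exp (- q * t)) * indicator {0..} t"

text \<open>For an Exp(q) time \<open>t\<close> the index \<open>grid_index n t\<close> is geometric
  with ratio exp(- q / 2^n): the density is integrated over each dyadic cell.\<close>

lemma nn_integral_grid_index:
  fixes f :: "nat \<Rightarrow> ennreal"
  assumes q: "0 < q"
  shows "(\<integral>\<^sup>+t. exp_weight q t * f (grid_index n t) \<partial>lborel) =
    ennreal (1 - exp (- q / 2 ^ n)) * (\<Sum>k. ennreal (exp (- q / 2 ^ n) ^ k) * f k)"
proof -
  define J where "J k = {real k / 2 ^ n ..< real (Suc k) / 2 ^ n}" for k
  have J: "t \<in> J k \<longleftrightarrow> grid_index n t = k" if "0 \<le> t" for t k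
  proof -
    have "0 \<le> t * 2 ^ n" using that by simp
    then have "grid_index n t = k \<longleftrightarrow> real k \<le> t * 2 ^ n \<and> t * 2 ^ n < real (Suc k)"
      unfolding grid_index_def by (auto; linarith)
    then show ?thesis by (auto simp: J_def field_simps)
  qed
  have J0: "t \<in> J k \<Longrightarrow> 0 \<le> t" for t k
    by (auto simp: J_def intro: order_trans[of 0 "real k / 2 ^ n"])
  have pw: "exp_weight q t * f (grid_index n t) =
      (\<Sum>k. f k * (ennreal (q * exp (- q * t)) * indicator (J k) t))" for t
  proof (cases "0 \<le> t")
    case True
    have "(\<Sum>k. f k * (ennreal (q * exp (- q * t)) * indicator (J k) t)) =
        (\<Sum>k\<in>{grid_index n t}. f k * (ennreal (q * exp (- q * t)) * indicator (J k) t))"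
      using J[OF True] by (intro suminf_finite) (auto simp: indicator_def)
    then show ?thesis using True J[OF True] by (simp add: mult_ac)
  next
    case False
    then have "t \<notin> J k" for k using J0 by blast
    then show ?thesis using False by simp
  qed
  have int: "(\<integral>\<^sup>+t. ennreal (q * exp (- q * t)) * indicator (J k) t \<partial>lborel) =
      ennreal (1 - exp (- q / 2 ^ n)) * ennreal (exp (- q / 2 ^ n) ^ k)" for k
  proof -
    have "(\<integral>\<^sup>+t. ennreal (q * exp (- q * t)) * indicator (J k) t \<partial>lborel) =
        (\<integral>\<^sup>+t. ennreal (q * exp (- q * t)) * indicator {real k / 2 ^ n .. real (Suc k) / 2 ^ n} t \<partial>lborel)"
      by (intro nn_integral_cong_AE, rule eventually_mono[OF AE_lborel_singleton[of "real (Suc k) / 2 ^ n"]])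
         (auto simp: J_def indicator_def)
    also have "\<dots> = ennreal (- exp (- q * (real (Suc k) / 2 ^ n)) - (- exp (- q * (real k / 2 ^ n))))"
      using q by (intro nn_integral_FTC_Icc) (auto intro!: derivative_eq_intros divide_right_mono)
    also have "- exp (- q * (real (Suc k) / 2 ^ n)) - (- exp (- q * (real k / 2 ^ n))) =
        (1 - exp (- q / 2 ^ n)) * exp (- q / 2 ^ n) ^ k"
      by (simp add: algebra_simps add_divide_distrib flip: exp_of_nat_mult exp_add)
    finally show ?thesis using q by (simp add: ennreal_mult')
  qed
  have [measurable]: "J k \<in> sets borel" for k by (simp add: J_def)
  have "(\<integral>\<^sup>+t. exp_weight q t * f (grid_index n t) \<partial>lborel) =
      (\<Sum>k. f k * (\<integral>\<^sup>+t. ennreal (q * exp (- q * t)) * indicator (J k) t \<partial>lborel))"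
    unfolding pw by (subst nn_integral_suminf) (auto simp: nn_integral_cmult)
  then show ?thesis
    unfolding int by (simp add: mult_ac flip: ennreal_suminf_cmult)
qed

text \<open>Cauchy's functional equation: multiplicativity fixes the values at non-negative
  rationals, and monotonicity squeezes every other value between rationals at distance at most
  \<open>1 / real (Suc n)\<close>.\<close>

lemma multiplicative_imp_exp:
  fixes a :: "real \<Rightarrow> real"
  assumes pos: "0 < a 1" and le1: "a 1 \<le> 1" and nonneg: "\<And>x. 0 \<le> x \<Longrightarrow> 0 \<le> a x"
    and mono: "\<And>x y. 0 \<le> x \<Longrightarrow> x \<le> y \<Longrightarrow> a y \<le> a x"
    and mult: "\<And>x y. 0 \<le> x \<Longrightarrow> 0 \<le> y \<Longrightarrow> a (x + y) = a x * a y"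
    and x: "0 \<le> x"
  shows "a x = exp (ln (a 1) * x)"
proof -
  have a0: "a 0 = 1" using mult[of 0 1] pos by simp
  have pow: "a (real m * y) = a y ^ m" if "0 \<le> y" for m y
    using that by (induction m) (auto simp: a0 mult distrib_right)
  have rat: "a (real k / real n) = exp (ln (a 1) * (real k / real n))" if n: "0 < n" for k n :: nat
  proof -
    have "a (real k / real n) ^ n = a (real k)" using pow[of "real k / real n" n] n by simp
    also have "\<dots> = a 1 ^ k" using pow[of 1 k] by simp
    also have "\<dots> = exp (ln (a 1) * (real k / real n)) ^ n"
      using n pos by (simp add: exp_of_nat_mult[symmetric] mult.commute[of "ln (a 1)"] exp_of_nat_mult)
    finally show ?thesis using n nonneg[of "real k / real n"] by (subst (asm) power_eq_iff_eq_base) auto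
  qed
  have l: "ln (a 1) \<le> 0" using le1 pos by simp
  have up: "a x \<le> exp (ln (a 1) * (x - 1 / real (Suc n)))" for n
  proof -
    let ?k = "nat \<lfloor>x * real (Suc n)\<rfloor>"
    have 0: "0 \<le> x * real (Suc n)" using x by simp
    have "real ?k \<le> x * real (Suc n)" "x * real (Suc n) - 1 \<le> real ?k" using 0 by linarith+
    then have k: "real ?k / real (Suc n) \<le> x" "x - 1 / real (Suc n) \<le> real ?k / real (Suc n)"
      using divide_right_mono[of "real ?k" "x * real (Suc n)" "real (Suc n)"]
        divide_right_mono[of "x * real (Suc n) - 1" "real ?k" "real (Suc n)"]
      by (simp_all add: diff_divide_distrib del: of_nat_Suc)
    have "a x \<le> a (real ?k / real (Suc n))" by (rule mono) (use k in auto)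
    also have "\<dots> = exp (ln (a 1) * (real ?k / real (Suc n)))" by (rule rat) simp
    also have "\<dots> \<le> exp (ln (a 1) * (x - 1 / real (Suc n)))"
      using mult_left_mono_neg[OF k(2) l] by simp
    finally show ?thesis .
  qed
  have lo: "exp (ln (a 1) * (x + 1 / real (Suc n))) \<le> a x" for n
  proof -
    let ?k = "nat \<lceil>x * real (Suc n)\<rceil>"
    have 0: "0 \<le> x * real (Suc n)" using x by simp
    have "x * real (Suc n) \<le> real ?k" "real ?k \<le> x * real (Suc n) + 1" using 0 by linarith+
    then have k: "x \<le> real ?k / real (Suc n)" "real ?k / real (Suc n) \<le> x + 1 / real (Suc n)"
      using divide_right_mono[of "x * real (Suc n)" "real ?k" "real (Suc n)"]
        divide_right_mono[of "real ?k" "x * real (Suc n) + 1" "real (Suc n)"]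
      by (simp_all add: add_divide_distrib del: of_nat_Suc)
    have "exp (ln (a 1) * (x + 1 / real (Suc n))) \<le> exp (ln (a 1) * (real ?k / real (Suc n)))"
      using mult_left_mono_neg[OF k(2) l] by simp
    also have "\<dots> = a (real ?k / real (Suc n))" by (rule rat[symmetric]) simp
    also have "\<dots> \<le> a x" by (rule mono) (use k x in auto)
    finally show ?thesis .
  qed
  have "(\<lambda>n. exp (ln (a 1) * (x - 1 / real (Suc n)))) \<longlonglongrightarrow> exp (ln (a 1) * (x - 0))"
    by (intro tendsto_intros LIMSEQ_inverse_real_of_nat[unfolded inverse_eq_divide])
  moreover have "(\<lambda>n. exp (ln (a 1) * (x + 1 / real (Suc n)))) \<longlonglongrightarrow> exp (ln (a 1) * (x + 0))"
    by (intro tendsto_intros LIMSEQ_inverse_real_of_nat[unfolded inverse_eq_divide])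
  ultimately show ?thesis
    using up lo by (intro antisym) (auto intro: LIMSEQ_le_const LIMSEQ_le_const2)
qed

section \<open>Layer-cake forms and integrals of exponentials\<close>

lemma exp_layer_cake:
  assumes "0 \<le> \<gamma>" "0 \<le> d"
  shows "ennreal (exp (\<gamma> * d)) =
    1 + (\<integral>\<^sup>+x. ennreal (\<gamma> * exp (\<gamma> * x)) * indicator {0..} x * indicator {x<..} d \<partial>lborel)"
proof -
  have "(\<integral>\<^sup>+x. ennreal (\<gamma> * exp (\<gamma> * x)) * indicator {0..} x * indicator {x<..} d \<partial>lborel) =
      (\<integral>\<^sup>+x. ennreal (\<gamma> * exp (\<gamma> * x)) * indicator {0..d} x \<partial>lborel)"
    by (intro nn_integral_cong_AE, rule eventually_mono[OF AE_lborel_singleton[of d]]) (auto simp: indicator_def)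
  also have "\<dots> = ennreal (exp (\<gamma> * d) - exp (\<gamma> * 0))"
    using assms by (intro nn_integral_FTC_Icc) (auto intro!: derivative_eq_intros)
  finally show ?thesis using assms by (simp flip: ennreal_plus ennreal_1)
qed

text \<open>The function is chosen because max(M, W + z) = M + max(0, z - (M - W)). In
  \<open>d\<close> it increases from exp(- \<gamma> z) to 1 and is constant from
  \<open>d = z\<close> on, so the weight lives on levels up to \<open>z\<close>.\<close>

lemma exp_pos_part_layer_cake:
  assumes "0 \<le> \<gamma>" "0 \<le> d" "0 \<le> z"
  shows "ennreal (exp (- \<gamma> * max 0 (z - d))) = ennreal (exp (- \<gamma> * z)) +
    (\<integral>\<^sup>+x. (ennreal (\<gamma> * exp (- \<gamma> * (z - x))) * indicator {..z} x) * indicator {0..} x * indicator {x<..} d \<partial>lborel)"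
proof -
  have "(\<integral>\<^sup>+x. (ennreal (\<gamma> * exp (- \<gamma> * (z - x))) * indicator {..z} x) * indicator {0..} x * indicator {x<..} d \<partial>lborel) =
      (\<integral>\<^sup>+x. ennreal (\<gamma> * exp (- \<gamma> * (z - x))) * indicator {0..min d z} x \<partial>lborel)"
    by (intro nn_integral_cong_AE, rule eventually_mono[OF AE_lborel_singleton[of d]]) (auto simp: indicator_def)
  also have "\<dots> = ennreal (exp (- \<gamma> * (z - min d z)) - exp (- \<gamma> * (z - 0)))"
    using assms by (intro nn_integral_FTC_Icc) (auto intro!: derivative_eq_intros)
  finally have I: "(\<integral>\<^sup>+x. (ennreal (\<gamma> * exp (- \<gamma> * (z - x))) * indicator {..z} x) * indicator {0..} x * indicator {x<..} d \<partial>lborel)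
    = \<dots>" .
  have m: "z - min d z = max 0 (z - d)" by auto
  have "exp (- \<gamma> * z) \<le> exp (- \<gamma> * max 0 (z - d))"
    using assms by (auto intro!: mult_left_mono)
  then show ?thesis unfolding I m by (simp flip: ennreal_plus)
qed

text \<open>For r > 0 this is E exp(- \<gamma> max(0, z - D)) with D exponential of rate r: the
  weight of \<open>exp_pos_part_layer_cake\<close> is integrated against the tail exp(- r x) of
  D.\<close>

lemma nn_integral_exp_pos_part_weight:
  assumes "0 \<le> \<gamma>" "0 \<le> z" "\<gamma> \<noteq> r"
  shows "ennreal (exp (- \<gamma> * z)) +
    (\<integral>\<^sup>+x. (ennreal (\<gamma> * exp (- \<gamma> * (z - x))) * indicator {..z} x) * indicator {0..} x * ennreal (exp (- r * x)) \<partial>lborel)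
    = ennreal ((r * exp (- \<gamma> * z) - \<gamma> * exp (- r * z)) / (r - \<gamma>))" (is "_ + ?I = _")
proof -
  let ?F = "\<lambda>x. \<gamma> / (\<gamma> - r) * exp (- \<gamma> * (z - x) - r * x)"
  have F': "(?F has_real_derivative \<gamma> * exp (- \<gamma> * (z - x) - r * x)) (at x)" for x
  proof -
    have "((\<lambda>x. exp (- \<gamma> * (z - x) - r * x)) has_real_derivative exp (- \<gamma> * (z - x) - r * x) * (\<gamma> - r)) (at x)"
      by (auto intro!: derivative_eq_intros)
    from DERIV_cmult[OF this, of "\<gamma> / (\<gamma> - r)"] show ?thesis using assms by simp
  qed
  have mono: "?F 0 \<le> ?F z"
    by (rule DERIV_nonneg_imp_nondecreasing[OF assms(2)]) (use F' assms in force)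
  have "?I = (\<integral>\<^sup>+x. ennreal (\<gamma> * exp (- \<gamma> * (z - x) - r * x)) * indicator {0..z} x \<partial>lborel)"
  proof (rule nn_integral_cong)
    fix x
    have "exp (- \<gamma> * (z - x)) * exp (- r * x) = exp (- \<gamma> * (z - x) - r * x)"
      by (simp add: algebra_simps flip: exp_add)
    then have "\<gamma> * exp (- \<gamma> * (z - x)) * exp (- r * x) = \<gamma> * exp (- \<gamma> * (z - x) - r * x)"
      by (simp only: mult.assoc)
    then show "(ennreal (\<gamma> * exp (- \<gamma> * (z - x))) * indicator {..z} x) * indicator {0..} x * ennreal (exp (- r * x)) =
        ennreal (\<gamma> * exp (- \<gamma> * (z - x) - r * x)) * indicator {0..z} x"
      using assms by (auto simp: indicator_def simp flip: ennreal_mult')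
  qed
  also have "\<dots> = ennreal (?F z - ?F 0)"
    using assms F' by (intro nn_integral_FTC_Icc) auto
  finally have "ennreal (exp (- \<gamma> * z)) + ?I = ennreal (exp (- \<gamma> * z) + (?F z - ?F 0))"
    using mono by (simp add: ennreal_plus)
  also have "exp (- \<gamma> * z) + (?F z - ?F 0) = (r * exp (- \<gamma> * z) - \<gamma> * exp (- r * z)) / (r - \<gamma>)"
    using assms(3) by (simp add: divide_simps) (simp add: algebra_simps)
  finally show ?thesis .
qed

lemma nn_integral_exponential_density:
  assumes "0 < q"
  shows "(\<integral>\<^sup>+t. ennreal (exponential_density q t) \<partial>lborel) = 1"
  using prob_space.emeasure_space_1[OF prob_space_exponential_density[OF assms]] by (simp add: emeasure_density)

text \<open>Dominated convergence with the exponential density as dominating function. The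
  indicators are there because bounds, limits and measurability are available for non-negative times
  only.\<close>

lemma nn_integral_exponential_tendsto:
  fixes f :: "nat \<Rightarrow> real \<Rightarrow> ennreal"
  assumes q: "0 < q" and f: "\<And>n. (\<lambda>t. f n t * indicator {0..} t) \<in> borel_measurable borel"
    and le: "\<And>n t. 0 \<le> t \<Longrightarrow> f n t \<le> 1" and lim: "\<And>t. 0 \<le> t \<Longrightarrow> (\<lambda>n. f n t) \<longlonglongrightarrow> g t"
  shows "(\<lambda>t. g t * indicator {0..} t) \<in> borel_measurable borel"
    and "(\<lambda>n. \<integral>\<^sup>+t. exp_weight q t * f n t \<partial>lborel) \<longlonglongrightarrow>
      (\<integral>\<^sup>+t. exp_weight q t * g t \<partial>lborel)"
proof -
  have lim': "(\<lambda>n. f n t * indicator {0..} t) \<longlonglongrightarrow> g t * indicator {0..} t" for t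
    using lim[of t] by (auto simp: indicator_def)
  show g: "(\<lambda>t. g t * indicator {0..} t) \<in> borel_measurable borel"
    by (rule borel_measurable_LIMSEQ_order[OF lim' f])
  have "(\<lambda>n. \<integral>\<^sup>+t. ennreal (q * exp (- q * t)) * (f n t * indicator {0..} t) \<partial>lborel) \<longlonglongrightarrow>
      (\<integral>\<^sup>+t. ennreal (q * exp (- q * t)) * (g t * indicator {0..} t) \<partial>lborel)"
  proof (rule nn_integral_dominated_convergence[where w = "\<lambda>t. ennreal (exponential_density q t)"])
    show "AE t in lborel. ennreal (q * exp (- q * t)) * (f n t * indicator {0..} t) \<le> ennreal (exponential_density q t)" for n
    proof (rule AE_I2)
      fix t :: real
      show "ennreal (q * exp (- q * t)) * (f n t * indicator {0..} t) \<le> ennreal (exponential_density q t)"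
      proof (cases "0 \<le> t")
        case True
        then show ?thesis
          using mult_left_mono[OF le[OF True], of "ennreal (q * exp (- q * t))" n]
          by (simp add: exponential_density_def mult.commute)
      qed simp
    qed
    show "AE t in lborel. (\<lambda>n. ennreal (q * exp (- q * t)) * (f n t * indicator {0..} t)) \<longlonglongrightarrow>
        ennreal (q * exp (- q * t)) * (g t * indicator {0..} t)"
      by (intro AE_I2 ennreal_tendsto_cmult lim') simp
  qed (use f g in \<open>auto simp: nn_integral_exponential_density[OF q]\<close>)
  then show "(\<lambda>n. \<integral>\<^sup>+t. exp_weight q t * f n t \<partial>lborel) \<longlonglongrightarrow>
      (\<integral>\<^sup>+t. exp_weight q t * g t \<partial>lborel)"
    by (simp add: mult_ac)
qed

lemma (in prob_space) nn_integral_tendsto_le_1: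
  fixes f :: "nat \<Rightarrow> 'a \<Rightarrow> real"
  assumes f: "\<And>n. f n \<in> borel_measurable M" and le: "\<And>n \<omega>. \<omega> \<in> space M \<Longrightarrow> f n \<omega> \<le> 1"
    and lim: "\<And>\<omega>. \<omega> \<in> space M \<Longrightarrow> (\<lambda>n. f n \<omega>) \<longlonglongrightarrow> g \<omega>"
  shows "(\<lambda>n. \<integral>\<^sup>+\<omega>. ennreal (f n \<omega>) \<partial>M) \<longlonglongrightarrow> (\<integral>\<^sup>+\<omega>. ennreal (g \<omega>) \<partial>M)"
proof (rule nn_integral_dominated_convergence[where w = "\<lambda>_. 1"])
  show "AE \<omega> in M. ennreal (f n \<omega>) \<le> 1" for n using le by (intro AE_I2) simp
  show "AE \<omega> in M. (\<lambda>n. ennreal (f n \<omega>)) \<longlonglongrightarrow> ennreal (g \<omega>)"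
    by (intro AE_I2 tendsto_ennrealI lim)
qed (use f borel_measurable_LIMSEQ_real[OF lim f] in \<open>auto simp: emeasure_space_1\<close>)

text \<open>This is E exp(\<gamma> D) for D exponential of rate r, computed from its tail.\<close>

lemma nn_integral_exp_weight:
  assumes "0 \<le> \<gamma>" "\<gamma> < r"
  shows "1 + (\<integral>\<^sup>+x. ennreal (\<gamma> * exp (\<gamma> * x)) * indicator {0..} x * ennreal (exp (- r * x)) \<partial>lborel) = ennreal (r / (r - \<gamma>))"
proof -
  have "(\<integral>\<^sup>+x. ennreal (\<gamma> * exp (\<gamma> * x)) * indicator {0..} x * ennreal (exp (- r * x)) \<partial>lborel) =
      (\<integral>\<^sup>+x. ennreal (\<gamma> / (r - \<gamma>)) * (ennreal (exponential_density (r - \<gamma>) x)) \<partial>lborel)"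
  proof (rule nn_integral_cong)
    fix x :: real
    have "exp (\<gamma> * x) * exp (- r * x) = exp (- x * (r - \<gamma>))"
      by (simp add: algebra_simps flip: exp_add)
    then have "\<gamma> * exp (\<gamma> * x) * exp (- r * x) = \<gamma> / (r - \<gamma>) * ((r - \<gamma>) * exp (- x * (r - \<gamma>)))"
      using assms by simp
    then show "ennreal (\<gamma> * exp (\<gamma> * x)) * indicator {0..} x * ennreal (exp (- r * x)) =
        ennreal (\<gamma> / (r - \<gamma>)) * ennreal (exponential_density (r - \<gamma>) x)"
      using assms by (auto simp: indicator_def exponential_density_def simp flip: ennreal_mult')
  qed
  also have "\<dots> = ennreal (\<gamma> / (r - \<gamma>)) * (\<integral>\<^sup>+x. ennreal (exponential_density (r - \<gamma>) x) \<partial>lborel)"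
    by (rule nn_integral_cmult) simp
  also have "(\<integral>\<^sup>+x. ennreal (exponential_density (r - \<gamma>) x) \<partial>lborel) = 1"
    using assms by (intro nn_integral_exponential_density) simp
  finally have I: "(\<integral>\<^sup>+x. ennreal (\<gamma> * exp (\<gamma> * x)) * indicator {0..} x * ennreal (exp (- r * x)) \<partial>lborel) =
      ennreal (\<gamma> / (r - \<gamma>))"
    by simp
  have "1 + \<gamma> / (r - \<gamma>) = r / (r - \<gamma>)" using assms by (simp add: divide_simps)
  then show ?thesis
    unfolding I using assms by (simp flip: ennreal_plus ennreal_1)
qed

text \<open>From \<gamma> = r on, the integrand is at least \<gamma> on the whole half-line.\<close>

lemma nn_integral_exp_weight_top:
  assumes "0 < \<gamma>" "r \<le> \<gamma>"
  shows "(\<integral>\<^sup>+x. ennreal (\<gamma> * exp (\<gamma> * x)) * indicator {0..} x * ennreal (exp (- r * x)) \<partial>lborel) = \<infinity>"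
proof -
  have "(\<integral>\<^sup>+x. ennreal \<gamma> * indicator {0::real..} x \<partial>lborel) \<le>
      (\<integral>\<^sup>+x. ennreal (\<gamma> * exp (\<gamma> * x)) * indicator {0..} x * ennreal (exp (- r * x)) \<partial>lborel)"
  proof (rule nn_integral_mono)
    fix x :: real
    have "1 \<le> exp (\<gamma> * x) * exp (- r * x)" if "0 \<le> x"
      using that assms by (simp add: mult_right_mono flip: exp_add)
    then show "ennreal \<gamma> * indicator {0..} x \<le> ennreal (\<gamma> * exp (\<gamma> * x)) * indicator {0..} x * ennreal (exp (- r * x))"
      using assms by (auto simp: indicator_def mult.assoc simp flip: ennreal_mult' intro!: ennreal_leI)
  qed
  moreover have "(\<integral>\<^sup>+x. ennreal \<gamma> * indicator {0::real..} x \<partial>lborel) = ennreal \<gamma> * emeasure lborel {0::real..}"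
    by (subst nn_integral_cmult_indicator) auto
  moreover have "emeasure lborel {0::real..} = \<infinity>"
  proof -
    have "of_nat n \<le> emeasure lborel {0::real..}" for n
      using emeasure_mono[of "{0..real n}" "{0..}" lborel] by (simp flip: ennreal_of_nat_eq_real_of_nat)
    then have "(\<Squnion>n. of_nat n :: ennreal) \<le> emeasure lborel {0::real..}" by (rule SUP_least)
    then show ?thesis by (simp add: ennreal_SUP_of_nat_eq_top top_unique)
  qed
  ultimately show ?thesis using assms by (simp add: ennreal_mult_top top_unique)
qed

section \<open>Dyadic approximation of the process\<close>

text \<open>This is \<open>hit_discount\<close> for the walk obtained by sampling a path at the
  times k / 2^n, but expressed through the path, so that grids of different mesh can be
  compared.\<close>

definition path_hit :: "real \<Rightarrow> nat \<Rightarrow> real \<Rightarrow> (real \<Rightarrow> real) \<Rightarrow> ennreal" where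
  "path_hit q n x y = (\<Squnion>k\<in>{k. y (real k / 2 ^ n) < - x}. ennreal (exp (- q / 2 ^ n) ^ k))"

lemma exp_grid_power: "exp (- q / 2 ^ n) ^ k = exp (- q * (real k / 2 ^ n))"
  by (simp add: mult.commute flip: exp_of_nat_mult)

lemma path_hit_mono: "x \<le> x' \<Longrightarrow> path_hit q n x' y \<le> path_hit q n x y"
  unfolding path_hit_def by (intro SUP_subset_mono) auto

text \<open>Dyadic grids are nested: time k / 2^n is time 2k / 2^(n + 1) and carries the same
  discount.\<close>

lemma path_hit_incseq: "incseq (\<lambda>n. path_hit q n x y)"
proof (rule incseq_SucI)
  fix n
  show "path_hit q n x y \<le> path_hit q (Suc n) x y"
    unfolding path_hit_def exp_grid_power
  proof (rule SUP_least)
    fix k assume "k \<in> {k. y (real k / 2 ^ n) < - x}"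
    then show "ennreal (exp (- q * (real k / 2 ^ n))) \<le>
        (\<Squnion>k\<in>{k. y (real k / 2 ^ Suc n) < - x}. ennreal (exp (- q * (real k / 2 ^ Suc n))))"
      by (intro SUP_upper2[of "2 * k"]) auto
  qed
qed

text \<open>Passage is defined by a strict inequality, so a value below \<open>- x\<close> is
  already below \<open>- x - 1 / (m + 1)\<close> for some \<open>m\<close>. This gives
  right-continuity in the level.\<close>

lemma path_hit_SUP_right: "(\<Squnion>m. path_hit q n (x + 1 / real (Suc m)) y) = path_hit q n x y"
proof (rule antisym)
  show "(\<Squnion>m. path_hit q n (x + 1 / real (Suc m)) y) \<le> path_hit q n x y"
    by (intro SUP_least path_hit_mono) simp
  show "path_hit q n x y \<le> (\<Squnion>m. path_hit q n (x + 1 / real (Suc m)) y)"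
    unfolding path_hit_def[of q n x y]
  proof (rule SUP_least)
    fix k assume "k \<in> {k. y (real k / 2 ^ n) < - x}"
    then obtain m where "inverse (real (Suc m)) < - x - y (real k / 2 ^ n)"
      using reals_Archimedean[of "- x - y (real k / 2 ^ n)"] by auto
    then have "y (real k / 2 ^ n) < - (x + 1 / real (Suc m))" by (simp add: inverse_eq_divide)
    then have "ennreal (exp (- q / 2 ^ n) ^ k) \<le> path_hit q n (x + 1 / real (Suc m)) y"
      unfolding path_hit_def by (intro SUP_upper) auto
    then show "ennreal (exp (- q / 2 ^ n) ^ k) \<le> (\<Squnion>m. path_hit q n (x + 1 / real (Suc m)) y)"
      by (rule SUP_upper2[OF UNIV_I])
  qed
qed

lemma path_hit_le:
  assumes "0 < q" "\<And>t. 0 \<le> t \<Longrightarrow> t < d \<Longrightarrow> - x \<le> y t"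
  shows "path_hit q n x y \<le> ennreal (exp (- q * d))"
  unfolding path_hit_def exp_grid_power
proof (rule SUP_least)
  fix k assume "k \<in> {k. y (real k / 2 ^ n) < - x}"
  then have "\<not> - x \<le> y (real k / 2 ^ n)" "0 \<le> real k / 2 ^ n" by auto
  then have "d \<le> real k / 2 ^ n" using assms(2)[of "real k / 2 ^ n"] by linarith
  then show "ennreal (exp (- q * (real k / 2 ^ n))) \<le> ennreal (exp (- q * d))"
    using mult_left_mono[of d "real k / 2 ^ n" q] assms(1) by (intro ennreal_leI) simp
qed

text \<open>
  A path without negative jumps passes below \<open>-x\<close> continuously, so on a fine grid the passage below
  \<open>-x\<close> strictly precedes the one below \<open>-x - \<epsilon>\<close>.
\<close>

lemma path_hit_no_overshoot:
  assumes rc: "\<And>t. 0 \<le> t \<Longrightarrow> continuous (at_right t) y" and y0: "y 0 = 0"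
    and ll: "\<And>t. 0 < t \<Longrightarrow> \<exists>l. (y \<longlongrightarrow> l) (at_left t)"
    and no_jump: "\<And>t l. 0 < t \<Longrightarrow> (y \<longlongrightarrow> l) (at_left t) \<Longrightarrow> l \<le> y t"
    and x: "0 \<le> x" and e: "0 < e" and q: "0 < q"
  shows "\<forall>\<^sub>F n in sequentially. path_hit q n x y = path_hit q n (x + e) y \<longrightarrow> path_hit q n x y = 0"
proof (cases "\<exists>t\<ge>0. y t < - x")
  case False
  then have "{k. y (real k / 2 ^ n) < - x} = {}" for n by auto
  then have "path_hit q n x y = 0" for n
    by (simp add: path_hit_def bot_ennreal)
  then show ?thesis by simp
next
  case True
  define \<tau> where "\<tau> = Inf {t. 0 \<le> t \<and> y t < - x}"
  have ne: "{t. 0 \<le> t \<and> y t < - x} \<noteq> {}" using True by auto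
  have bdd: "bdd_below {t. 0 \<le> t \<and> y t < - x}" by (auto intro: bdd_belowI)
  have \<tau>0: "0 \<le> \<tau>" unfolding \<tau>_def using ne by (intro cInf_greatest) auto
  have before: "- x \<le> y t" if "0 \<le> t" "t < \<tau>" for t
  proof (rule ccontr)
    assume "\<not> - x \<le> y t"
    then have "\<tau> \<le> t" unfolding \<tau>_def using that bdd by (intro cInf_lower) auto
    with that show False by simp
  qed
  \<comment> \<open>Here the sign of the jumps enters: the left limit at \<tau> is at least
    \<open>- x\<close>, and a jump at \<tau> cannot lead further down.\<close>
  have at: "- x \<le> y \<tau>"
  proof (cases "\<tau> = 0")
    case True
    then show ?thesis using y0 x by simp
  next
    case False
    then have pos: "0 < \<tau>" using \<tau>0 by simp
    obtain l where l: "(y \<longlongrightarrow> l) (at_left \<tau>)" using ll[OF pos] ..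
    have "\<forall>\<^sub>F s in at_left \<tau>. - x \<le> y s"
      using pos before by (auto simp: eventually_at_left_field intro!: exI[of _ 0])
    then have "- x \<le> l" by (rule tendsto_lowerbound[OF l]) simp
    then show ?thesis using no_jump[OF pos l] by simp
  qed
  obtain d where d: "0 < d" "\<And>s. \<tau> \<le> s \<Longrightarrow> s < \<tau> + d \<Longrightarrow> \<bar>y s - y \<tau>\<bar> < e"
    using continuous_at_right_eps[OF rc[OF \<tau>0] e] by blast
  \<comment> \<open>Right-continuity at \<tau> keeps the path above the lower level until \<tau> +
    d, on every grid at once.\<close>
  have late: "path_hit q n (x + e) y \<le> ennreal (exp (- q * (\<tau> + d)))" for n
  proof (rule path_hit_le[OF q])
    fix t assume t: "0 \<le> t" "t < \<tau> + d"
    show "- (x + e) \<le> y t"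
    proof (cases "t < \<tau>")
      case True
      then show ?thesis using before[of t] t e by simp
    next
      case False
      then show ?thesis using d(2)[of t] t at by auto
    qed
  qed
  \<comment> \<open>Since \<tau> is an infimum, the path is below \<open>- x\<close> at some time
    before \<tau> + d. A fine grid has a point just after that time at which it is still below, and
    its discount strictly exceeds the bound for the lower level.\<close>
  have "Inf {t. 0 \<le> t \<and> y t < - x} < \<tau> + d" using d(1) by (simp add: \<tau>_def)
  then obtain t where t: "0 \<le> t" "y t < - x" "t < \<tau> + d"
    using ne bdd by (subst (asm) cInf_less_iff) auto
  obtain d' where d': "0 < d'" "\<And>s. t \<le> s \<Longrightarrow> s < t + d' \<Longrightarrow> \<bar>y s - y t\<bar> < - x - y t"
    using continuous_at_right_eps[OF rc[OF t(1)], of "- x - y t"] t(2) by auto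
  define d'' where "d'' = min (d' / 2) ((\<tau> + d - t) / 2)"
  have d'': "0 < d''" "t + d'' < t + d'" "t + d'' < \<tau> + d"
  proof -
    have "d'' \<le> d' / 2" "d'' \<le> (\<tau> + d - t) / 2"
      unfolding d''_def by (rule min.cobounded1, rule min.cobounded2)
    moreover have "d' / 2 < d'" "(\<tau> + d - t) / 2 < \<tau> + d - t" using d'(1) t(3) by (simp_all add: field_simps)
    ultimately show "t + d'' < t + d'" "t + d'' < \<tau> + d" by linarith+
    show "0 < d''" using d' t by (simp add: d''_def)
  qed
  have "\<forall>\<^sub>F n in sequentially. 1 / 2 ^ n \<le> d''" by (rule eventually_grid_fine) fact
  then show ?thesis
  proof eventually_elim
    case (elim n)
    obtain i :: nat where i: "t \<le> 0 + i / 2 ^ n" "0 + i / 2 ^ n \<le> t + d''"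
    proof (rule grid_point_between[OF _ elim])
      show "0 \<le> t + d''" using t(1) d''(1) by simp
    qed (rule that)
    have "\<bar>y (i / 2 ^ n) - y t\<bar> < - x - y t" by (rule d'(2)) (use i d'' in linarith)+
    then have "y (i / 2 ^ n) < - x" by linarith
    then have "ennreal (exp (- q * (i / 2 ^ n))) \<le> path_hit q n x y"
      unfolding path_hit_def exp_grid_power by (intro SUP_upper) auto
    moreover have "ennreal (exp (- q * (\<tau> + d))) < ennreal (exp (- q * (i / 2 ^ n)))"
    proof (intro ennreal_lessI)
      have "i / 2 ^ n < \<tau> + d" using i d'' by simp
      from mult_strict_left_mono[OF this q] show "exp (- q * (\<tau> + d)) < exp (- q * (i / 2 ^ n))" by simp
    qed simp
    ultimately have "path_hit q n (x + e) y < path_hit q n x y"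
      using late[of n] by (meson le_less_trans less_le_trans)
    then show ?case by simp
  qed
qed

section \<open>From geometric to exponential clocks\<close>

lemma (in random_walk) nn_integral_exp_walk:
  "(\<integral>\<^sup>+w. ennreal (exp (- \<gamma> * walk w k)) \<partial>S) = (\<integral>\<^sup>+w. ennreal (exp (- \<gamma> * walk w 1)) \<partial>S) ^ k"
proof (induction k)
  case 0
  then show ?case by (simp add: P.emeasure_space_1)
next
  case (Suc k)
  let ?G = "\<lambda>(w, w'). ennreal (exp (- \<gamma> * walk w 1)) * ennreal (exp (- \<gamma> * walk w' k))"
  have "(\<integral>\<^sup>+w. ennreal (exp (- \<gamma> * walk w (Suc k))) \<partial>S) = (\<integral>\<^sup>+w. ?G (w, shift_seq 1 w) \<partial>S)"
    using walk_shift[of _ 1 k]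
    by (intro nn_integral_cong) (simp add: algebra_simps flip: ennreal_mult' exp_add)
  also have "\<dots> = (\<integral>\<^sup>+w'. (\<integral>\<^sup>+w. ?G (w, w') \<partial>S) \<partial>S)"
    by (rule nn_integral_split) (auto simp: walk_def)
  also have "\<dots> = (\<integral>\<^sup>+w. ennreal (exp (- \<gamma> * walk w 1)) \<partial>S) * (\<integral>\<^sup>+w. ennreal (exp (- \<gamma> * walk w k)) \<partial>S)"
    by (simp add: nn_integral_cmult nn_integral_multc)
  finally show ?case using Suc by simp
qed

text \<open>The limit is available at index \<open>Suc (grid_index n t)\<close>, the grid time to
  the right of \<open>t\<close>, while the sum starts at \<open>k = 0\<close>. The shift by one
  splits off the term at 0, whose weight 1 - exp(- q / 2^n) tends to 0, and leaves a factor exp(- q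
  / 2^n) that tends to 1.\<close>

lemma geometric_to_exponential:
  fixes a :: "nat \<Rightarrow> nat \<Rightarrow> ennreal"
  assumes q: "0 < q" and le: "\<And>n k. a n k \<le> 1"
    and lim: "\<And>t. 0 \<le> t \<Longrightarrow> (\<lambda>n. a n (Suc (grid_index n t))) \<longlonglongrightarrow> F t"
  shows "(\<lambda>t. F t * indicator {0..} t) \<in> borel_measurable borel"
    and "(\<lambda>n. ennreal (1 - exp (- q / 2 ^ n)) * (\<Sum>k. ennreal (exp (- q / 2 ^ n) ^ k) * a n k)) \<longlonglongrightarrow>
      (\<integral>\<^sup>+t. exp_weight q t * F t \<partial>lborel)"
proof -
  note lim' = nn_integral_exponential_tendsto[OF q, of "\<lambda>n t. a n (Suc (grid_index n t))" F, OF _ le lim]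
  show "(\<lambda>t. F t * indicator {0..} t) \<in> borel_measurable borel" by (rule lim'(1)) measurable
  define \<rho> where "\<rho> n = exp (- q / 2 ^ n)" for n
  define I where "I n = (\<integral>\<^sup>+t. exp_weight q t * a n (Suc (grid_index n t)) \<partial>lborel)" for n
  let ?L = "\<integral>\<^sup>+t. exp_weight q t * F t \<partial>lborel"
  have I: "I \<longlonglongrightarrow> ?L" unfolding I_def[abs_def] by (rule lim'(2)) measurable
  have \<rho>: "0 < \<rho> n" "\<rho> n < 1" for n using q by (auto simp: \<rho>_def)
  have \<rho>_lim: "\<rho> \<longlonglongrightarrow> 1"
  proof -
    have "(\<lambda>n. 1 / 2 ^ n :: real) \<longlonglongrightarrow> 0"
      using LIMSEQ_realpow_zero[of "1/2 :: real"] by (simp add: power_one_over)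
    from tendsto_exp[OF tendsto_mult_right_zero[OF this, of "- q"]] show ?thesis
      by (simp add: \<rho>_def[abs_def])
  qed
  have eq: "ennreal (1 - \<rho> n) * (\<Sum>k. ennreal (\<rho> n ^ k) * a n k) = ennreal (1 - \<rho> n) * a n 0 + ennreal (\<rho> n) * I n" for n
  proof -
    have "(\<Sum>k. ennreal (\<rho> n ^ k) * a n k) = a n 0 + (\<Sum>k. ennreal (\<rho> n ^ Suc k) * a n (Suc k))"
      by (subst suminf_offset[where i = 1]) auto
    also have "(\<Sum>k. ennreal (\<rho> n ^ Suc k) * a n (Suc k)) = ennreal (\<rho> n) * (\<Sum>k. ennreal (\<rho> n ^ k) * a n (Suc k))"
      using \<rho>[of n] by (simp add: ennreal_mult mult.assoc)
    finally show ?thesis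
      unfolding I_def nn_integral_grid_index[OF q, of "\<lambda>k. a n (Suc k)" n] \<rho>_def[symmetric]
      by (simp add: algebra_simps)
  qed
  have "(\<lambda>n. ennreal (1 - \<rho> n)) \<longlonglongrightarrow> ennreal (1 - 1)" by (intro tendsto_intros \<rho>_lim)
  then have "(\<lambda>n. ennreal (1 - \<rho> n)) \<longlonglongrightarrow> 0" by simp
  moreover have "ennreal (1 - \<rho> n) * a n 0 \<le> ennreal (1 - \<rho> n)" for n
    using mult_left_mono[OF le[of n 0], of "ennreal (1 - \<rho> n)"] by simp
  ultimately have "(\<lambda>n. ennreal (1 - \<rho> n) * a n 0) \<longlonglongrightarrow> 0"
    by (intro tendsto_sandwich[of "\<lambda>_. 0" "\<lambda>n. ennreal (1 - \<rho> n) * a n 0" sequentially "\<lambda>n. ennreal (1 - \<rho> n)"]) auto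
  moreover have "(\<lambda>n. ennreal (\<rho> n) * I n) \<longlonglongrightarrow> ennreal 1 * ?L"
    by (intro tendsto_mult_ennreal I tendsto_ennrealI \<rho>_lim) auto
  ultimately have "(\<lambda>n. ennreal (1 - \<rho> n) * a n 0 + ennreal (\<rho> n) * I n) \<longlonglongrightarrow> 0 + ennreal 1 * ?L"
    by (rule tendsto_add)
  then show "(\<lambda>n. ennreal (1 - exp (- q / 2 ^ n)) * (\<Sum>k. ennreal (exp (- q / 2 ^ n) ^ k) * a n k)) \<longlonglongrightarrow> ?L"
    unfolding eq[symmetric] by (simp add: \<rho>_def)
qed

lemma exp_walk_max: "0 \<le> \<gamma> \<Longrightarrow> exp (- \<gamma> * walk_max w k) = (MIN i\<in>{..k}. exp (- \<gamma> * walk w i))"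
proof (rule Min_eqI[symmetric])
  assume \<gamma>: "0 \<le> \<gamma>"
  show "exp (- \<gamma> * walk_max w k) \<le> e" if "e \<in> (\<lambda>i. exp (- \<gamma> * walk w i)) ` {..k}" for e
    using that \<gamma> by (auto simp: walk_max_def intro!: mult_left_mono)
  have "walk_max w k \<in> walk w ` {..k}" unfolding walk_max_def by (rule Max_in) auto
  then show "exp (- \<gamma> * walk_max w k) \<in> (\<lambda>i. exp (- \<gamma> * walk w i)) ` {..k}" by auto
qed simp

text \<open>The start at 0 is required on every path and not just almost surely, so that the path
  sampled on a grid is exactly the walk of its increments.\<close>

locale normalized_levy_process = levy_process +
  assumes start: "\<And>\<omega>. \<omega> \<in> space M \<Longrightarrow> X 0 \<omega> = 0"
begin

definition grid_increments :: "nat \<Rightarrow> 'a \<Rightarrow> nat \<Rightarrow> real" where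
  "grid_increments n \<omega> = (\<lambda>j. X (real (Suc j) / 2 ^ n) \<omega> - X (real j / 2 ^ n) \<omega>)"

definition step_law :: "nat \<Rightarrow> real measure" where
  "step_law n = distr M borel (X (1 / 2 ^ n))"

lemma measurable_X' [measurable (raw)]: "0 \<le> t \<Longrightarrow> (\<lambda>\<omega>. X t \<omega>) \<in> borel_measurable M"
  using measurable_X[of t] by simp

lemma walk_grid_increments: "\<omega> \<in> space M \<Longrightarrow> walk (grid_increments n \<omega>) k = X (real k / 2 ^ n) \<omega>"
  unfolding walk_def grid_increments_def using start[of \<omega>]
  by (subst sum_lessThan_telescope) simp

lemma random_walk_step_law: "random_walk (step_law n)"
proof -
  interpret step: prob_space "step_law n"
    unfolding step_law_def by (rule prob_space_distr) (simp add: measurable_X)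
  show ?thesis by unfold_locales (simp_all add: step_law_def)
qed

text \<open>Independence of an infinite family concerns finite subfamilies. Each of these lies in an
  initial segment, to which the assumption on increments applies at the times i / 2^n.\<close>

lemma indep_grid_increments:
  "indep_vars (\<lambda>_. borel) (\<lambda>j \<omega>. grid_increments n \<omega> j) UNIV"
proof -
  have fin: "indep_vars (\<lambda>_. borel) (\<lambda>j \<omega>. grid_increments n \<omega> j) {..<m}" for m
    using indep_increments[of "\<lambda>i. real i / 2 ^ n" m]
    by (simp add: grid_increments_def divide_strict_right_mono)
  have rv: "random_variable borel (\<lambda>\<omega>. grid_increments n \<omega> j)" for j
    unfolding grid_increments_def by measurable
  show ?thesis
    unfolding indep_vars_def2
  proof (intro conjI ballI rv)
    show "indep_sets (\<lambda>i. {(\<lambda>\<omega>. grid_increments n \<omega> i) -` A \<inter> space M |A. A \<in> sets borel}) UNIV"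
    proof (subst indep_sets_finite_index_sets, intro allI impI)
      fix J :: "nat set" assume "J \<subseteq> UNIV" "J \<noteq> {}" "finite J"
      then obtain m where "J \<subseteq> {..<m}" using finite_nat_iff_bounded by blast
      then show "indep_sets (\<lambda>i. {(\<lambda>\<omega>. grid_increments n \<omega> i) -` A \<inter> space M |A. A \<in> sets borel}) J"
        by (rule indep_sets_mono_index) (use fin[of m] in \<open>simp add: indep_vars_def2\<close>)
    qed
  qed
qed

lemma distr_grid_increments:
  "distr M (PiM UNIV (\<lambda>_. step_law n)) (grid_increments n) = PiM UNIV (\<lambda>_. step_law n)"
proof -
  have law: "distr M borel (\<lambda>\<omega>. grid_increments n \<omega> j) = step_law n" for j
    unfolding grid_increments_def step_law_def
    using stationary_increments[of "real j / 2 ^ n" "1 / 2 ^ n"]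
    by (simp add: add_divide_distrib add.commute)
  have rv: "random_variable borel (\<lambda>\<omega>. grid_increments n \<omega> j)" for j
    unfolding grid_increments_def by measurable
  have "distr M (PiM UNIV (\<lambda>_. borel)) (\<lambda>\<omega>. \<lambda>j\<in>UNIV. grid_increments n \<omega> j) =
      PiM UNIV (\<lambda>j. distr M borel (\<lambda>\<omega>. grid_increments n \<omega> j))"
    using indep_grid_increments[of n] by (subst (asm) indep_vars_iff_distr_eq_PiM) (auto simp: rv)
  moreover have "sets (PiM UNIV (\<lambda>_. step_law n)) = sets (PiM (UNIV :: nat set) (\<lambda>_. borel))"
    by (intro sets_PiM_cong) (auto simp: step_law_def)
  ultimately show ?thesis unfolding law by (simp add: restrict_def cong: distr_cong)
qed

lemma measurable_grid_increments [measurable]: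
  "grid_increments n \<in> measurable M (PiM UNIV (\<lambda>_. step_law n))"
proof -
  interpret random_walk "step_law n" by (rule random_walk_step_law)
  show ?thesis by (rule measurable_into_S) (simp add: grid_increments_def)
qed

lemma nn_integral_grid_increments:
  assumes "F \<in> borel_measurable (PiM UNIV (\<lambda>_. step_law n))"
  shows "(\<integral>\<^sup>+w. F w \<partial>PiM UNIV (\<lambda>_. step_law n)) = (\<integral>\<^sup>+\<omega>. F (grid_increments n \<omega>) \<partial>M)"
  using nn_integral_distr[OF measurable_grid_increments[of n], of F] assms
  by (simp add: distr_grid_increments)

lemma right_continuous_X [simp]: "\<omega> \<in> space M \<Longrightarrow> 0 \<le> t \<Longrightarrow> continuous (at_right t) (\<lambda>s. X s \<omega>)"
  by (rule right_continuous)

text \<open>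
  \<open>exp (- \<gamma> S)\<close> for the running supremum \<open>S\<close> is written as an infimum of exponentials: this is bounded
  below, so no bound on the paths is needed.
\<close>

definition inf_exp :: "real \<Rightarrow> real \<Rightarrow> 'a \<Rightarrow> real" where
  "inf_exp \<gamma> t \<omega> = (INF s\<in>{0..t}. exp (- \<gamma> * X s \<omega>))"

definition sup_transform :: "real \<Rightarrow> real \<Rightarrow> ennreal" where
  "sup_transform \<gamma> t = (\<integral>\<^sup>+\<omega>. ennreal (inf_exp \<gamma> t \<omega>) \<partial>M)"

section \<open>The running supremum as a limit of walk maxima\<close>

lemma exp_walk_max_tendsto:
  assumes "\<omega> \<in> space M" "0 \<le> \<gamma>" "0 \<le> t"
  shows "(\<lambda>n. exp (- \<gamma> * walk_max (grid_increments n \<omega>) (Suc (grid_index n t)))) \<longlonglongrightarrow> inf_exp \<gamma> t \<omega>"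
proof -
  have "(\<lambda>n. MIN i\<in>{..Suc (grid_index n t)}. exp (- \<gamma> * X (0 + i / 2 ^ n) \<omega>)) \<longlonglongrightarrow> (INF s\<in>{0..t}. exp (- \<gamma> * X s \<omega>))"
    using assms grid_index_tendsto[of t] grid_index_bounds[of t]
    by (intro grid_Min_tendsto_INF) (auto intro!: continuous_intros)
  then show ?thesis
    unfolding exp_walk_max[OF assms(2)] inf_exp_def walk_grid_increments[OF assms(1)] by simp
qed

lemma inf_exp_bounds:
  assumes "\<omega> \<in> space M" "0 \<le> t"
  shows "0 \<le> inf_exp \<gamma> t \<omega>" "inf_exp \<gamma> t \<omega> \<le> 1"
proof -
  show "0 \<le> inf_exp \<gamma> t \<omega>" unfolding inf_exp_def using assms by (intro cINF_greatest) auto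
  have "inf_exp \<gamma> t \<omega> \<le> exp (- \<gamma> * X 0 \<omega>)"
    unfolding inf_exp_def using assms by (intro cINF_lower bdd_belowI2[of _ 0]) auto
  then show "inf_exp \<gamma> t \<omega> \<le> 1" using start[OF assms(1)] by simp
qed

lemma measurable_exp_walk_max [measurable]:
  "(\<lambda>\<omega>. walk_max (grid_increments n \<omega>) k) \<in> borel_measurable M"
proof -
  interpret random_walk "step_law n" by (rule random_walk_step_law)
  show ?thesis by (rule measurable_compose[OF measurable_grid_increments measurable_walk_max])
qed

lemma measurable_inf_exp [measurable]: "0 \<le> \<gamma> \<Longrightarrow> 0 \<le> t \<Longrightarrow> inf_exp \<gamma> t \<in> borel_measurable M"
  by (rule borel_measurable_LIMSEQ_real[OF exp_walk_max_tendsto]) auto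

lemma sup_transform_tendsto:
  assumes "0 \<le> \<gamma>" "0 \<le> t"
  shows "(\<lambda>n. \<integral>\<^sup>+\<omega>. ennreal (exp (- \<gamma> * walk_max (grid_increments n \<omega>) (Suc (grid_index n t)))) \<partial>M)
    \<longlonglongrightarrow> sup_transform \<gamma> t"
  unfolding sup_transform_def
proof (rule nn_integral_tendsto_le_1)
  show "exp (- \<gamma> * walk_max (grid_increments n \<omega>) (Suc (grid_index n t))) \<le> 1" for n \<omega>
    using assms walk_max_nonneg by (simp add: mult_nonneg_nonneg)
  show "(\<lambda>n. exp (- \<gamma> * walk_max (grid_increments n \<omega>) (Suc (grid_index n t)))) \<longlonglongrightarrow> inf_exp \<gamma> t \<omega>"
    if "\<omega> \<in> space M" for \<omega>
    using assms that by (intro exp_walk_max_tendsto)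
qed simp

lemma sup_transform_le_1: "0 \<le> t \<Longrightarrow> sup_transform \<gamma> t \<le> 1"
proof -
  assume "0 \<le> t"
  then have "sup_transform \<gamma> t \<le> (\<integral>\<^sup>+\<omega>. 1 \<partial>M)"
    unfolding sup_transform_def by (intro nn_integral_mono) (simp add: inf_exp_bounds)
  then show ?thesis by (simp add: emeasure_space_1)
qed

text \<open>E exp(- \<gamma> S) for the supremum S up to an independent Exp(q) time. The clock is
  integrated out against its density, so that the probability space need not carry such a
  time.\<close>

definition killed_transform :: "real \<Rightarrow> real \<Rightarrow> ennreal" where
  "killed_transform q \<gamma> = (\<integral>\<^sup>+t. exp_weight q t * sup_transform \<gamma> t \<partial>lborel)"

text \<open>The same transform for the walk of mesh 2^-n stopped at a geometric time: the factor in
  front makes the weights sum to 1.\<close>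

definition grid_transform :: "real \<Rightarrow> real \<Rightarrow> nat \<Rightarrow> ennreal" where
  "grid_transform q \<gamma> n = ennreal (1 - exp (- q / 2 ^ n)) * (\<Sum>k. ennreal (exp (- q / 2 ^ n) ^ k) *
     (\<integral>\<^sup>+w. ennreal (exp (- \<gamma> * walk_max w k)) \<partial>PiM UNIV (\<lambda>_. step_law n)))"

lemma
  assumes "0 < q" "0 \<le> \<gamma>"
  shows measurable_sup_transform: "(\<lambda>t. sup_transform \<gamma> t * indicator {0..} t) \<in> borel_measurable borel"
    and grid_transform_tendsto: "grid_transform q \<gamma> \<longlonglongrightarrow> killed_transform q \<gamma>"
proof -
  define a where "a n k = (\<integral>\<^sup>+\<omega>. ennreal (exp (- \<gamma> * walk_max (grid_increments n \<omega>) k)) \<partial>M)" for n k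
  have le: "a n k \<le> 1" for n k
  proof -
    have "a n k \<le> (\<integral>\<^sup>+\<omega>. 1 \<partial>M)"
      unfolding a_def using assms walk_max_nonneg by (intro nn_integral_mono) (simp add: mult_nonneg_nonneg)
    then show ?thesis by (simp add: emeasure_space_1)
  qed
  have "(\<integral>\<^sup>+w. ennreal (exp (- \<gamma> * walk_max w k)) \<partial>PiM UNIV (\<lambda>_. step_law n)) = a n k" for n k
  proof -
    interpret random_walk "step_law n" by (rule random_walk_step_law)
    show ?thesis unfolding a_def by (rule nn_integral_grid_increments) measurable
  qed
  then have eq: "grid_transform q \<gamma> = (\<lambda>n. ennreal (1 - exp (- q / 2 ^ n)) * (\<Sum>k. ennreal (exp (- q / 2 ^ n) ^ k) * a n k))"
    unfolding grid_transform_def by simp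
  have lim: "(\<lambda>n. a n (Suc (grid_index n t))) \<longlonglongrightarrow> sup_transform \<gamma> t" if "0 \<le> t" for t
    unfolding a_def using assms that by (intro sup_transform_tendsto) auto
  show "(\<lambda>t. sup_transform \<gamma> t * indicator {0..} t) \<in> borel_measurable borel"
    by (rule geometric_to_exponential(1)[where a = a and q = q]) (use assms le lim in auto)
  show "grid_transform q \<gamma> \<longlonglongrightarrow> killed_transform q \<gamma>"
    unfolding eq killed_transform_def by (rule geometric_to_exponential(2)[where a = a and q = q]) (use assms le lim in auto)
qed

end

section \<open>First passage and the Wiener-Hopf identity in the limit\<close>

lemma (in random_walk) prob_S: "(\<integral>\<^sup>+w. 1 \<partial>S) = 1"
  by (simp add: P.emeasure_space_1)

lemma suminf_geometric_ennreal:
  assumes "0 \<le> x" "x < 1"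
  shows "(\<Sum>k. ennreal x ^ k) = ennreal (1 / (1 - x))"
proof -
  have "(\<Sum>k. ennreal x ^ k) = (\<Sum>k. ennreal (x ^ k))" using assms by (simp add: ennreal_power)
  also have "\<dots> = ennreal (\<Sum>k. x ^ k)" using assms by (intro suminf_ennreal2 summable_geometric) auto
  finally show ?thesis using assms by (simp add: suminf_geometric)
qed

lemma suminf_geometric_ennreal_top:
  assumes "1 \<le> x"
  shows "(\<Sum>k. x ^ k) = (\<top> :: ennreal)"
proof -
  have pow: "1 \<le> x ^ k" for k
  proof (induction k)
    case (Suc k)
    have "1 * 1 \<le> x * x ^ k" by (rule mult_mono) (use assms Suc in auto)
    then show ?case by simp
  qed simp
  have "of_nat n \<le> (\<Sum>k. x ^ k)" for n
  proof -
    have "(of_nat n :: ennreal) = (\<Sum>k<n. 1)" by simp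
    also have "\<dots> \<le> (\<Sum>k<n. x ^ k)" by (intro sum_mono pow)
    also have "\<dots> \<le> (\<Sum>k. x ^ k)" by (intro sum_le_suminf summableI) simp_all
    finally show ?thesis .
  qed
  then have "(\<Squnion>n. of_nat n :: ennreal) \<le> (\<Sum>k. x ^ k)" by (rule SUP_least)
  then show ?thesis by (simp add: ennreal_SUP_of_nat_eq_top top_unique)
qed

lemma one_minus_exp_grid_tendsto:
  "(\<lambda>n. (1 - exp (- c / 2 ^ n)) * 2 ^ n) \<longlonglongrightarrow> (c :: real)"
proof (cases "c = 0")
  case False
  have 0: "(\<lambda>n. - c / 2 ^ n) \<longlonglongrightarrow> 0"
    using tendsto_mult_right_zero[OF LIMSEQ_realpow_zero[of "1/2 :: real"], of "- c"] by (simp add: power_one_over)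
  have "filterlim (\<lambda>n. - c / 2 ^ n) (at 0) sequentially"
    using 0 False by (auto simp: filterlim_at)
  from filterlim_compose[OF lim_exp_minus_1 this]
  have "(\<lambda>n. (exp (- c / 2 ^ n) - 1) / (- c / 2 ^ n)) \<longlonglongrightarrow> 1" by simp
  from tendsto_mult_left[OF this, of c]
  have "(\<lambda>n. c * ((exp (- c / 2 ^ n) - 1) / (- c / 2 ^ n))) \<longlonglongrightarrow> c" by simp
  moreover have "c * ((exp (- c / 2 ^ n) - 1) / (- c / 2 ^ n)) = (1 - exp (- c / 2 ^ n)) * 2 ^ n" for n
    using False by (simp add: divide_simps) (simp add: algebra_simps)
  ultimately show ?thesis by simp
qed simp

section \<open>First-passage transforms and exponential moments\<close>

context normalized_levy_process
begin

definition hit_transform :: "real \<Rightarrow> nat \<Rightarrow> real \<Rightarrow> ennreal" where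
  "hit_transform q n x = (\<integral>\<^sup>+\<omega>. path_hit q n x (\<lambda>t. X t \<omega>) \<partial>M)"

text \<open>By nested grids and right-continuity this is E exp(- q \<tau>) for the first passage
  time \<tau> of the process below \<open>- x\<close>, paths without passage contributing 0.
  Equivalently it is the tail at \<open>x\<close> of the negative of the infimum up to an Exp(q)
  time.\<close>

definition hit_limit :: "real \<Rightarrow> real \<Rightarrow> ennreal" where
  "hit_limit q x = (\<Squnion>n. hit_transform q n x)"

text \<open>The exponential moment of one grid step, valued in \<open>ennreal\<close> because its
  finiteness is a later result.\<close>

definition mgf :: "real \<Rightarrow> nat \<Rightarrow> ennreal" where
  "mgf \<gamma> n = (\<integral>\<^sup>+\<omega>. ennreal (exp (- \<gamma> * X (1 / 2 ^ n) \<omega>)) \<partial>M)"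

lemma hit_discount_grid:
  "\<omega> \<in> space M \<Longrightarrow> hit_discount (exp (- q / 2 ^ n)) x (grid_increments n \<omega>) = path_hit q n x (\<lambda>t. X t \<omega>)"
  by (simp add: hit_discount_def path_hit_def walk_grid_increments)

lemma measurable_path_hit [measurable]: "(\<lambda>\<omega>. path_hit q n x (\<lambda>t. X t \<omega>)) \<in> borel_measurable M"
proof -
  interpret random_walk "step_law n" by (rule random_walk_step_law)
  have "(\<lambda>\<omega>. hit_discount (exp (- q / 2 ^ n)) x (grid_increments n \<omega>)) \<in> borel_measurable M"
    by (intro measurable_hit_discount) measurable
  then show ?thesis by (rule measurable_cong[THEN iffD1, rotated]) (rule hit_discount_grid)
qed

lemma nn_integral_hit_discount_eq:
  "(\<integral>\<^sup>+w. hit_discount (exp (- q / 2 ^ n)) x w \<partial>PiM UNIV (\<lambda>_. step_law n)) = hit_transform q n x"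
proof -
  interpret random_walk "step_law n" by (rule random_walk_step_law)
  show ?thesis
    unfolding hit_transform_def
    by (subst nn_integral_grid_increments) (auto intro!: nn_integral_cong hit_discount_grid[simplified])
qed

lemma path_hit_le_1: "0 < q \<Longrightarrow> path_hit q n x y \<le> 1"
  unfolding path_hit_def by (intro SUP_least) (auto intro: power_le_one)

lemma hit_transform_le_1: "0 < q \<Longrightarrow> hit_transform q n x \<le> 1"
proof -
  assume "0 < q"
  then have "hit_transform q n x \<le> (\<integral>\<^sup>+\<omega>. 1 \<partial>M)"
    unfolding hit_transform_def by (intro nn_integral_mono path_hit_le_1)
  then show ?thesis by (simp add: emeasure_space_1)
qed

lemma hit_limit_le_1: "0 < q \<Longrightarrow> hit_limit q x \<le> 1"
  unfolding hit_limit_def by (intro SUP_least hit_transform_le_1)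

lemma hit_limit_neq_top: "0 < q \<Longrightarrow> hit_limit q x \<noteq> \<top>"
  by (rule neq_top_trans[OF _ hit_limit_le_1]) simp_all

lemma incseq_hit_transform: "incseq (\<lambda>n. hit_transform q n x)"
  unfolding hit_transform_def using path_hit_incseq
  by (auto intro!: incseq_SucI nn_integral_mono dest: incseq_SucD)

lemma hit_transform_tendsto: "(\<lambda>n. hit_transform q n x) \<longlonglongrightarrow> hit_limit q x"
  unfolding hit_limit_def by (rule LIMSEQ_SUP[OF incseq_hit_transform])

lemma hit_limit_eq: "hit_limit q x = (\<integral>\<^sup>+\<omega>. (\<Squnion>n. path_hit q n x (\<lambda>t. X t \<omega>)) \<partial>M)"
  unfolding hit_limit_def hit_transform_def
  using path_hit_incseq by (intro nn_integral_monotone_convergence_SUP[symmetric]) (auto simp: incseq_def le_fun_def)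

lemma hit_limit_mono: "x \<le> x' \<Longrightarrow> hit_limit q x' \<le> hit_limit q x"
  unfolding hit_limit_eq by (intro nn_integral_mono SUP_mono) (auto intro: path_hit_mono)

lemma hit_limit_supermultiplicative:
  assumes "0 \<le> x" "0 \<le> y" "0 < q"
  shows "hit_limit q x * hit_limit q y \<le> hit_limit q (x + y)"
proof (rule LIMSEQ_le)
  show "(\<lambda>n. hit_transform q n x * hit_transform q n y) \<longlonglongrightarrow> hit_limit q x * hit_limit q y"
    using hit_limit_neq_top[OF assms(3)]
    by (intro tendsto_mult_ennreal hit_transform_tendsto) auto
  show "(\<lambda>n. hit_transform q n (x + y)) \<longlonglongrightarrow> hit_limit q (x + y)" by (rule hit_transform_tendsto)
  show "\<exists>N. \<forall>n\<ge>N. hit_transform q n x * hit_transform q n y \<le> hit_transform q n (x + y)"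
  proof (intro exI allI impI)
    fix n
    interpret random_walk "step_law n" by (rule random_walk_step_law)
    show "hit_transform q n x * hit_transform q n y \<le> hit_transform q n (x + y)"
      unfolding nn_integral_hit_discount_eq[symmetric]
      using assms by (intro hit_discount_supermultiplicative) auto
  qed
qed

text \<open>Two increasing limits, in the mesh and in the level, are exchanged. The result is used
  to let the slack in the submultiplicative bound tend to 0.\<close>

lemma hit_limit_right_continuous: "(\<Squnion>m. hit_limit q (x + 1 / real (Suc m))) = hit_limit q x"
proof -
  have "(\<Squnion>m. hit_limit q (x + 1 / real (Suc m))) = (\<Squnion>n. \<Squnion>m. hit_transform q n (x + 1 / real (Suc m)))"
    unfolding hit_limit_def by (rule SUP_commute)
  also have "\<dots> = (\<Squnion>n. hit_transform q n x)"
  proof (rule SUP_cong[OF refl])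
    fix n
    have "incseq (\<lambda>m \<omega>. path_hit q n (x + 1 / real (Suc m)) (\<lambda>t. X t \<omega>))"
      by (auto simp: incseq_def le_fun_def intro!: path_hit_mono divide_left_mono)
    then have "(\<Squnion>m. hit_transform q n (x + 1 / real (Suc m))) =
        (\<integral>\<^sup>+\<omega>. (\<Squnion>m. path_hit q n (x + 1 / real (Suc m)) (\<lambda>t. X t \<omega>)) \<partial>M)"
      unfolding hit_transform_def by (intro nn_integral_monotone_convergence_SUP[symmetric]) auto
    then show "(\<Squnion>m. hit_transform q n (x + 1 / real (Suc m))) = hit_transform q n x"
      unfolding path_hit_SUP_right by (simp add: hit_transform_def)
  qed
  finally show ?thesis by (simp add: hit_limit_def)
qed

text \<open>This excludes a product \<infinity> * 0, across which limits in \<open>ennreal\<close>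
  cannot be taken. If the transform vanished, monotonicity in time would make
  \<open>sup_transform\<close> zero at every t > 0, but right-continuity at time 0 makes it tend to
  1 as t decreases to 0.\<close>

lemma killed_transform_nonzero: "0 \<le> \<gamma> \<Longrightarrow> killed_transform q \<gamma> = 0 \<Longrightarrow> 0 < q \<Longrightarrow> False"
proof -
  assume \<gamma>: "0 \<le> \<gamma>" and q: "0 < q" and 0: "killed_transform q \<gamma> = 0"
  note [measurable] = measurable_sup_transform[OF q \<gamma>]
  have "(\<integral>\<^sup>+t. ennreal (q * exp (- q * t)) * (sup_transform \<gamma> t * indicator {0..} t) \<partial>lborel) = 0"
    using 0 unfolding killed_transform_def by (simp add: mult_ac)
  then have "AE t in lborel. ennreal (q * exp (- q * t)) * (sup_transform \<gamma> t * indicator {0..} t) = 0"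
    by (subst (asm) nn_integral_0_iff_AE) auto
  then have AE0: "AE t in lborel. 0 \<le> t \<longrightarrow> sup_transform \<gamma> t = 0"
    using q by (auto simp: indicator_def elim!: eventually_mono)
  have anti: "sup_transform \<gamma> t \<le> sup_transform \<gamma> s" if "0 \<le> s" "s \<le> t" for s t
    unfolding sup_transform_def inf_exp_def using that
    by (intro nn_integral_mono ennreal_leI cINF_superset_mono bdd_belowI2[of _ 0]) auto
  have zero: "sup_transform \<gamma> t = 0" if "0 < t" for t
  proof -
    have "\<exists>s. 0 < s \<and> s < t \<and> sup_transform \<gamma> s = 0"
    proof (rule ccontr)
      assume "\<not> ?thesis"
      then have "AE s in lborel. s \<notin> {0<..<t}" using AE0 by (auto elim!: eventually_mono)
      then have "{0<..<t} \<in> null_sets lborel" by (subst AE_iff_null_sets) auto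
      then show False using that by (simp add: null_sets_def)
    qed
    then obtain s where "0 < s" "s < t" "sup_transform \<gamma> s = 0" by blast
    then show ?thesis using anti[of s t] by simp
  qed
  have "(\<lambda>n. sup_transform \<gamma> (1 / real (Suc n))) \<longlonglongrightarrow> (\<integral>\<^sup>+\<omega>. ennreal 1 \<partial>M)"
    unfolding sup_transform_def
  proof (rule nn_integral_tendsto_le_1)
    show "inf_exp \<gamma> (1 / real (Suc n)) \<omega> \<le> 1" if "\<omega> \<in> space M" for n \<omega>
      using inf_exp_bounds(2)[OF that] by simp
    show "(\<lambda>n. inf_exp \<gamma> (1 / real (Suc n)) \<omega>) \<longlonglongrightarrow> 1" if \<omega>: "\<omega> \<in> space M" for \<omega>
    proof (rule order_tendstoI)
      fix c :: real
      {
        assume c: "c < 1"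
        have "continuous (at_right 0) (\<lambda>s. exp (- \<gamma> * X s \<omega>))"
          using \<omega> by (auto intro!: continuous_intros)
        then obtain d where d: "0 < d" "\<And>s. 0 \<le> s \<Longrightarrow> s < 0 + d \<Longrightarrow> \<bar>exp (- \<gamma> * X s \<omega>) - exp (- \<gamma> * X 0 \<omega>)\<bar> < (1 - c) / 2"
          by (rule continuous_at_right_eps[of 0 _ "(1 - c) / 2"]) (use c in auto)
        have "\<forall>\<^sub>F n in sequentially. 1 / real (Suc n) < d"
          using order_tendstoD(2)[OF LIMSEQ_inverse_real_of_nat d(1)] by (simp add: inverse_eq_divide)
        then show "\<forall>\<^sub>F n in sequentially. c < inf_exp \<gamma> (1 / real (Suc n)) \<omega>"
        proof eventually_elim
          case (elim n)
          have "(1 + c) / 2 \<le> inf_exp \<gamma> (1 / real (Suc n)) \<omega>"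
            unfolding inf_exp_def
          proof (rule cINF_greatest)
            fix s assume "s \<in> {0..1 / real (Suc n)}"
            then have "\<bar>exp (- \<gamma> * X s \<omega>) - 1\<bar> < (1 - c) / 2"
              using d(2)[of s] elim start[OF \<omega>] by auto
            then show "(1 + c) / 2 \<le> exp (- \<gamma> * X s \<omega>)"
              unfolding abs_less_iff by (simp add: field_simps)
          qed simp
          then show ?case using c by (simp add: field_simps)
        qed
      }
      {
        assume "1 < c"
        then show "\<forall>\<^sub>F n in sequentially. inf_exp \<gamma> (1 / real (Suc n)) \<omega> < c"
          by (intro always_eventually allI le_less_trans[OF inf_exp_bounds(2)[OF \<omega>]]) simp_all
      }
    qed
  qed (use \<gamma> in simp)
  then have "(\<lambda>n. 0 :: ennreal) \<longlonglongrightarrow> 1" using zero by (simp add: emeasure_space_1)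
  then show False by (simp add: LIMSEQ_const_iff)
qed

lemma nn_integral_exp_walk_eq_mgf:
  "(\<integral>\<^sup>+w. ennreal (exp (- \<gamma> * walk w k)) \<partial>PiM UNIV (\<lambda>_. step_law n)) = mgf \<gamma> n ^ k"
  and mgf_eq: "mgf \<gamma> 0 = mgf \<gamma> n ^ (2 ^ n)"
proof -
  interpret random_walk "step_law n" by (rule random_walk_step_law)
  have eq: "(\<integral>\<^sup>+w. ennreal (exp (- \<gamma> * walk w k)) \<partial>S) = (\<integral>\<^sup>+\<omega>. ennreal (exp (- \<gamma> * X (real k / 2 ^ n) \<omega>)) \<partial>M)" for k
    by (subst nn_integral_grid_increments) (auto simp: walk_grid_increments intro!: nn_integral_cong)
  show *: "(\<integral>\<^sup>+w. ennreal (exp (- \<gamma> * walk w k)) \<partial>S) = mgf \<gamma> n ^ k" for k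
    unfolding nn_integral_exp_walk[of \<gamma> k] eq[of 1] by (simp add: mgf_def)
  show "mgf \<gamma> 0 = mgf \<gamma> n ^ (2 ^ n)"
    using *[of "2 ^ n"] eq[of "2 ^ n"] by (simp add: mgf_def)
qed

text \<open>Here exp(- \<gamma> W) is split as exp(- \<gamma> M) * exp(\<gamma> (M - W)). Its
  expectation at step \<open>k\<close> is a k-th power, so the left side is a geometric series,
  convergent or not.\<close>

lemma wiener_hopf_mgf:
  assumes "0 < q" "0 \<le> \<gamma>"
  shows "ennreal (1 - exp (- q / 2 ^ n)) * (\<Sum>k. (ennreal (exp (- q / 2 ^ n)) * mgf \<gamma> n) ^ k) =
    (1 + (\<integral>\<^sup>+x. ennreal (\<gamma> * exp (\<gamma> * x)) * indicator {0..} x * hit_transform q n x \<partial>lborel)) * grid_transform q \<gamma> n"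
proof -
  interpret random_walk "step_law n" by (rule random_walk_step_law)
  define \<rho> where "\<rho> = exp (- q / 2 ^ n)"
  have \<rho>: "0 \<le> \<rho>" "\<rho> \<le> 1" using assms by (auto simp: \<rho>_def)
  have "(\<Sum>k. ennreal (\<rho> ^ k) * (\<integral>\<^sup>+w. ennreal (exp (- \<gamma> * walk_max w k)) * ennreal (exp (\<gamma> * (walk_max w k - walk w k))) \<partial>S)) =
    (1 + (\<integral>\<^sup>+x. ennreal (\<gamma> * exp (\<gamma> * x)) * indicator {0..} x * (\<integral>\<^sup>+w. hit_discount \<rho> x w \<partial>S) \<partial>lborel)) *
    (\<Sum>k. ennreal (\<rho> ^ k) * (\<integral>\<^sup>+w. ennreal (exp (- \<gamma> * walk_max w k)) \<partial>S))"
    by (rule wiener_hopf[OF _ _ \<rho>]) (use exp_layer_cake[OF assms(2)] in auto)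
  also have "(\<lambda>k. (\<integral>\<^sup>+w. ennreal (exp (- \<gamma> * walk_max w k)) * ennreal (exp (\<gamma> * (walk_max w k - walk w k))) \<partial>S)) =
      (\<lambda>k. mgf \<gamma> n ^ k)"
    unfolding nn_integral_exp_walk_eq_mgf[symmetric]
    by (intro ext nn_integral_cong) (simp add: algebra_simps flip: ennreal_mult' exp_add)
  finally have "(\<Sum>k. ennreal (\<rho> ^ k) * mgf \<gamma> n ^ k) =
    (1 + (\<integral>\<^sup>+x. ennreal (\<gamma> * exp (\<gamma> * x)) * indicator {0..} x * hit_transform q n x \<partial>lborel)) *
    (\<Sum>k. ennreal (\<rho> ^ k) * (\<integral>\<^sup>+w. ennreal (exp (- \<gamma> * walk_max w k)) \<partial>S))"
    unfolding \<rho>_def nn_integral_hit_discount_eq .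
  then show ?thesis
    unfolding grid_transform_def \<rho>_def[symmetric] using \<rho>
    by (simp add: power_mult_distrib ennreal_power mult_ac)
qed

lemma measurable_hit_transform [measurable]: "hit_transform q n \<in> borel_measurable borel"
proof -
  interpret random_walk "step_law n" by (rule random_walk_step_law)
  show ?thesis
    using measurable_nn_integral_hit_discount[of "exp (- q / 2 ^ n)"] unfolding nn_integral_hit_discount_eq .
qed

lemma measurable_hit_limit [measurable]: "hit_limit q \<in> borel_measurable borel"
  unfolding hit_limit_def[abs_def] by measurable

lemma nn_integral_hit_limit:
  assumes [measurable]: "f \<in> borel_measurable borel"
  shows "(\<integral>\<^sup>+x. f x * hit_limit q x \<partial>lborel) = (\<Squnion>n. \<integral>\<^sup>+x. f x * hit_transform q n x \<partial>lborel)"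
    "incseq (\<lambda>n. \<integral>\<^sup>+x. f x * hit_transform q n x \<partial>lborel)"
proof -
  have inc: "incseq (\<lambda>n x. f x * hit_transform q n x)"
    using incseq_hit_transform by (auto simp: incseq_def le_fun_def intro!: mult_left_mono)
  show "(\<integral>\<^sup>+x. f x * hit_limit q x \<partial>lborel) = (\<Squnion>n. \<integral>\<^sup>+x. f x * hit_transform q n x \<partial>lborel)"
    unfolding hit_limit_def SUP_mult_left_ennreal
    by (rule nn_integral_monotone_convergence_SUP[OF inc]) simp
  show "incseq (\<lambda>n. \<integral>\<^sup>+x. f x * hit_transform q n x \<partial>lborel)"
    using inc by (auto simp: incseq_def le_fun_def intro!: nn_integral_mono)
qed

lemma grid_transform_le_1:
  assumes "0 < q" "0 \<le> \<gamma>"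
  shows "grid_transform q \<gamma> n \<le> 1"
proof -
  interpret random_walk "step_law n" by (rule random_walk_step_law)
  define \<rho> where "\<rho> = exp (- q / 2 ^ n)"
  have \<rho>: "0 \<le> \<rho>" "\<rho> < 1" using assms by (auto simp: \<rho>_def)
  have "grid_transform q \<gamma> n \<le> ennreal (1 - \<rho>) * (\<Sum>k. ennreal \<rho> ^ k * 1)"
    unfolding grid_transform_def \<rho>_def[symmetric]
  proof (intro mult_left_mono suminf_le allI)
    fix k
    have "(\<integral>\<^sup>+w. ennreal (exp (- \<gamma> * walk_max w k)) \<partial>S) \<le> (\<integral>\<^sup>+w. 1 \<partial>S)"
      using assms walk_max_nonneg by (intro nn_integral_mono) (simp add: mult_nonneg_nonneg)
    then show "ennreal (\<rho> ^ k) * (\<integral>\<^sup>+w. ennreal (exp (- \<gamma> * walk_max w k)) \<partial>S) \<le> ennreal \<rho> ^ k * 1"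
      unfolding prob_S using \<rho> mult_left_mono[of _ 1 "ennreal (\<rho> ^ k)"] by (simp add: ennreal_power)
  qed auto
  also have "\<dots> = 1" using \<rho> by (simp add: suminf_geometric_ennreal flip: ennreal_mult')
  finally show ?thesis .
qed

lemma mgf_pos: "mgf \<gamma> n \<noteq> 0"
  unfolding mgf_def by (subst nn_integral_0_iff_AE) (auto simp: AE_False)

text \<open>On the grid of mesh 1, a finite right side of the factorisation forces the geometric
  series on the left to converge, so its ratio exp(- q) * \<open>mgf \<gamma> 0\<close> is below 1.
  Information on first passage thus yields finiteness of an exponential moment.\<close>

lemma mgf_less:
  assumes q: "0 < q" and \<gamma>: "0 \<le> \<gamma>"
    and fin: "(\<integral>\<^sup>+x. ennreal (\<gamma> * exp (\<gamma> * x)) * indicator {0..} x * hit_limit q x \<partial>lborel) < \<infinity>"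
  shows "mgf \<gamma> 0 < ennreal (exp q)"
proof -
  have "(\<integral>\<^sup>+x. ennreal (\<gamma> * exp (\<gamma> * x)) * indicator {0..} x * hit_transform q 0 x \<partial>lborel) \<le>
      (\<integral>\<^sup>+x. ennreal (\<gamma> * exp (\<gamma> * x)) * indicator {0..} x * hit_limit q x \<partial>lborel)"
    unfolding hit_limit_def by (intro nn_integral_mono mult_left_mono SUP_upper) auto
  with fin have "(1 + (\<integral>\<^sup>+x. ennreal (\<gamma> * exp (\<gamma> * x)) * indicator {0..} x * hit_transform q 0 x \<partial>lborel)) * grid_transform q \<gamma> 0 < \<infinity>"
    using grid_transform_le_1[OF q \<gamma>, of 0] by (auto simp: ennreal_mult_less_top intro: le_less_trans)
  then have "ennreal (1 - exp (- q)) * (\<Sum>k. (ennreal (exp (- q)) * mgf \<gamma> 0) ^ k) < \<infinity>"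
    using wiener_hopf_mgf[OF q \<gamma>, of 0] by simp
  then have "(\<Sum>k. (ennreal (exp (- q)) * mgf \<gamma> 0) ^ k) \<noteq> \<top>"
    using q by (auto simp: ennreal_mult_top)
  then have "\<not> 1 \<le> ennreal (exp (- q)) * mgf \<gamma> 0"
    using suminf_geometric_ennreal_top by blast
  then have 1: "ennreal (exp (- q)) * mgf \<gamma> 0 < 1" by simp
  have "mgf \<gamma> 0 \<noteq> \<top>"
  proof
    assume "mgf \<gamma> 0 = \<top>"
    with 1 show False by (simp add: ennreal_mult_top)
  qed
  then obtain m where m: "mgf \<gamma> 0 = ennreal m" "0 \<le> m" by (cases "mgf \<gamma> 0") auto
  with 1 have "exp (- q) * m < 1" by (simp add: ennreal_less_iff flip: ennreal_mult' ennreal_1)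
  then have "m < exp q" by (simp add: exp_minus field_simps)
  then show ?thesis using m by (simp add: ennreal_lessI)
qed

text \<open>The left side is E exp(- \<gamma> Y) at an Exp(q) time. On the grid it is (1 - exp(- q /
  2^n)) / (1 - exp(- (q - \<phi>) / 2^n)); multiplying numerator and denominator by 2^n gives
  convergence of both.\<close>

lemma wiener_hopf_limit:
  assumes q: "0 < q" and \<gamma>: "0 \<le> \<gamma>" and \<phi>: "mgf \<gamma> 0 = ennreal (exp \<phi>)" "\<phi> < q"
  shows "ennreal (q / (q - \<phi>)) =
    (1 + (\<integral>\<^sup>+x. ennreal (\<gamma> * exp (\<gamma> * x)) * indicator {0..} x * hit_limit q x \<partial>lborel)) * killed_transform q \<gamma>"
proof -
  define B where "B n = 1 + (\<integral>\<^sup>+x. ennreal (\<gamma> * exp (\<gamma> * x)) * indicator {0..} x * hit_transform q n x \<partial>lborel)" for n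
  define L where "L = 1 + (\<integral>\<^sup>+x. ennreal (\<gamma> * exp (\<gamma> * x)) * indicator {0..} x * hit_limit q x \<partial>lborel)"
  have B: "B \<longlonglongrightarrow> L"
    unfolding B_def[abs_def] L_def nn_integral_hit_limit(1)[of "\<lambda>x. ennreal (\<gamma> * exp (\<gamma> * x)) * indicator {0..} x", simplified]
    by (intro tendsto_add tendsto_const LIMSEQ_SUP nn_integral_hit_limit(2)) auto
  have mgf_n: "mgf \<gamma> n = ennreal (exp (\<phi> / 2 ^ n))" for n
  proof -
    have "mgf \<gamma> n ^ (2 ^ n) = ennreal (exp \<phi>)" using \<phi>(1) mgf_eq by simp
    then have "mgf \<gamma> n \<noteq> \<top>" by (auto simp: top_power_ennreal)
    then obtain m where m: "mgf \<gamma> n = ennreal m" "0 \<le> m" by (cases "mgf \<gamma> n") auto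
    have "m ^ (2 ^ n) = exp \<phi>" using \<open>mgf \<gamma> n ^ (2 ^ n) = ennreal (exp \<phi>)\<close> m by (simp add: ennreal_power)
    also have "\<dots> = exp (\<phi> / 2 ^ n) ^ (2 ^ n)" by (simp flip: exp_of_nat_mult)
    finally have "m = exp (\<phi> / 2 ^ n)" using m(2) by (subst (asm) power_eq_iff_eq_base) auto
    then show ?thesis using m by simp
  qed
  have lhs: "ennreal (1 - exp (- q / 2 ^ n)) * (\<Sum>k. (ennreal (exp (- q / 2 ^ n)) * mgf \<gamma> n) ^ k) =
      ennreal ((1 - exp (- q / 2 ^ n)) * 2 ^ n / ((1 - exp (- (q - \<phi>) / 2 ^ n)) * 2 ^ n))" for n
  proof -
    have "ennreal (exp (- q / 2 ^ n)) * mgf \<gamma> n = ennreal (exp (- (q - \<phi>) / 2 ^ n))"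
      unfolding mgf_n by (simp add: diff_divide_distrib flip: ennreal_mult' exp_add)
    then show ?thesis
      using \<phi>(2) q by (simp add: suminf_geometric_ennreal divide_neg_pos flip: ennreal_mult')
  qed
  have "(\<lambda>n. ennreal ((1 - exp (- q / 2 ^ n)) * 2 ^ n / ((1 - exp (- (q - \<phi>) / 2 ^ n)) * 2 ^ n))) \<longlonglongrightarrow> ennreal (q / (q - \<phi>))"
    using \<phi>(2) by (intro tendsto_ennrealI tendsto_divide one_minus_exp_grid_tendsto) auto
  moreover have "(\<lambda>n. B n * grid_transform q \<gamma> n) \<longlonglongrightarrow> L * killed_transform q \<gamma>"
  proof (rule tendsto_mult_ennreal[OF B grid_transform_tendsto[OF q \<gamma>]])
    have "L \<noteq> 0" by (simp add: L_def)
    moreover have "killed_transform q \<gamma> \<noteq> 0" using killed_transform_nonzero[OF \<gamma> _ q] by blast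
    ultimately show "\<not> (L = 0 \<and> killed_transform q \<gamma> = \<infinity> \<or> L = \<infinity> \<and> killed_transform q \<gamma> = 0)" by simp
  qed
  ultimately show ?thesis
    unfolding lhs[symmetric] wiener_hopf_mgf[OF q \<gamma>] B_def[symmetric] L_def[symmetric]
    by (rule LIMSEQ_unique)
qed

end

section \<open>No negative jumps: the exponential law of the infimum\<close>

locale normalized_spectrally_positive = normalized_levy_process + spectrally_positive_levy_process
begin

text \<open>For almost every path the overshoot contribution is 0 on all sufficiently fine grids, so
  its expectation \<open>E n\<close> tends to 0 by dominated convergence.\<close>

lemma hit_limit_submultiplicative:
  assumes "0 \<le> x" "0 \<le> y" "0 < \<epsilon>" "0 < q"
  shows "hit_limit q (x + y + \<epsilon>) \<le> hit_limit q x * hit_limit q y"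
proof -
  define E where "E n = (\<integral>\<^sup>+\<omega>. (if path_hit q n x (\<lambda>t. X t \<omega>) = path_hit q n (x + \<epsilon>) (\<lambda>t. X t \<omega>)
     then path_hit q n x (\<lambda>t. X t \<omega>) else 0) \<partial>M)" for n
  have "E \<longlonglongrightarrow> (\<integral>\<^sup>+\<omega>. 0 \<partial>M)"
    unfolding E_def
  proof (rule nn_integral_dominated_convergence[where w = "\<lambda>_. 1"])
    show "AE \<omega> in M. (\<lambda>n. if path_hit q n x (\<lambda>t. X t \<omega>) = path_hit q n (x + \<epsilon>) (\<lambda>t. X t \<omega>)
       then path_hit q n x (\<lambda>t. X t \<omega>) else 0) \<longlonglongrightarrow> 0"
      using no_negative_jumps AE_space
    proof eventually_elim
      case (elim \<omega>)
      have "\<forall>\<^sub>F n in sequentially. path_hit q n x (\<lambda>t. X t \<omega>) = path_hit q n (x + \<epsilon>) (\<lambda>t. X t \<omega>)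
          \<longrightarrow> path_hit q n x (\<lambda>t. X t \<omega>) = 0"
        using elim assms left_limits start by (intro path_hit_no_overshoot) auto
      then show ?case by (intro tendsto_eventually) (auto elim: eventually_mono)
    qed
  qed (use assms in \<open>auto simp: emeasure_space_1 path_hit_le_1\<close>)
  then have E: "E \<longlonglongrightarrow> 0" by simp
  have "(\<lambda>n. hit_transform q n x * hit_transform q n y + E n) \<longlonglongrightarrow> hit_limit q x * hit_limit q y + 0"
    using hit_limit_neq_top[OF assms(4)]
    by (intro tendsto_add E tendsto_mult_ennreal hit_transform_tendsto) auto
  moreover have "hit_transform q n (x + y + \<epsilon>) \<le> hit_transform q n x * hit_transform q n y + E n" for n
  proof -
    interpret random_walk "step_law n" by (rule random_walk_step_law)
    let ?\<rho> = "exp (- q / 2 ^ n)"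
    have [measurable]: "Measurable.pred S (\<lambda>w. hit_discount ?\<rho> x w = hit_discount ?\<rho> (x + \<epsilon>) w)"
      unfolding pred_def by (intro borel_measurable_eq measurable_hit_discount) measurable
    have "(\<integral>\<^sup>+w. hit_discount ?\<rho> x w * indicator {w. hit_discount ?\<rho> x w = hit_discount ?\<rho> (x + \<epsilon>) w} w \<partial>S) = E n"
    proof (subst nn_integral_grid_increments)
      show "(\<lambda>w. hit_discount ?\<rho> x w * indicator {w. hit_discount ?\<rho> x w = hit_discount ?\<rho> (x + \<epsilon>) w} w) \<in> borel_measurable S"
        by measurable
    qed (auto intro!: nn_integral_cong simp: E_def indicator_def hit_discount_grid[simplified])
    moreover have "(\<integral>\<^sup>+w. hit_discount ?\<rho> (x + y + \<epsilon>) w \<partial>S) \<le>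
      (\<integral>\<^sup>+w. hit_discount ?\<rho> x w \<partial>S) * (\<integral>\<^sup>+w. hit_discount ?\<rho> y w \<partial>S) +
      (\<integral>\<^sup>+w. hit_discount ?\<rho> x w * indicator {w. hit_discount ?\<rho> x w = hit_discount ?\<rho> (x + \<epsilon>) w} w \<partial>S)"
      using assms by (intro hit_discount_submultiplicative) auto
    ultimately show ?thesis by (simp add: nn_integral_hit_discount_eq[simplified])
  qed
  ultimately have "hit_limit q (x + y + \<epsilon>) \<le> hit_limit q x * hit_limit q y + 0"
    using hit_transform_tendsto by (intro LIMSEQ_le[of "\<lambda>n. hit_transform q n (x + y + \<epsilon>)"]) auto
  then show ?thesis by simp
qed

lemma hit_limit_mult:
  assumes "0 \<le> x" "0 \<le> y" "0 < q"
  shows "hit_limit q (x + y) = hit_limit q x * hit_limit q y"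
proof (rule antisym)
  show "hit_limit q (x + y) \<le> hit_limit q x * hit_limit q y"
    unfolding hit_limit_right_continuous[of q "x + y", symmetric]
    using assms by (intro SUP_least hit_limit_submultiplicative) auto
qed (use assms in \<open>auto intro: hit_limit_supermultiplicative\<close>)

text \<open>The first alternative is the degenerate exponential law of infinite rate, as for a
  subordinator, which never goes below 0. By multiplicativity, vanishing at level 1 forces vanishing
  at every level 1 / (n + 1), hence at all positive levels.\<close>

lemma hit_limit_cases:
  assumes q: "0 < q"
  obtains "\<And>x. 0 < x \<Longrightarrow> hit_limit q x = 0"
  | r where "0 \<le> r" "\<And>x. 0 \<le> x \<Longrightarrow> hit_limit q x = ennreal (exp (- r * x))"
proof (cases "hit_limit q 1 = 0")
  case True
  have "hit_limit q x = 0" if "0 < x" for x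
  proof -
    have pow: "0 < n \<Longrightarrow> hit_limit q (real n * y) = hit_limit q y ^ n" if "0 \<le> y" for n y
    proof (induction n)
      case (Suc n)
      have "real (Suc n) * y = y + real n * y" by (simp add: algebra_simps)
      then have "hit_limit q (real (Suc n) * y) = hit_limit q y * hit_limit q (real n * y)"
        using hit_limit_mult[of y "real n * y" q] that q by simp
      then show ?case using Suc by (cases "n = 0") auto
    qed simp
    obtain n where n: "inverse (real (Suc n)) < x" using reals_Archimedean[OF \<open>0 < x\<close>] by blast
    have "hit_limit q (inverse (real (Suc n))) ^ Suc n = 0"
      using pow[of "inverse (real (Suc n))" "Suc n"] True by simp
    then have "hit_limit q (inverse (real (Suc n))) = 0" by (simp del: power_Suc)
    then show ?thesis using hit_limit_mono[of "inverse (real (Suc n))" x q] n by simp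
  qed
  then show thesis by (rule that(1))
next
  case False
  define a where "a x = enn2real (hit_limit q x)" for x
  have fin: "hit_limit q x < \<top>" for x using hit_limit_le_1[OF q, of x] by (auto intro: le_less_trans)
  have eq: "hit_limit q x = ennreal (a x)" for x using fin[of x] by (simp add: a_def)
  have pos: "0 < a 1" using False fin[of 1] by (simp add: a_def enn2real_positive_iff zero_less_iff_neq_zero)
  have le1: "a 1 \<le> 1" using hit_limit_le_1[OF q, of 1] by (simp add: eq)
  have ax: "a x = exp (ln (a 1) * x)" if "0 \<le> x" for x
    using pos le1 _ _ _ that
  proof (rule multiplicative_imp_exp)
    show "0 \<le> a x" for x by (simp add: a_def)
    show "a y \<le> a x" if "0 \<le> x" "x \<le> y" for x y
      unfolding a_def using that fin by (intro enn2real_mono hit_limit_mono) auto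
    show "a (x + y) = a x * a y" if "0 \<le> x" "0 \<le> y" for x y
      unfolding a_def using that q by (simp add: hit_limit_mult enn2real_mult)
  qed
  show thesis
  proof (rule that(2))
    show "0 \<le> - ln (a 1)" using pos le1 by simp
    show "hit_limit q x = ennreal (exp (- (- ln (a 1)) * x))" if "0 \<le> x" for x
      unfolding eq ax[OF that] by simp
  qed
qed

text \<open>By right-continuity at 0 each path needs some positive time d to fall by 1, so its
  discount is at most exp(- q d), which tends to 0 as q grows.\<close>

lemma hit_limit_tendsto_0: "(\<lambda>m. hit_limit (real (Suc m)) 1) \<longlonglongrightarrow> 0"
proof -
  have "(\<lambda>m. hit_limit (real (Suc m)) 1) \<longlonglongrightarrow> (\<integral>\<^sup>+\<omega>. 0 \<partial>M)"
    unfolding hit_limit_eq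
  proof (rule nn_integral_dominated_convergence[where w = "\<lambda>_. 1"])
    show "AE \<omega> in M. (\<Squnion>n. path_hit (real (Suc m)) n 1 (\<lambda>t. X t \<omega>)) \<le> 1" for m
      by (intro AE_I2 SUP_least path_hit_le_1) simp
    show "AE \<omega> in M. (\<lambda>m. \<Squnion>n. path_hit (real (Suc m)) n 1 (\<lambda>t. X t \<omega>)) \<longlonglongrightarrow> 0"
    proof (rule AE_I2)
      fix \<omega> assume \<omega>: "\<omega> \<in> space M"
      obtain d where d: "0 < d" "\<And>s. 0 \<le> s \<Longrightarrow> s < 0 + d \<Longrightarrow> \<bar>X s \<omega> - X 0 \<omega>\<bar> < 1"
        by (rule continuous_at_right_eps[of 0 "\<lambda>s. X s \<omega>" 1]) (use \<omega> in auto)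
      have "path_hit (real (Suc m)) n 1 (\<lambda>t. X t \<omega>) \<le> ennreal (exp (- real (Suc m) * d))" for m n
      proof (rule path_hit_le)
        show "- 1 \<le> X t \<omega>" if "0 \<le> t" "t < d" for t
          using d(2)[of t] that start[OF \<omega>] by (simp add: abs_less_iff)
      qed simp
      then have le: "(\<Squnion>n. path_hit (real (Suc m)) n 1 (\<lambda>t. X t \<omega>)) \<le> ennreal (exp (- d) ^ Suc m)" for m
        by (intro SUP_least) (simp add: mult.commute[of _ d] del: power_Suc of_nat_Suc flip: exp_of_nat_mult)
      have "(\<lambda>m. exp (- d) ^ Suc m) \<longlonglongrightarrow> 0"
        using d by (intro LIMSEQ_Suc LIMSEQ_realpow_zero) auto
      then have "(\<lambda>m. ennreal (exp (- d) ^ Suc m)) \<longlonglongrightarrow> ennreal 0"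
        by (rule tendsto_ennrealI)
      then have "(\<lambda>m. ennreal (exp (- d) ^ Suc m)) \<longlonglongrightarrow> 0" by simp
      then show "(\<lambda>m. \<Squnion>n. path_hit (real (Suc m)) n 1 (\<lambda>t. X t \<omega>)) \<longlonglongrightarrow> 0"
        by (rule tendsto_sandwich[of "\<lambda>_. 0", rotated 3]) (use le in \<open>auto intro!: always_eventually\<close>)
    qed
  qed (auto simp: emeasure_space_1)
  then show ?thesis by simp
qed

text \<open>The weight is E exp(\<gamma> D) - 1 for the negative D of the infimum, in the three
  regimes: D concentrated at 0, \<gamma> below the rate, and \<gamma> at or above it.\<close>

lemma hit_weight_finite:
  assumes q: "0 < q" and \<gamma>: "0 \<le> \<gamma>"
  shows "(\<And>x. 0 < x \<Longrightarrow> hit_limit q x = 0) \<Longrightarrow>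
      (\<integral>\<^sup>+x. ennreal (\<gamma> * exp (\<gamma> * x)) * indicator {0..} x * hit_limit q x \<partial>lborel) < \<infinity>"
    and "(\<And>x. 0 \<le> x \<Longrightarrow> hit_limit q x = ennreal (exp (- r * x))) \<Longrightarrow> \<gamma> < r \<Longrightarrow>
      1 + (\<integral>\<^sup>+x. ennreal (\<gamma> * exp (\<gamma> * x)) * indicator {0..} x * hit_limit q x \<partial>lborel) = ennreal (r / (r - \<gamma>))"
    and "(\<And>x. 0 \<le> x \<Longrightarrow> hit_limit q x = ennreal (exp (- r * x))) \<Longrightarrow> 0 < \<gamma> \<Longrightarrow> r \<le> \<gamma> \<Longrightarrow>
      (\<integral>\<^sup>+x. ennreal (\<gamma> * exp (\<gamma> * x)) * indicator {0..} x * hit_limit q x \<partial>lborel) = \<infinity>"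
proof -
  assume "\<And>x. 0 < x \<Longrightarrow> hit_limit q x = 0"
  then have "(\<integral>\<^sup>+x. ennreal (\<gamma> * exp (\<gamma> * x)) * indicator {0..} x * hit_limit q x \<partial>lborel) = (\<integral>\<^sup>+x. 0 \<partial>(lborel :: real measure))"
    by (intro nn_integral_cong_AE, intro eventually_mono[OF AE_lborel_singleton[of 0]]) (auto simp: indicator_def less_le)
  then show "(\<integral>\<^sup>+x. ennreal (\<gamma> * exp (\<gamma> * x)) * indicator {0..} x * hit_limit q x \<partial>lborel) < \<infinity>" by simp
next
  assume eq: "\<And>x. 0 \<le> x \<Longrightarrow> hit_limit q x = ennreal (exp (- r * x))"
  then have I: "(\<integral>\<^sup>+x. ennreal (\<gamma> * exp (\<gamma> * x)) * indicator {0..} x * hit_limit q x \<partial>lborel) =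
      (\<integral>\<^sup>+x. ennreal (\<gamma> * exp (\<gamma> * x)) * indicator {0..} x * ennreal (exp (- r * x)) \<partial>lborel)"
    by (intro nn_integral_cong) (auto simp: indicator_def)
  show "1 + (\<integral>\<^sup>+x. ennreal (\<gamma> * exp (\<gamma> * x)) * indicator {0..} x * hit_limit q x \<partial>lborel) = ennreal (r / (r - \<gamma>))"
    if "\<gamma> < r" unfolding I using \<gamma> that by (rule nn_integral_exp_weight)
  show "(\<integral>\<^sup>+x. ennreal (\<gamma> * exp (\<gamma> * x)) * indicator {0..} x * hit_limit q x \<partial>lborel) = \<infinity>"
    if "0 < \<gamma>" "r \<le> \<gamma>" unfolding I using that by (rule nn_integral_exp_weight_top)
qed

text \<open>A rate of at most \<gamma> would keep the passage transform at level 1 at or above exp(-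
  \<gamma>), whereas it tends to 0 along growing killing rates.\<close>

lemma hit_rate_unbounded:
  "\<exists>p>p0. (\<forall>x>0. hit_limit p x = 0) \<or> (\<exists>r>\<gamma>. \<forall>x\<ge>0. hit_limit p x = ennreal (exp (- r * x)))"
proof -
  have "\<forall>\<^sub>F m in sequentially. hit_limit (real (Suc m)) 1 < ennreal (exp (- \<gamma>))"
    using hit_limit_tendsto_0 by (rule order_tendstoD) simp
  moreover have "\<forall>\<^sub>F m in sequentially. p0 < real (Suc m)"
    using filterlim_at_top_dense[THEN iffD1, OF filterlim_compose[OF filterlim_real_sequentially filterlim_Suc]] by blast
  ultimately obtain m where m: "hit_limit (real (Suc m)) 1 < ennreal (exp (- \<gamma>))" "p0 < real (Suc m)"
    by (metis (no_types, lifting) eventually_conj eventually_happens sequentially_bot)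
  have q: "0 < real (Suc m)" by simp
  show ?thesis
  proof (rule hit_limit_cases[OF q])
    assume "\<And>x. 0 < x \<Longrightarrow> hit_limit (real (Suc m)) x = 0"
    then show ?thesis using m by blast
  next
    fix r assume r: "0 \<le> r" "\<And>x. 0 \<le> x \<Longrightarrow> hit_limit (real (Suc m)) x = ennreal (exp (- r * x))"
    then have "\<gamma> < r" using m(1) r(2)[of 1] by (simp add: ennreal_less_iff)
    then show ?thesis using m r by blast
  qed
qed

text \<open>For a killing rate p whose infimum has rate above \<gamma>, or vanishes, the weight is
  finite, and \<open>mgf_less\<close> bounds the moment by exp p.\<close>

lemma mgf_finite:
  assumes "0 \<le> \<gamma>"
  shows "mgf \<gamma> 0 < \<infinity>"
proof -
  obtain p where p: "0 < p" "(\<forall>x>0. hit_limit p x = 0) \<or> (\<exists>r>\<gamma>. \<forall>x\<ge>0. hit_limit p x = ennreal (exp (- r * x)))"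
    using hit_rate_unbounded[of 0 \<gamma>] by blast
  have "(\<integral>\<^sup>+x. ennreal (\<gamma> * exp (\<gamma> * x)) * indicator {0..} x * hit_limit p x \<partial>lborel) < \<infinity>"
    using p(2)
  proof (elim disjE exE conjE)
    assume "\<forall>x>0. hit_limit p x = 0"
    then show ?thesis by (intro hit_weight_finite(1)[OF p(1) assms]) auto
  next
    fix r assume "r > \<gamma>" "\<forall>x\<ge>0. hit_limit p x = ennreal (exp (- r * x))"
    then have "1 + (\<integral>\<^sup>+x. ennreal (\<gamma> * exp (\<gamma> * x)) * indicator {0..} x * hit_limit p x \<partial>lborel) = ennreal (r / (r - \<gamma>))"
      by (intro hit_weight_finite(2)[OF p(1) assms]) auto
    then show ?thesis by (metis ennreal_add_eq_top ennreal_neq_top infinity_ennreal_def less_top)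
  qed
  from mgf_less[OF p(1) assms this] show ?thesis by (auto intro: less_trans)
qed

end

section \<open>A second leg with a different drift\<close>

lemma exp_pos_part_weight_nonneg:
  fixes z \<gamma> r :: real
  assumes "0 \<le> z" "0 \<le> \<gamma>" "0 \<le> r"
  shows "0 \<le> (r * exp (- \<gamma> * z) - \<gamma> * exp (- r * z)) / (r - \<gamma>)"
proof (cases "\<gamma> \<le> r")
  case True
  have "exp (- r * z) \<le> exp (- \<gamma> * z)" using mult_right_mono[OF True assms(1)] by simp
  then have "\<gamma> * exp (- r * z) \<le> r * exp (- \<gamma> * z)" using assms True by (intro mult_mono) auto
  with True show ?thesis by simp
next
  case False
  then have "exp (- \<gamma> * z) \<le> exp (- r * z)" using mult_right_mono[of r \<gamma> z] assms(1) by simp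
  then have "r * exp (- \<gamma> * z) \<le> \<gamma> * exp (- r * z)" using assms False by (intro mult_mono) auto
  with False show ?thesis by (simp add: divide_nonpos_neg)
qed

lemma exp_max_walk:
  assumes "0 \<le> \<gamma>"
  shows "exp (- \<gamma> * max (walk_max w k) (walk w k + walk_max w' l)) =
    min (MIN i\<in>{..k}. exp (- \<gamma> * walk w i)) (MIN i\<in>{..l}. exp (- \<gamma> * (walk w k + walk w' i)))"
proof -
  have "(MIN i\<in>{..l}. exp (- \<gamma> * (walk w k + walk w' i))) = (MIN i\<in>{..l}. exp (- \<gamma> * walk w k) * exp (- \<gamma> * walk w' i))"
    by (simp add: algebra_simps flip: exp_add)
  also have "\<dots> = exp (- \<gamma> * walk w k) * (MIN i\<in>{..l}. exp (- \<gamma> * walk w' i))"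
    using mono_Min_commute[of "\<lambda>x. exp (- \<gamma> * walk w k) * x" "(\<lambda>i. exp (- \<gamma> * walk w' i)) ` {..l}"]
    by (simp add: mono_def mult_left_mono image_image)
  also have "\<dots> = exp (- \<gamma> * (walk w k + walk_max w' l))"
    unfolding exp_walk_max[OF assms, symmetric] by (simp add: algebra_simps flip: exp_add)
  finally show ?thesis
    unfolding exp_walk_max[OF assms, symmetric]
    using assms by (simp add: min_def max_def mult_le_cancel_left) (auto simp: mult_le_cancel_left less_le)
qed

text \<open>For a fixed value z of the continuation, max(M, W + z) = M + max(0, z - (M - W)) brings
  the expectation into the form required by \<open>wiener_hopf\<close>. The actual continuation is
  the maximum over \<open>l\<close> later steps, each shifted by \<open>d\<close>; it is independent
  of the first \<open>k\<close> steps and is integrated last.\<close>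

lemma (in random_walk) nn_integral_max_split:
  fixes d :: real
  assumes \<gamma>: "0 \<le> \<gamma>" and \<rho>: "0 \<le> \<rho>" "\<rho> \<le> 1"
  shows "(\<Sum>k. ennreal (\<rho> ^ k) *
      (\<integral>\<^sup>+w. ennreal (exp (- \<gamma> * max (walk_max w k) (walk w k + walk_max (\<lambda>j. shift_seq k w j + d) l))) \<partial>S)) =
    (\<integral>\<^sup>+w'. (ennreal (exp (- \<gamma> * walk_max (\<lambda>j. w' j + d) l)) +
      (\<integral>\<^sup>+x. (ennreal (\<gamma> * exp (- \<gamma> * (walk_max (\<lambda>j. w' j + d) l - x))) * indicator {..walk_max (\<lambda>j. w' j + d) l} x) *
        indicator {0..} x * (\<integral>\<^sup>+w. hit_discount \<rho> x w \<partial>S) \<partial>lborel)) \<partial>S) *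
    (\<Sum>k. ennreal (\<rho> ^ k) * (\<integral>\<^sup>+w. ennreal (exp (- \<gamma> * walk_max w k)) \<partial>S))"
proof -
  define z where "z w' = walk_max (\<lambda>j. w' j + d) l" for w'
  have [measurable]: "(\<lambda>w j. w j + d) \<in> measurable S S" by (rule measurable_into_S) measurable
  have z [measurable]: "z \<in> borel_measurable S"
    unfolding z_def[abs_def] by (rule measurable_compose[OF _ measurable_walk_max]) measurable
  have z0: "0 \<le> z w'" for w' unfolding z_def by (rule walk_max_nonneg)
  define h where "h w' = ennreal (exp (- \<gamma> * z w')) +
      (\<integral>\<^sup>+x. (ennreal (\<gamma> * exp (- \<gamma> * (z w' - x))) * indicator {..z w'} x) *
        indicator {0..} x * (\<integral>\<^sup>+w. hit_discount \<rho> x w \<partial>S) \<partial>lborel)" for w'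
  let ?A = "\<Sum>k. ennreal (\<rho> ^ k) * (\<integral>\<^sup>+w. ennreal (exp (- \<gamma> * walk_max w k)) \<partial>S)"
  have split: "(\<integral>\<^sup>+w. ennreal (exp (- \<gamma> * max (walk_max w k) (walk w k + z (shift_seq k w)))) \<partial>S) =
      (\<integral>\<^sup>+w'. (\<integral>\<^sup>+w. ennreal (exp (- \<gamma> * max (walk_max w k) (walk w k + z w'))) \<partial>S) \<partial>S)" for k
    using nn_integral_split[of "\<lambda>(w, w'). ennreal (exp (- \<gamma> * max (walk_max w k) (walk w k + z w')))" k]
    by (simp add: walk_comb walk_max_comb)
  have wh: "(\<Sum>k. ennreal (\<rho> ^ k) * (\<integral>\<^sup>+w. ennreal (exp (- \<gamma> * max (walk_max w k) (walk w k + z w'))) \<partial>S)) = h w' * ?A" for w'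
  proof -
    have "(\<Sum>k. ennreal (\<rho> ^ k) * (\<integral>\<^sup>+w. ennreal (exp (- \<gamma> * max (walk_max w k) (walk w k + z w'))) \<partial>S)) =
      (\<Sum>k. ennreal (\<rho> ^ k) * (\<integral>\<^sup>+w. ennreal (exp (- \<gamma> * walk_max w k)) * ennreal (exp (- \<gamma> * max 0 (z w' - (walk_max w k - walk w k)))) \<partial>S))"
    proof (intro suminf_cong arg_cong2[where f = times] refl nn_integral_cong)
      fix k w
      have "- \<gamma> * walk_max w k + - \<gamma> * max 0 (z w' - (walk_max w k - walk w k)) = - \<gamma> * max (walk_max w k) (walk w k + z w')"
        by (simp add: max_def algebra_simps)
      then show "ennreal (exp (- \<gamma> * max (walk_max w k) (walk w k + z w'))) =
          ennreal (exp (- \<gamma> * walk_max w k)) * ennreal (exp (- \<gamma> * max 0 (z w' - (walk_max w k - walk w k))))"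
        by (simp only: exp_add[symmetric] ennreal_mult'[symmetric] exp_ge_zero)
    qed
    also have "\<dots> = h w' * ?A"
      unfolding h_def by (rule wiener_hopf[OF _ _ \<rho>]) (use exp_pos_part_layer_cake[OF \<gamma> _ z0] in auto)
    finally show ?thesis .
  qed
  have "(\<Sum>k. ennreal (\<rho> ^ k) * (\<integral>\<^sup>+w. ennreal (exp (- \<gamma> * max (walk_max w k) (walk w k + z (shift_seq k w)))) \<partial>S)) =
      (\<integral>\<^sup>+w'. (\<Sum>k. ennreal (\<rho> ^ k) * (\<integral>\<^sup>+w. ennreal (exp (- \<gamma> * max (walk_max w k) (walk w k + z w'))) \<partial>S)) \<partial>S)"
    unfolding split by (subst nn_integral_suminf) (auto simp: nn_integral_cmult)
  also have "\<dots> = (\<integral>\<^sup>+w'. h w' \<partial>S) * ?A"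
    unfolding wh
  proof (rule nn_integral_multc)
    note [measurable] = measurable_nn_integral_hit_discount[of \<rho>]
    have "h = (\<lambda>w'. ennreal (exp (- \<gamma> * z w')) +
      (\<integral>\<^sup>+x. (ennreal (\<gamma> * exp (- \<gamma> * (z w' - x))) * (if x \<le> z w' then 1 else 0)) *
        indicator {0..} x * (\<integral>\<^sup>+w. hit_discount \<rho> x w \<partial>S) \<partial>lborel))"
      unfolding h_def[abs_def] by (simp add: indicator_def of_bool_def)
    also have "\<dots> \<in> borel_measurable S" by measurable
    finally show "h \<in> borel_measurable S" .
  qed
  finally show ?thesis unfolding h_def z_def .
qed

section \<open>The path with a change of drift and its grid approximation\<close>

context normalized_levy_process
begin

text \<open>Applied to the process with drift c1 removed and with c = c2 - c1, this is the integrand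
  for the net path of the theorem, the drift changing at the fixed time \<open>s\<close>.\<close>

definition drift_exp :: "real \<Rightarrow> real \<Rightarrow> real \<Rightarrow> real \<Rightarrow> 'a \<Rightarrow> real" where
  "drift_exp \<gamma> c s v \<omega> = (INF t\<in>{0..s + v}. exp (- \<gamma> * (X t \<omega> - c * max 0 (t - s))))"

definition drift_transform :: "real \<Rightarrow> real \<Rightarrow> real \<Rightarrow> real \<Rightarrow> ennreal" where
  "drift_transform \<gamma> c s v = (\<integral>\<^sup>+\<omega>. ennreal (drift_exp \<gamma> c s v \<omega>) \<partial>M)"

lemma drift_transform_0: "drift_transform \<gamma> 0 s v = sup_transform \<gamma> (s + v)"
  by (simp add: drift_transform_def drift_exp_def sup_transform_def inf_exp_def)

definition grid_max :: "real \<Rightarrow> real \<Rightarrow> nat \<Rightarrow> nat \<Rightarrow> nat \<Rightarrow> 'a \<Rightarrow> real" where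
  "grid_max \<gamma> c n k l \<omega> = exp (- \<gamma> * max (walk_max (grid_increments n \<omega>) k)
     (walk (grid_increments n \<omega>) k + walk_max (\<lambda>j. shift_seq k (grid_increments n \<omega>) j + - c / 2 ^ n) l))"

lemma walk_shift_drift:
  "walk (\<lambda>j. shift_seq k w j + d) i = walk w (k + i) - walk w k + real i * d"
  using walk_shift[of w k i] by (simp add: walk_def sum.distrib)

lemma grid_max_tendsto:
  assumes \<omega>: "\<omega> \<in> space M" and \<gamma>: "0 \<le> \<gamma>" and s: "0 \<le> s" and v: "0 \<le> v"
  shows "(\<lambda>n. grid_max \<gamma> c n (Suc (grid_index n s)) (Suc (grid_index n v)) \<omega>) \<longlonglongrightarrow> drift_exp \<gamma> c s v \<omega>"
proof -
  define g where "g t = exp (- \<gamma> * (X t \<omega> - c * max 0 (t - s)))" for t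
  define g' where "g' t = exp (- \<gamma> * (X t \<omega> - c * (t - s)))" for t
  define sn where "sn n = real (Suc (grid_index n s)) / 2 ^ n" for n
  let ?vn = "\<lambda>n. real (Suc (grid_index n v)) / 2 ^ n"
  have rcX: "continuous (at_right t) (\<lambda>t. X t \<omega>)" if "0 \<le> t" for t using \<omega> that by simp
  have sn: "sn \<longlonglongrightarrow> s" "s \<le> sn n" for n
    unfolding sn_def using grid_index_tendsto[OF s] grid_index_bounds[OF s] by auto
  have "(\<lambda>n. MIN i\<in>{..Suc (grid_index n s)}. exp (- \<gamma> * walk (grid_increments n \<omega>) i)) \<longlonglongrightarrow> (INF t\<in>{0..s}. exp (- \<gamma> * X t \<omega>))"
    using exp_walk_max_tendsto[OF \<omega> \<gamma> s] unfolding exp_walk_max[OF \<gamma>] inf_exp_def .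
  moreover have "(INF t\<in>{0..s}. exp (- \<gamma> * X t \<omega>)) = (INF t\<in>{0..s}. g t)"
    by (intro INF_cong) (auto simp: g_def)
  ultimately have 1: "(\<lambda>n. MIN i\<in>{..Suc (grid_index n s)}. exp (- \<gamma> * walk (grid_increments n \<omega>) i)) \<longlonglongrightarrow> (INF t\<in>{0..s}. g t)"
    by simp
  have "(\<lambda>n. MIN i\<in>{..Suc (grid_index n v)}. g' (sn n + real i / 2 ^ n)) \<longlonglongrightarrow> (INF t\<in>{s..s + v}. g' t)"
  proof (rule grid_Min_tendsto_INF)
    show "continuous (at_right t) g'" if "s \<le> t" "t \<le> s + v" for t
      unfolding g'_def using that s by (intro continuous_intros rcX) auto
    show "(\<lambda>n. sn n + real (Suc (grid_index n v)) / 2 ^ n) \<longlonglongrightarrow> s + v"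
      by (intro tendsto_add sn grid_index_tendsto v)
    show "s + v \<le> sn n + real (Suc (grid_index n v)) / 2 ^ n" for n
      using sn(2)[of n] grid_index_bounds[OF v, of n] by linarith
  qed (use v sn in \<open>auto simp: g'_def\<close>)
  \<comment> \<open>On the grid the extra drift sets in at \<open>sn n\<close>, which is not before
    \<open>s\<close>. The discrepancy is exactly this factor, common to all points of the second leg
    and tending to 1.\<close>
  moreover have "(\<lambda>n. exp (- \<gamma> * c * (sn n - s))) \<longlonglongrightarrow> exp (- \<gamma> * c * (s - s))"
    by (intro tendsto_intros sn)
  ultimately have "(\<lambda>n. exp (- \<gamma> * c * (sn n - s)) * (MIN i\<in>{..Suc (grid_index n v)}. g' (sn n + real i / 2 ^ n)))
      \<longlonglongrightarrow> exp (- \<gamma> * c * (s - s)) * (INF t\<in>{s..s + v}. g' t)"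
    by (rule tendsto_mult[rotated])
  moreover have "exp (- \<gamma> * c * (sn n - s)) * (MIN i\<in>{..Suc (grid_index n v)}. g' (sn n + real i / 2 ^ n)) =
      (MIN i\<in>{..Suc (grid_index n v)}. exp (- \<gamma> * (walk (grid_increments n \<omega>) (Suc (grid_index n s)) +
        walk (\<lambda>j. shift_seq (Suc (grid_index n s)) (grid_increments n \<omega>) j + - c / 2 ^ n) i)))" for n
  proof -
    let ?C = "exp (- \<gamma> * c * (sn n - s))"
    have "?C * (MIN i\<in>{..Suc (grid_index n v)}. g' (sn n + real i / 2 ^ n)) =
        (MIN i\<in>{..Suc (grid_index n v)}. ?C * g' (sn n + real i / 2 ^ n))"
      using mono_Min_commute[of "\<lambda>x. ?C * x" "(\<lambda>i. g' (sn n + real i / 2 ^ n)) ` {..Suc (grid_index n v)}"]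
      by (simp add: mono_def mult_left_mono image_image)
    also have "(\<lambda>i::nat. ?C * g' (sn n + real i / 2 ^ n)) = (\<lambda>i. exp (- \<gamma> * (walk (grid_increments n \<omega>) (Suc (grid_index n s)) +
        walk (\<lambda>j. shift_seq (Suc (grid_index n s)) (grid_increments n \<omega>) j + - c / 2 ^ n) i)))"
    proof
      fix i :: nat
      have "walk (grid_increments n \<omega>) (Suc (grid_index n s) + i) = X (sn n + real i / 2 ^ n) \<omega>"
        unfolding walk_grid_increments[OF \<omega>] sn_def by (simp add: add_divide_distrib add.assoc)
      then have eq: "walk (grid_increments n \<omega>) (Suc (grid_index n s)) +
          walk (\<lambda>j. shift_seq (Suc (grid_index n s)) (grid_increments n \<omega>) j + - c / 2 ^ n) i =
          X (sn n + real i / 2 ^ n) \<omega> - c * (real i / 2 ^ n)"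
        unfolding walk_shift_drift by simp
      show "?C * g' (sn n + real i / 2 ^ n) = exp (- \<gamma> * (walk (grid_increments n \<omega>) (Suc (grid_index n s)) +
        walk (\<lambda>j. shift_seq (Suc (grid_index n s)) (grid_increments n \<omega>) j + - c / 2 ^ n) i))"
        unfolding eq g'_def by (simp add: algebra_simps flip: exp_add)
    qed
    finally show ?thesis .
  qed
  moreover have "(INF t\<in>{s..s + v}. g' t) = (INF t\<in>{s..s + v}. g t)"
    by (intro INF_cong) (auto simp: g_def g'_def)
  ultimately have 2: "(\<lambda>n. MIN i\<in>{..Suc (grid_index n v)}. exp (- \<gamma> * (walk (grid_increments n \<omega>) (Suc (grid_index n s)) +
        walk (\<lambda>j. shift_seq (Suc (grid_index n s)) (grid_increments n \<omega>) j + - c / 2 ^ n) i))) \<longlonglongrightarrow> (INF t\<in>{s..s + v}. g t)"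
    by simp
  have "drift_exp \<gamma> c s v \<omega> = (INF t\<in>{0..s} \<union> {s..s + v}. g t)"
    unfolding drift_exp_def g_def[abs_def] using s v by (simp add: ivl_disj_un)
  also have "\<dots> = min (INF t\<in>{0..s}. g t) (INF t\<in>{s..s + v}. g t)"
    using s v by (subst cINF_union) (auto simp: inf_min g_def intro!: bdd_belowI2[of _ 0])
  finally show ?thesis
    unfolding grid_max_def exp_max_walk[OF \<gamma>] using tendsto_min[OF 1 2] by simp
qed

lemma measurable_grid_max [measurable]: "grid_max \<gamma> c n k l \<in> borel_measurable M"
proof -
  interpret random_walk "step_law n" by (rule random_walk_step_law)
  have m1 [measurable]: "(\<lambda>w j. shift_seq k w j + - c / 2 ^ n) \<in> measurable S S"
    by (rule measurable_into_S) (simp add: shift_seq_def)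
  have "(\<lambda>w. exp (- \<gamma> * max (walk_max w k) (walk w k + walk_max (\<lambda>j. shift_seq k w j + - c / 2 ^ n) l))) \<in> borel_measurable S"
    using measurable_compose[OF m1 measurable_walk_max[of l]] by measurable
  from measurable_compose[OF measurable_grid_increments this] show ?thesis
    unfolding grid_max_def[abs_def] .
qed

lemma grid_max_le_1: "0 \<le> \<gamma> \<Longrightarrow> grid_max \<gamma> c n k l \<omega> \<le> 1"
  unfolding grid_max_def using walk_max_nonneg[of "grid_increments n \<omega>" k]
  by (simp add: mult_nonneg_nonneg max.coboundedI1)

lemma measurable_drift_exp [measurable]:
  "0 \<le> \<gamma> \<Longrightarrow> 0 \<le> s \<Longrightarrow> 0 \<le> v \<Longrightarrow> drift_exp \<gamma> c s v \<in> borel_measurable M"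
  by (rule borel_measurable_LIMSEQ_real[OF grid_max_tendsto]) auto

lemma drift_exp_bounds:
  assumes "\<omega> \<in> space M" "0 \<le> s" "0 \<le> v"
  shows "0 \<le> drift_exp \<gamma> c s v \<omega>" "drift_exp \<gamma> c s v \<omega> \<le> 1"
proof -
  show "0 \<le> drift_exp \<gamma> c s v \<omega>" unfolding drift_exp_def using assms by (intro cINF_greatest) auto
  have "drift_exp \<gamma> c s v \<omega> \<le> exp (- \<gamma> * (X 0 \<omega> - c * max 0 (0 - s)))"
    unfolding drift_exp_def using assms by (intro cINF_lower bdd_belowI2[of _ 0]) auto
  then show "drift_exp \<gamma> c s v \<omega> \<le> 1" using start[OF assms(1)] assms by simp
qed

lemma drift_transform_le_1: "0 \<le> s \<Longrightarrow> 0 \<le> v \<Longrightarrow> drift_transform \<gamma> c s v \<le> 1"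
proof -
  assume "0 \<le> s" "0 \<le> v"
  then have "drift_transform \<gamma> c s v \<le> (\<integral>\<^sup>+\<omega>. 1 \<partial>M)"
    unfolding drift_transform_def by (intro nn_integral_mono) (simp add: drift_exp_bounds)
  then show ?thesis by (simp add: emeasure_space_1)
qed

lemma drift_transform_tendsto:
  assumes "0 \<le> \<gamma>" "0 \<le> s" "0 \<le> v"
  shows "(\<lambda>n. \<integral>\<^sup>+\<omega>. ennreal (grid_max \<gamma> c n (Suc (grid_index n s)) (Suc (grid_index n v)) \<omega>) \<partial>M) \<longlonglongrightarrow> drift_transform \<gamma> c s v"
  unfolding drift_transform_def
  using assms by (intro nn_integral_tendsto_le_1 grid_max_tendsto) (auto simp: grid_max_le_1)

lemma drift_walk_max_tendsto:
  assumes \<omega>: "\<omega> \<in> space M" and \<gamma>: "0 \<le> \<gamma>" and v: "0 \<le> v"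
  shows "(\<lambda>n. exp (- \<gamma> * walk_max (\<lambda>j. grid_increments n \<omega> j + - c / 2 ^ n) (Suc (grid_index n v)))) \<longlonglongrightarrow> drift_exp \<gamma> c 0 v \<omega>"
proof -
  have "(\<lambda>n. MIN i\<in>{..Suc (grid_index n v)}. exp (- \<gamma> * (X (0 + i / 2 ^ n) \<omega> - c * (0 + i / 2 ^ n)))) \<longlonglongrightarrow>
      (INF t\<in>{0..v}. exp (- \<gamma> * (X t \<omega> - c * t)))"
    using assms grid_index_tendsto[of v] grid_index_bounds[of v]
    by (intro grid_Min_tendsto_INF[where g = "\<lambda>t. exp (- \<gamma> * (X t \<omega> - c * t))"]) (auto intro!: continuous_intros)
  moreover have "walk (\<lambda>j. grid_increments n \<omega> j + - c / 2 ^ n) i = X (0 + i / 2 ^ n) \<omega> - c * (0 + i / 2 ^ n)" for n i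
    using walk_grid_increments[OF \<omega>, of n i] by (simp add: walk_def sum.distrib sum_subtractf)
  moreover have "drift_exp \<gamma> c 0 v \<omega> = (INF t\<in>{0..v}. exp (- \<gamma> * (X t \<omega> - c * t)))"
    unfolding drift_exp_def by (intro INF_cong) auto
  ultimately show ?thesis unfolding exp_walk_max[OF \<gamma>] by simp
qed

lemma measurable_drift_walk_max [measurable]:
  "(\<lambda>\<omega>. walk_max (\<lambda>j. grid_increments n \<omega> j + - c / 2 ^ n) l) \<in> borel_measurable M"
proof -
  interpret random_walk "step_law n" by (rule random_walk_step_law)
  have m1: "(\<lambda>w j. w j + - c / 2 ^ n) \<in> measurable S S"
    by (rule measurable_into_S) simp
  from measurable_compose[OF measurable_grid_increments measurable_compose[OF m1 measurable_walk_max[of l]]]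
  show ?thesis .
qed

lemma nn_integral_grid_max:
  assumes q: "0 < q" and \<gamma>: "0 \<le> \<gamma>"
  shows "ennreal (1 - exp (- q / 2 ^ n)) * (\<Sum>k. ennreal (exp (- q / 2 ^ n) ^ k) * (\<integral>\<^sup>+\<omega>. ennreal (grid_max \<gamma> c n k l \<omega>) \<partial>M)) =
    (\<integral>\<^sup>+\<omega>. (ennreal (exp (- \<gamma> * walk_max (\<lambda>j. grid_increments n \<omega> j + - c / 2 ^ n) l)) +
      (\<integral>\<^sup>+x. (ennreal (\<gamma> * exp (- \<gamma> * (walk_max (\<lambda>j. grid_increments n \<omega> j + - c / 2 ^ n) l - x))) *
         indicator {..walk_max (\<lambda>j. grid_increments n \<omega> j + - c / 2 ^ n) l} x) *
        indicator {0..} x * hit_transform q n x \<partial>lborel)) \<partial>M) * grid_transform q \<gamma> n"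
proof -
  interpret random_walk "step_law n" by (rule random_walk_step_law)
  define \<rho> where "\<rho> = exp (- q / 2 ^ n)"
  have \<rho>: "0 \<le> \<rho>" "\<rho> \<le> 1" using q by (auto simp: \<rho>_def)
  define d where "d = - c / 2 ^ n"
  have m1 [measurable]: "(\<lambda>w j. shift_seq k w j + d) \<in> measurable S S" for k
    by (rule measurable_into_S) (simp add: shift_seq_def)
  have m2 [measurable]: "(\<lambda>w j. w j + d) \<in> measurable S S"
    by (rule measurable_into_S) simp
  note [measurable] = measurable_compose[OF m1 measurable_walk_max[of l]] measurable_compose[OF m2 measurable_walk_max[of l]]
  have 1: "(\<integral>\<^sup>+w. ennreal (exp (- \<gamma> * max (walk_max w k) (walk w k + walk_max (\<lambda>j. shift_seq k w j + d) l))) \<partial>S) =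
      (\<integral>\<^sup>+\<omega>. ennreal (grid_max \<gamma> c n k l \<omega>) \<partial>M)" for k
    unfolding grid_max_def d_def[symmetric] by (rule nn_integral_grid_increments) measurable
  define h where "h z = ennreal (exp (- \<gamma> * z)) +
      (\<integral>\<^sup>+x. (ennreal (\<gamma> * exp (- \<gamma> * (z - x))) * indicator {..z} x) * indicator {0..} x * hit_transform q n x \<partial>lborel)" for z
  have h: "h \<in> borel_measurable borel"
  proof -
    have "h = (\<lambda>z. ennreal (exp (- \<gamma> * z)) +
      (\<integral>\<^sup>+x. (ennreal (\<gamma> * exp (- \<gamma> * (z - x))) * (if x \<le> z then 1 else 0)) * indicator {0..} x * hit_transform q n x \<partial>lborel))"
      unfolding h_def[abs_def] by (simp add: indicator_def of_bool_def)
    also have "\<dots> \<in> borel_measurable borel" by measurable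
    finally show ?thesis .
  qed
  have 2: "(\<integral>\<^sup>+w'. h (walk_max (\<lambda>j. w' j + d) l) \<partial>S) = (\<integral>\<^sup>+\<omega>. h (walk_max (\<lambda>j. grid_increments n \<omega> j + d) l) \<partial>M)"
    by (rule nn_integral_grid_increments) (intro measurable_compose[OF _ h], measurable)
  have "(\<Sum>k. ennreal (\<rho> ^ k) * (\<integral>\<^sup>+\<omega>. ennreal (grid_max \<gamma> c n k l \<omega>) \<partial>M)) =
    (\<integral>\<^sup>+w'. h (walk_max (\<lambda>j. w' j + d) l) \<partial>S) *
    (\<Sum>k. ennreal (\<rho> ^ k) * (\<integral>\<^sup>+w. ennreal (exp (- \<gamma> * walk_max w k)) \<partial>S))"
    unfolding 1[symmetric] nn_integral_max_split[OF \<gamma> \<rho>, of d l] h_def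
    unfolding \<rho>_def nn_integral_hit_discount_eq ..
  note this[unfolded 2]
  then show ?thesis
    unfolding grid_transform_def \<rho>_def[symmetric] d_def[symmetric] h_def by (simp add: mult_ac)
qed

lemma killed_transform_le_1: "0 < q \<Longrightarrow> 0 \<le> \<gamma> \<Longrightarrow> killed_transform q \<gamma> \<le> 1"
  using grid_transform_le_1 by (intro LIMSEQ_le_const2[OF grid_transform_tendsto]) auto

end

section \<open>Inverse exponents and the law after an exponential first leg\<close>

text \<open>In terms of independent clocks: p E f(e_q) = (p - q) E f(e_p + e_q) + q E f(e_p). It
  follows by comparing densities.\<close>

lemma exponential_resolvent:
  fixes f :: "real \<Rightarrow> ennreal"
  assumes [measurable]: "f \<in> borel_measurable borel" and pq: "0 < q" "q < p"
  shows "ennreal (p - q) * (\<integral>\<^sup>+v. exp_weight q v *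
        (\<integral>\<^sup>+s. exp_weight p s * f (s + v) \<partial>lborel) \<partial>lborel) +
      ennreal q * (\<integral>\<^sup>+t. exp_weight p t * f t \<partial>lborel) =
    ennreal p * (\<integral>\<^sup>+t. exp_weight q t * f t \<partial>lborel)"
proof -
  have inner: "(\<integral>\<^sup>+s. exp_weight p s * f (s + v) \<partial>lborel) =
      (\<integral>\<^sup>+t. ennreal (p * exp (- p * (t - v))) * (if v \<le> t then 1 else 0) * f t \<partial>lborel)" for v
    by (subst nn_integral_real_affine[where c = 1 and t = "- v"]) (auto intro!: nn_integral_cong simp: indicator_def)
  have "(\<integral>\<^sup>+v. exp_weight q v *
        (\<integral>\<^sup>+s. exp_weight p s * f (s + v) \<partial>lborel) \<partial>lborel) =
      (\<integral>\<^sup>+v. (\<integral>\<^sup>+t. f t * (exp_weight q v *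
        (ennreal (p * exp (- p * (t - v))) * (if v \<le> t then 1 else 0))) \<partial>lborel) \<partial>lborel)"
    unfolding inner
    by (intro nn_integral_cong, subst nn_integral_cmult[symmetric]) (auto intro!: nn_integral_cong simp: mult_ac)
  also have "\<dots> = (\<integral>\<^sup>+t. (\<integral>\<^sup>+v. f t * (exp_weight q v *
        (ennreal (p * exp (- p * (t - v))) * (if v \<le> t then 1 else 0))) \<partial>lborel) \<partial>lborel)"
    by (rule lborel_pair.Fubini') measurable
  \<comment> \<open>The inner integral is the convolution of the two exponential densities.\<close>
  also have "\<dots> = (\<integral>\<^sup>+t. f t * (indicator {0..} t * ennreal (p * q / (p - q) * (exp (- q * t) - exp (- p * t)))) \<partial>lborel)"
  proof (rule nn_integral_cong)
    fix t :: real
    have "(\<integral>\<^sup>+v. exp_weight q v * (ennreal (p * exp (- p * (t - v))) * (if v \<le> t then 1 else 0)) \<partial>lborel) =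
        indicator {0..} t * ennreal (p * q / (p - q) * (exp (- q * t) - exp (- p * t)))"
    proof (cases "0 \<le> t")
      case True
      have "(\<integral>\<^sup>+v. exp_weight q v * (ennreal (p * exp (- p * (t - v))) * (if v \<le> t then 1 else 0)) \<partial>lborel) =
          (\<integral>\<^sup>+v. ennreal (p * q * exp ((p - q) * v - p * t)) * indicator {0..t} v \<partial>lborel)"
      proof (rule nn_integral_cong)
        fix v :: real
        have "exp (- q * v) * exp (- p * (t - v)) = exp ((p - q) * v - p * t)"
          by (simp add: algebra_simps flip: exp_add)
        then have "q * exp (- q * v) * (p * exp (- p * (t - v))) = p * q * exp ((p - q) * v - p * t)"
          by (metis (no_types, lifting) mult.assoc mult.commute mult.left_commute)
        then show "exp_weight q v * (ennreal (p * exp (- p * (t - v))) * (if v \<le> t then 1 else 0)) =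
            ennreal (p * q * exp ((p - q) * v - p * t)) * indicator {0..t} v"
          using pq by (auto simp: indicator_def simp flip: ennreal_mult')
      qed
      also have "\<dots> = ennreal (p * q / (p - q) * exp ((p - q) * t - p * t) - p * q / (p - q) * exp ((p - q) * 0 - p * t))"
      proof (rule nn_integral_FTC_Icc)
        fix v :: real
        have "((\<lambda>v. exp ((p - q) * v - p * t)) has_real_derivative exp ((p - q) * v - p * t) * (p - q)) (at v)"
          by (auto intro!: derivative_eq_intros)
        from DERIV_cmult[OF this, of "p * q / (p - q)"]
        show "((\<lambda>v. p * q / (p - q) * exp ((p - q) * v - p * t)) has_real_derivative p * q * exp ((p - q) * v - p * t)) (at v)"
          using pq by (simp add: mult.assoc)
      qed (use pq True in auto)
      also have "p * q / (p - q) * exp ((p - q) * t - p * t) - p * q / (p - q) * exp ((p - q) * 0 - p * t) =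
          p * q / (p - q) * (exp (- q * t) - exp (- p * t))"
        by (simp add: algebra_simps)
      finally show ?thesis using True by simp
    next
      case False
      then have "(\<integral>\<^sup>+v. exp_weight q v * (ennreal (p * exp (- p * (t - v))) * (if v \<le> t then 1 else 0)) \<partial>lborel) =
          (\<integral>\<^sup>+v. 0 \<partial>(lborel :: real measure))"
        by (intro nn_integral_cong) (auto simp: indicator_def)
      then show ?thesis using False by simp
    qed
    then show "(\<integral>\<^sup>+v. f t * (exp_weight q v *
        (ennreal (p * exp (- p * (t - v))) * (if v \<le> t then 1 else 0))) \<partial>lborel) =
        f t * (indicator {0..} t * ennreal (p * q / (p - q) * (exp (- q * t) - exp (- p * t))))"
      by (subst nn_integral_cmult) auto
  qed
  finally have D: "ennreal (p - q) * (\<integral>\<^sup>+v. exp_weight q v *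
        (\<integral>\<^sup>+s. exp_weight p s * f (s + v) \<partial>lborel) \<partial>lborel) =
      (\<integral>\<^sup>+t. ennreal (p - q) * (f t * (indicator {0..} t * ennreal (p * q / (p - q) * (exp (- q * t) - exp (- p * t))))) \<partial>lborel)"
    by (subst nn_integral_cmult) auto
  have "ennreal (p - q) * (f t * (indicator {0..} t * ennreal (p * q / (p - q) * (exp (- q * t) - exp (- p * t))))) +
      ennreal q * (exp_weight p t * f t) =
      ennreal p * (exp_weight q t * f t)" for t
  proof (cases "0 \<le> t")
    case True
    have le: "exp (- p * t) \<le> exp (- q * t)" using True pq by (simp add: mult_right_mono)
    have "ennreal (p - q) * ennreal (p * q / (p - q) * (exp (- q * t) - exp (- p * t))) + ennreal q * ennreal (p * exp (- p * t)) =
        ennreal ((p - q) * (p * q / (p - q) * (exp (- q * t) - exp (- p * t))) + q * (p * exp (- p * t)))"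
    proof -
      have "0 \<le> p * q / (p - q) * (exp (- q * t) - exp (- p * t))" using pq le by (intro mult_nonneg_nonneg) auto
      then have "0 \<le> (p - q) * (p * q / (p - q) * (exp (- q * t) - exp (- p * t)))"
        by (rule mult_nonneg_nonneg[rotated]) (use pq in simp)
      moreover have "0 \<le> q * (p * exp (- p * t))" using pq by auto
      ultimately show ?thesis
        using pq by (simp only: ennreal_mult'[symmetric] ennreal_plus less_imp_le diff_ge_0_iff_ge)
    qed
    also have "(p - q) * (p * q / (p - q) * (exp (- q * t) - exp (- p * t))) + q * (p * exp (- p * t)) = p * (q * exp (- q * t))"
    proof -
      have "(p - q) * (p * q / (p - q) * d) = p * q * d" for d using pq by simp
      then show ?thesis by (simp only: right_diff_distrib) simp
    qed
    also have "ennreal \<dots> = ennreal p * ennreal (q * exp (- q * t))" using pq by (simp add: ennreal_mult')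
    finally have eq: "ennreal (p - q) * ennreal (p * q / (p - q) * (exp (- q * t) - exp (- p * t))) + ennreal q * ennreal (p * exp (- p * t)) =
        ennreal p * ennreal (q * exp (- q * t))" .
    have "ennreal (p - q) * (f t * ennreal (p * q / (p - q) * (exp (- q * t) - exp (- p * t)))) + ennreal q * (ennreal (p * exp (- p * t)) * f t) =
        (ennreal (p - q) * ennreal (p * q / (p - q) * (exp (- q * t) - exp (- p * t))) + ennreal q * ennreal (p * exp (- p * t))) * f t"
    proof -
      have "a * (x * b) + c * (d * x) = (a * b + c * d) * x" for a b c d x :: ennreal
        by (simp add: distrib_left distrib_right mult_ac)
      then show ?thesis .
    qed
    then show ?thesis unfolding eq using True by (simp add: mult.assoc)
  qed simp
  then show ?thesis
    unfolding D by (simp flip: nn_integral_cmult nn_integral_add)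
qed

section \<open>The Laplace exponent and its right inverse\<close>

context normalized_spectrally_positive
begin

definition exponent :: "real \<Rightarrow> real" where
  "exponent \<gamma> = ln (enn2real (mgf \<gamma> 0))"

lemma mgf_eq_exp: "0 \<le> \<gamma> \<Longrightarrow> mgf \<gamma> 0 = ennreal (exp (exponent \<gamma>))"
proof -
  assume "0 \<le> \<gamma>"
  then have "mgf \<gamma> 0 < \<top>" using mgf_finite by simp
  moreover from this have "0 < enn2real (mgf \<gamma> 0)"
    using mgf_pos[of \<gamma> 0] by (simp add: enn2real_positive_iff zero_less_iff_neq_zero)
  ultimately show ?thesis by (simp add: exponent_def)
qed

lemma exponent_0 [simp]: "exponent 0 = 0"
  by (simp add: exponent_def mgf_def emeasure_space_1)

lemma exponent_eq_laplace_exponent: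
  assumes "0 \<le> \<gamma>"
  shows "exponent \<gamma> = laplace_exponent M X 0 \<gamma>"
  unfolding exponent_def laplace_exponent_def mgf_def
  by (subst integral_eq_nn_integral) auto

text \<open>Convexity is needed only along a ray from 0, where the exponent vanishes. Put y = -
  \<beta> X - \<open>exponent \<beta>\<close>, so that E exp y = 1, and integrate exp(u y) \<le> u
  exp y + (1 - u).\<close>

lemma exponent_convex:
  assumes "0 \<le> \<beta>" "0 \<le> u" "u \<le> 1"
  shows "exponent (u * \<beta>) \<le> u * exponent \<beta>"
proof -
  let ?\<phi> = "exponent \<beta>"
  have pw: "exp (- (u * \<beta>) * X 1 \<omega>) * exp (- u * ?\<phi>) \<le> u * (exp (- \<beta> * X 1 \<omega>) * exp (- ?\<phi>)) + (1 - u)" for \<omega>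
  proof -
    have "exp ((1 - u) *\<^sub>R 0 + u *\<^sub>R (- \<beta> * X 1 \<omega> - ?\<phi>)) \<le> (1 - u) * exp 0 + u * exp (- \<beta> * X 1 \<omega> - ?\<phi>)"
      using convex_onD[OF exp_convex, of u 0 "- \<beta> * X 1 \<omega> - ?\<phi>"] assms by simp
    moreover have "(1 - u) *\<^sub>R 0 + u *\<^sub>R (- \<beta> * X 1 \<omega> - ?\<phi>) = - (u * \<beta>) * X 1 \<omega> + - u * ?\<phi>"
      by (simp add: algebra_simps)
    moreover have "exp (- \<beta> * X 1 \<omega> - ?\<phi>) = exp (- \<beta> * X 1 \<omega>) * exp (- ?\<phi>)"
      by (simp flip: exp_add)
    ultimately show ?thesis by (simp only: exp_add exp_zero mult_1_right)
  qed
  have "mgf (u * \<beta>) 0 * ennreal (exp (- u * ?\<phi>)) = (\<integral>\<^sup>+\<omega>. ennreal (exp (- (u * \<beta>) * X 1 \<omega>) * exp (- u * ?\<phi>)) \<partial>M)"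
    unfolding mgf_def by (subst nn_integral_multc[symmetric]) (auto simp: ennreal_mult)
  also have "\<dots> \<le> (\<integral>\<^sup>+\<omega>. ennreal (u * (exp (- \<beta> * X 1 \<omega>) * exp (- ?\<phi>)) + (1 - u)) \<partial>M)"
    by (intro nn_integral_mono ennreal_leI pw)
  also have "\<dots> = (\<integral>\<^sup>+\<omega>. ennreal (u * exp (- ?\<phi>)) * ennreal (exp (- \<beta> * X 1 \<omega>)) + ennreal (1 - u) \<partial>M)"
    using assms by (intro nn_integral_cong) (simp add: mult_ac flip: ennreal_mult' ennreal_plus)
  also have "\<dots> = ennreal (u * exp (- ?\<phi>)) * mgf \<beta> 0 + ennreal (1 - u)"
    unfolding mgf_def by (subst nn_integral_add) (auto simp: nn_integral_cmult emeasure_space_1)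
  also have "\<dots> = ennreal (u + (1 - u))"
    unfolding mgf_eq_exp[OF assms(1)] using assms by (simp add: exp_minus flip: ennreal_mult' ennreal_plus)
  finally have "mgf (u * \<beta>) 0 * ennreal (exp (- u * ?\<phi>)) \<le> 1" by simp
  then have "exp (exponent (u * \<beta>)) * exp (- u * ?\<phi>) \<le> 1"
    using mgf_eq_exp[of "u * \<beta>"] assms by (simp flip: ennreal_mult' ennreal_1)
  then show ?thesis by (simp flip: exp_add)
qed

end

locale invertible_spectrally_positive = normalized_spectrally_positive +
  assumes exponent_onto: "\<And>q. 0 < q \<Longrightarrow> \<exists>\<beta>\<ge>0. exponent \<beta> = q"
begin

text \<open>The rate is identified by elimination. At \<beta> the weight is infinite, since
  otherwise \<open>mgf_less\<close> would give \<open>exponent \<beta>\<close> < q; this excludes a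
  rate above \<beta> and the absence of passages. A rate below \<beta> would leave a g < \<beta>
  with infinite weight although \<open>exponent g\<close> < q, where the left side of
  \<open>wiener_hopf_limit\<close> is finite.\<close>

lemma hit_limit_eq_exp:
  assumes q: "0 < q" and \<beta>: "0 \<le> \<beta>" "exponent \<beta> = q"
  shows "0 < \<beta>" "\<And>x. 0 \<le> x \<Longrightarrow> hit_limit q x = ennreal (exp (- \<beta> * x))"
proof -
  show \<beta>0: "0 < \<beta>" using \<beta> q by (cases "\<beta> = 0") auto
  have no: "\<not> (\<integral>\<^sup>+x. ennreal (\<beta> * exp (\<beta> * x)) * indicator {0..} x * hit_limit q x \<partial>lborel) < \<infinity>"
    using mgf_less[OF q \<beta>(1)] mgf_eq_exp[OF \<beta>(1)] \<beta>(2) by auto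
  show "hit_limit q x = ennreal (exp (- \<beta> * x))" if "0 \<le> x" for x
  proof (rule hit_limit_cases[OF q])
    assume "\<And>x. 0 < x \<Longrightarrow> hit_limit q x = 0"
    with no hit_weight_finite(1)[OF q \<beta>(1)] show ?thesis by blast
  next
    fix r assume r: "0 \<le> r" "\<And>x. 0 \<le> x \<Longrightarrow> hit_limit q x = ennreal (exp (- r * x))"
    have "\<not> \<beta> < r"
    proof
      assume "\<beta> < r"
      from hit_weight_finite(2)[OF q \<beta>(1) r(2) this]
      have "(\<integral>\<^sup>+x. ennreal (\<beta> * exp (\<beta> * x)) * indicator {0..} x * hit_limit q x \<partial>lborel) \<noteq> \<top>"
        by (metis ennreal_add_eq_top ennreal_neq_top)
      with no show False by (simp add: less_top)
    qed
    moreover have "\<not> r < \<beta>"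
    proof
      assume rb: "r < \<beta>"
      \<comment> \<open>The midpoint is positive even when \<open>r\<close> is 0, as the divergence
        of the weight requires.\<close>
      define g where "g = (r + \<beta>) / 2"
      have g: "0 < g" "r \<le> g" "g < \<beta>" using rb r(1) by (auto simp: g_def)
      have "exponent (g / \<beta> * \<beta>) \<le> g / \<beta> * exponent \<beta>"
        using g by (intro exponent_convex) auto
      also have "\<dots> < q" using g q \<beta> by (simp add: field_simps)
      finally have less: "exponent g < q" using \<beta>0 by simp
      from hit_weight_finite(3)[OF q _ r(2), of g] g
      have "(\<integral>\<^sup>+x. ennreal (g * exp (g * x)) * indicator {0..} x * hit_limit q x \<partial>lborel) = \<infinity>" by simp
      moreover have "killed_transform q g \<noteq> 0" using killed_transform_nonzero[of g q] g q by auto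
      ultimately show False using wiener_hopf_limit[OF q _ mgf_eq_exp less] g by (simp add: ennreal_top_mult)
    qed
    ultimately have "r = \<beta>" by simp
    then show ?thesis using r that by simp
  qed
qed

definition rate :: "real \<Rightarrow> real" where
  "rate q = inv_into {0..} exponent q"

lemma rate:
  assumes "0 < q"
  shows "0 < rate q" "exponent (rate q) = q" "\<And>x. 0 \<le> x \<Longrightarrow> hit_limit q x = ennreal (exp (- rate q * x))"
proof -
  have "q \<in> exponent ` {0..}" using exponent_onto[OF assms] by auto
  then have *: "rate q \<in> {0..}" "exponent (rate q) = q"
    unfolding rate_def by (rule inv_into_into, rule f_inv_into_f)
  then show "exponent (rate q) = q" by simp
  show "0 < rate q" "\<And>x. 0 \<le> x \<Longrightarrow> hit_limit q x = ennreal (exp (- rate q * x))"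
    using hit_limit_eq_exp[OF assms _ *(2)] *(1) by auto
qed

text \<open>The exponent may decrease before it increases, so this is not read off from
  monotonicity: below the rate the weight is finite and \<open>mgf_less\<close> applies.\<close>

lemma exponent_less:
  assumes "0 < q" "0 \<le> \<gamma>" "\<gamma> < rate q"
  shows "exponent \<gamma> < q"
proof -
  have "1 + (\<integral>\<^sup>+x. ennreal (\<gamma> * exp (\<gamma> * x)) * indicator {0..} x * hit_limit q x \<partial>lborel) = ennreal (rate q / (rate q - \<gamma>))"
    using assms rate(3)[OF assms(1)] by (intro hit_weight_finite(2)) auto
  then have "(\<integral>\<^sup>+x. ennreal (\<gamma> * exp (\<gamma> * x)) * indicator {0..} x * hit_limit q x \<partial>lborel) < \<infinity>"
    by (metis ennreal_add_eq_top ennreal_neq_top infinity_ennreal_def less_top)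
  from mgf_less[OF assms(1,2) this] show ?thesis
    using mgf_eq_exp[OF assms(2)] by (simp add: ennreal_less_iff)
qed

text \<open>Convexity along the ray through \<gamma> bounds the slope q / \<open>rate q\<close> by
  \<open>exponent \<gamma>\<close> / \<gamma>.\<close>

lemma exponent_greater:
  assumes "0 < q" "rate q < \<gamma>"
  shows "q < exponent \<gamma>"
proof -
  note r = rate[OF assms(1)]
  have "exponent (rate q / \<gamma> * \<gamma>) \<le> rate q / \<gamma> * exponent \<gamma>"
    using assms r by (intro exponent_convex) auto
  then have "q * \<gamma> \<le> rate q * exponent \<gamma>" using r assms by (simp add: field_simps)
  moreover have "q * rate q < q * \<gamma>" using assms by simp
  ultimately have "rate q * q < rate q * exponent \<gamma>" by (simp add: mult.commute)
  then show ?thesis using r(1) by simp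
qed

lemma rate_unbounded: "\<exists>p>p0. 0 < p \<and> \<gamma> < rate p"
proof -
  obtain p where p: "max 0 p0 < p" "(\<forall>x>0. hit_limit p x = 0) \<or> (\<exists>r>\<gamma>. \<forall>x\<ge>0. hit_limit p x = ennreal (exp (- r * x)))"
    using hit_rate_unbounded[of "max 0 p0" \<gamma>] by blast
  have p0: "0 < p" using p(1) by simp
  have 1: "hit_limit p 1 = ennreal (exp (- rate p))" using rate(3)[OF p0, of 1] by simp
  have "\<exists>r>\<gamma>. hit_limit p 1 = ennreal (exp (- r))"
    using p(2) 1 by (metis exp_gt_zero ennreal_eq_0_iff less_numeral_extra(1) mult.right_neutral not_less order_less_imp_le zero_le_one)
  then have "\<gamma> < rate p" using 1 by auto
  then show ?thesis using p(1) p0 by (intro exI[of _ p]) auto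
qed

lemma killed_transform_below_rate:
  assumes q: "0 < q" and \<gamma>: "0 \<le> \<gamma>" "\<gamma> < rate q"
  shows "enn2real (killed_transform q \<gamma>) = q * (rate q - \<gamma>) / (rate q * (q - exponent \<gamma>))"
proof -
  define K where "K = enn2real (killed_transform q \<gamma>)"
  have K: "killed_transform q \<gamma> = ennreal K" "0 \<le> K"
    using neq_top_trans[OF _ killed_transform_le_1[OF q \<gamma>(1)]] by (simp_all add: K_def less_top)
  have less: "exponent \<gamma> < q" by (rule exponent_less[OF q \<gamma>])
  have "1 + (\<integral>\<^sup>+x. ennreal (\<gamma> * exp (\<gamma> * x)) * indicator {0..} x * hit_limit q x \<partial>lborel) = ennreal (rate q / (rate q - \<gamma>))"
    using rate(3)[OF q] by (intro hit_weight_finite(2)[OF q \<gamma>(1) _ \<gamma>(2)]) auto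
  with wiener_hopf_limit[OF q \<gamma>(1) mgf_eq_exp[OF \<gamma>(1)] less]
  have "ennreal (q / (q - exponent \<gamma>)) = ennreal (rate q / (rate q - \<gamma>) * K)"
    unfolding K(1) using K(2) \<gamma> by (simp flip: ennreal_mult')
  then have "q / (q - exponent \<gamma>) = rate q / (rate q - \<gamma>) * K"
    using K(2) \<gamma> q less rate(1)[OF q] by (subst (asm) ennreal_inj) auto
  then show ?thesis
    using \<gamma> q less rate(1)[OF q] by (simp add: K_def[symmetric] field_simps)
qed

lemma drift_transform_enn2real:
  assumes "0 \<le> \<gamma>" "0 \<le> s" "0 \<le> v"
  shows "integrable M (drift_exp \<gamma> c s v)" "enn2real (drift_transform \<gamma> c s v) = (\<integral>\<omega>. drift_exp \<gamma> c s v \<omega> \<partial>M)"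
proof -
  show "integrable M (drift_exp \<gamma> c s v)"
    using assms drift_exp_bounds[of _ s v] by (intro integrable_const_bound[of _ 1]) (auto intro!: AE_I2)
  show "enn2real (drift_transform \<gamma> c s v) = (\<integral>\<omega>. drift_exp \<gamma> c s v \<omega> \<partial>M)"
    unfolding drift_transform_def using assms drift_exp_bounds[of _ s v]
    by (subst integral_eq_nn_integral) (auto intro!: AE_I2)
qed

text \<open>Let S and D = S - Y belong to the first leg at an Exp(q) time; they are independent and
  D is exponential of rate r = \<open>rate q\<close>. With Z the supremum of the second leg, the
  total supremum is S + max(0, Z - D). Averaging over D replaces exp(- \<gamma> max(0, Z - D)) by (r
  exp(- \<gamma> Z) - \<gamma> exp(- r Z)) / (r - \<gamma>), so the law of Z enters only through its
  transform \<open>G\<close> at \<gamma> and at r.\<close>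

lemma drift_master:
  fixes c :: real
  assumes q: "0 < q" and \<gamma>: "0 \<le> \<gamma>" "\<gamma> \<noteq> rate q" and v: "0 \<le> v"
  defines "G \<equiv> \<lambda>x. enn2real (drift_transform x c 0 v)"
  shows "0 \<le> (rate q * G \<gamma> - \<gamma> * G (rate q)) / (rate q - \<gamma>)"
    and "(\<integral>\<^sup>+s. exp_weight q s * drift_transform \<gamma> c s v \<partial>lborel) =
      killed_transform q \<gamma> * ennreal ((rate q * G \<gamma> - \<gamma> * G (rate q)) / (rate q - \<gamma>))"
    and "(\<lambda>s. drift_transform \<gamma> c s v * indicator {0..} s) \<in> borel_measurable borel"
proof -
  define r where "r = rate q"
  have r: "0 < r" "\<And>x. 0 \<le> x \<Longrightarrow> hit_limit q x = ennreal (exp (- r * x))"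
    using rate[OF q] by (auto simp: r_def)
  have \<gamma>r: "\<gamma> \<noteq> r" using \<gamma> by (simp add: r_def)
  define Z where "Z n \<omega> = walk_max (\<lambda>j. grid_increments n \<omega> j + - c / 2 ^ n) (Suc (grid_index n v))" for n \<omega>
  have Z0: "0 \<le> Z n \<omega>" for n \<omega> unfolding Z_def by (rule walk_max_nonneg)
  have [measurable]: "Z n \<in> borel_measurable M" for n unfolding Z_def[abs_def] by measurable
  define hr where "hr z = (r * exp (- \<gamma> * z) - \<gamma> * exp (- r * z)) / (r - \<gamma>)" for z
  define h where "h n z = ennreal (exp (- \<gamma> * z)) +
      (\<integral>\<^sup>+x. (ennreal (\<gamma> * exp (- \<gamma> * (z - x))) * indicator {..z} x) * indicator {0..} x * hit_transform q n x \<partial>lborel)" for n z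
  \<comment> \<open>On the grid the passage transform is only approximately exponential, so
    \<open>h n\<close> stands in place of \<open>hr\<close>. The gap between them is at most
    \<open>e n\<close> uniformly in \<open>z\<close>, hence it survives integration over the random
    \<open>z\<close> of the second leg.\<close>
  define e where "e n = (\<integral>\<^sup>+x. ennreal \<gamma> * indicator {0..} x * (hit_limit q x - hit_transform q n x) \<partial>lborel)" for n
  have hr0: "0 \<le> hr z" if "0 \<le> z" for z
    unfolding hr_def using that \<gamma> r by (intro exp_pos_part_weight_nonneg) auto
  have hr_eq: "ennreal (hr z) = ennreal (exp (- \<gamma> * z)) +
      (\<integral>\<^sup>+x. (ennreal (\<gamma> * exp (- \<gamma> * (z - x))) * indicator {..z} x) * indicator {0..} x * hit_limit q x \<partial>lborel)" if "0 \<le> z" for z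
  proof -
    have "(\<integral>\<^sup>+x. (ennreal (\<gamma> * exp (- \<gamma> * (z - x))) * indicator {..z} x) * indicator {0..} x * hit_limit q x \<partial>lborel) =
      (\<integral>\<^sup>+x. (ennreal (\<gamma> * exp (- \<gamma> * (z - x))) * indicator {..z} x) * indicator {0..} x * ennreal (exp (- r * x)) \<partial>lborel)"
      by (intro nn_integral_cong) (auto simp: indicator_def r)
    then show ?thesis
      unfolding hr_def nn_integral_exp_pos_part_weight[OF \<gamma>(1) that \<gamma>r, symmetric] by simp
  qed
  have ht_le: "hit_transform q n x \<le> hit_limit q x" for n x
    unfolding hit_limit_def by (rule SUP_upper) simp
  have h_le: "h n z \<le> ennreal (hr z)" if "0 \<le> z" for n z
    unfolding hr_eq[OF that] h_def by (intro add_left_mono nn_integral_mono mult_left_mono ht_le) auto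
  have le_h: "ennreal (hr z) \<le> h n z + e n" if "0 \<le> z" for n z
  proof -
    let ?w = "\<lambda>x. (ennreal (\<gamma> * exp (- \<gamma> * (z - x))) * indicator {..z} x) * indicator {0..} x"
    have "?w x * hit_limit q x \<le> ?w x * hit_transform q n x + ennreal \<gamma> * indicator {0..} x * (hit_limit q x - hit_transform q n x)" for x
    proof -
      have "?w x * hit_limit q x = ?w x * hit_transform q n x + ?w x * (hit_limit q x - hit_transform q n x)"
        using ht_le[of n x] by (simp add: add_diff_inverse_ennreal flip: distrib_left)
      also have "\<dots> \<le> ?w x * hit_transform q n x + ennreal \<gamma> * indicator {0..} x * (hit_limit q x - hit_transform q n x)"
        using \<gamma> by (intro add_left_mono mult_right_mono) (auto simp: indicator_def mult_left_le intro!: ennreal_leI)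
      finally show ?thesis .
    qed
    then have "(\<integral>\<^sup>+x. ?w x * hit_limit q x \<partial>lborel) \<le>
        (\<integral>\<^sup>+x. ?w x * hit_transform q n x + ennreal \<gamma> * indicator {0..} x * (hit_limit q x - hit_transform q n x) \<partial>lborel)"
      by (rule nn_integral_mono)
    also have "\<dots> = (\<integral>\<^sup>+x. ?w x * hit_transform q n x \<partial>lborel) + e n"
      unfolding e_def by (rule nn_integral_add) measurable
    finally show ?thesis unfolding hr_eq[OF that] h_def by (simp add: add.assoc add_left_mono)
  qed
  have e: "e \<longlonglongrightarrow> 0"
  proof -
    have "e \<longlonglongrightarrow> (\<integral>\<^sup>+x. 0 \<partial>(lborel :: real measure))"
      unfolding e_def[abs_def]
    proof (rule nn_integral_dominated_convergence[where w = "\<lambda>x. ennreal (\<gamma> / r) * ennreal (exponential_density r x)"])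
      show "AE x in lborel. ennreal \<gamma> * indicator {0..} x * (hit_limit q x - hit_transform q n x) \<le>
          ennreal (\<gamma> / r) * ennreal (exponential_density r x)" for n
      proof (rule AE_I2)
        fix x
        have "ennreal \<gamma> * indicator {0..} x * (hit_limit q x - hit_transform q n x) \<le> ennreal \<gamma> * indicator {0..} x * hit_limit q x"
          by (intro mult_left_mono diff_le_self_ennreal) simp
        also have "\<dots> = ennreal (\<gamma> / r) * ennreal (exponential_density r x)"
          using \<gamma> r by (auto simp: indicator_def exponential_density_def mult.commute[of x] simp flip: ennreal_mult')
        finally show "ennreal \<gamma> * indicator {0..} x * (hit_limit q x - hit_transform q n x) \<le>
          ennreal (\<gamma> / r) * ennreal (exponential_density r x)" .
      qed
      show "(\<integral>\<^sup>+x. ennreal (\<gamma> / r) * ennreal (exponential_density r x) \<partial>lborel) < \<infinity>"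
        by (subst nn_integral_cmult) (auto simp: nn_integral_exponential_density[OF r(1)])
      show "AE x in lborel. (\<lambda>n. ennreal \<gamma> * indicator {0..} x * (hit_limit q x - hit_transform q n x)) \<longlonglongrightarrow> 0"
      proof (rule AE_I2)
        fix x
        have "(\<lambda>n. hit_limit q x - hit_transform q n x) \<longlonglongrightarrow> hit_limit q x - hit_limit q x"
          using hit_limit_neq_top[OF q] by (intro tendsto_diff_ennreal hit_transform_tendsto tendsto_const) auto
        then have "(\<lambda>n. ennreal \<gamma> * indicator {0..} x * (hit_limit q x - hit_transform q n x)) \<longlonglongrightarrow>
            ennreal \<gamma> * indicator {0..} x * (hit_limit q x - hit_limit q x)"
          by (intro ennreal_tendsto_cmult) (auto simp: indicator_def)
        then show "(\<lambda>n. ennreal \<gamma> * indicator {0..} x * (hit_limit q x - hit_transform q n x)) \<longlonglongrightarrow> 0"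
          using hit_limit_neq_top[OF q] by simp
      qed
    qed measurable
    then show ?thesis by simp
  qed
  define L where "L = (r * G \<gamma> - \<gamma> * G r) / (r - \<gamma>)"
  define Lp where "Lp \<omega> = (r * drift_exp \<gamma> c 0 v \<omega> - \<gamma> * drift_exp r c 0 v \<omega>) / (r - \<gamma>)" for \<omega>
  have [measurable]: "drift_exp \<gamma> c 0 v \<in> borel_measurable M" "drift_exp r c 0 v \<in> borel_measurable M"
    using \<gamma> r v by auto
  have hr_lim: "(\<lambda>n. hr (Z n \<omega>)) \<longlonglongrightarrow> Lp \<omega>" if "\<omega> \<in> space M" for \<omega>
    unfolding hr_def Lp_def Z_def using \<gamma> r v that \<gamma>r by (intro tendsto_intros drift_walk_max_tendsto) auto
  have Lp0: "0 \<le> Lp \<omega>" if "\<omega> \<in> space M" for \<omega>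
    using hr_lim[OF that] by (rule LIMSEQ_le_const) (use hr0 Z0 in auto)
  have Lp_int: "integrable M Lp" "(\<integral>\<omega>. Lp \<omega> \<partial>M) = L"
    using drift_transform_enn2real[of \<gamma> 0 v c] drift_transform_enn2real[of r 0 v c] \<gamma> r v
    by (auto simp: Lp_def[abs_def] L_def G_def)
  then have Lp_nn: "(\<integral>\<^sup>+\<omega>. ennreal (Lp \<omega>) \<partial>M) = ennreal L"
    using Lp0 by (subst nn_integral_eq_integral) auto
  have L0: "0 \<le> L" unfolding Lp_int(2)[symmetric] using Lp0 by (intro integral_nonneg_AE AE_I2)
  then show "0 \<le> (rate q * G \<gamma> - \<gamma> * G (rate q)) / (rate q - \<gamma>)" by (simp add: L_def r_def)
  \<comment> \<open>A crude constant that serves as dominating function.\<close>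
  have bound: "hr z \<le> (r + \<gamma>) / \<bar>r - \<gamma>\<bar>" if "0 \<le> z" for z
  proof -
    have "exp (- \<gamma> * z) \<le> 1" "exp (- r * z) \<le> 1" using \<gamma> r that by auto
    then have "r * exp (- \<gamma> * z) \<le> r" "\<gamma> * exp (- r * z) \<le> \<gamma>" using \<gamma> r by (simp_all add: mult_left_le)
    moreover have "0 \<le> r * exp (- \<gamma> * z)" "0 \<le> \<gamma> * exp (- r * z)" using \<gamma> r by auto
    ultimately have "\<bar>r * exp (- \<gamma> * z) - \<gamma> * exp (- r * z)\<bar> \<le> r + \<gamma>" by linarith
    then have "\<bar>hr z\<bar> \<le> (r + \<gamma>) / \<bar>r - \<gamma>\<bar>"
      unfolding hr_def abs_divide by (intro divide_right_mono) auto
    then show ?thesis by simp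
  qed
  define H where "H n = (\<integral>\<^sup>+\<omega>. h n (Z n \<omega>) \<partial>M)" for n
  define H' where "H' n = (\<integral>\<^sup>+\<omega>. ennreal (hr (Z n \<omega>)) \<partial>M)" for n
  have [measurable]: "(\<lambda>\<omega>. hr (Z n \<omega>)) \<in> borel_measurable M" for n unfolding hr_def by measurable
  have H': "H' \<longlonglongrightarrow> ennreal L"
    unfolding H'_def[abs_def] Lp_nn[symmetric]
  proof (rule nn_integral_dominated_convergence[where w = "\<lambda>_. ennreal ((r + \<gamma>) / \<bar>r - \<gamma>\<bar>)"])
    show "AE \<omega> in M. ennreal (hr (Z n \<omega>)) \<le> ennreal ((r + \<gamma>) / \<bar>r - \<gamma>\<bar>)" for n
      by (intro AE_I2 ennreal_leI bound Z0)
    show "AE \<omega> in M. (\<lambda>n. ennreal (hr (Z n \<omega>))) \<longlonglongrightarrow> ennreal (Lp \<omega>)"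
      by (intro AE_I2 tendsto_ennrealI hr_lim)
  qed (auto simp: Lp_def[abs_def] emeasure_space_1)
  have hm [measurable]: "h n \<in> borel_measurable borel" for n
  proof -
    have "h n = (\<lambda>z. ennreal (exp (- \<gamma> * z)) +
      (\<integral>\<^sup>+x. (ennreal (\<gamma> * exp (- \<gamma> * (z - x))) * (if x \<le> z then 1 else 0)) * indicator {0..} x * hit_transform q n x \<partial>lborel))"
      unfolding h_def[abs_def] by (simp add: indicator_def of_bool_def)
    also have "\<dots> \<in> borel_measurable borel" by measurable
    finally show ?thesis .
  qed
  have H_le: "H n \<le> H' n" for n unfolding H_def H'_def by (intro nn_integral_mono h_le Z0)
  have le_H: "H' n \<le> H n + e n" for n
  proof -
    have "H' n \<le> (\<integral>\<^sup>+\<omega>. h n (Z n \<omega>) + e n \<partial>M)" unfolding H'_def by (intro nn_integral_mono le_h Z0)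
    also have "\<dots> = H n + e n" unfolding H_def by (subst nn_integral_add) (auto simp: emeasure_space_1)
    finally show ?thesis .
  qed
  have H: "H \<longlonglongrightarrow> ennreal L"
  proof (rule tendsto_sandwich)
    show "(\<lambda>n. H' n - e n) \<longlonglongrightarrow> ennreal L" using tendsto_diff_ennreal[OF H' e] by simp
    show "\<forall>\<^sub>F n in sequentially. H' n - e n \<le> H n"
    proof (intro always_eventually allI)
      fix n
      have "H' n \<le> (\<integral>\<^sup>+\<omega>. ennreal ((r + \<gamma>) / \<bar>r - \<gamma>\<bar>) \<partial>M)"
        unfolding H'_def by (intro nn_integral_mono ennreal_leI bound Z0)
      then have "H' n \<noteq> \<top>" by (auto simp: emeasure_space_1 top_unique)
      then show "H' n - e n \<le> H n" using le_H[of n] by (simp add: ennreal_minus_le_iff add.commute)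
    qed
  qed (use H_le H' in auto)
  define a where "a n k = (\<integral>\<^sup>+\<omega>. ennreal (grid_max \<gamma> c n k (Suc (grid_index n v)) \<omega>) \<partial>M)" for n k
  have a_le: "a n k \<le> 1" for n k
  proof -
    have "a n k \<le> (\<integral>\<^sup>+\<omega>. 1 \<partial>M)"
      unfolding a_def using grid_max_le_1[OF \<gamma>(1)] by (intro nn_integral_mono) simp
    then show ?thesis by (simp add: emeasure_space_1)
  qed
  have a_lim: "(\<lambda>n. a n (Suc (grid_index n s))) \<longlonglongrightarrow> drift_transform \<gamma> c s v" if "0 \<le> s" for s
    unfolding a_def by (rule drift_transform_tendsto[OF \<gamma>(1) that v])
  have eq: "ennreal (1 - exp (- q / 2 ^ n)) * (\<Sum>k. ennreal (exp (- q / 2 ^ n) ^ k) * a n k) = H n * grid_transform q \<gamma> n" for n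
    unfolding a_def nn_integral_grid_max[OF q \<gamma>(1)] H_def h_def Z_def ..
  have "(\<lambda>n. H n * grid_transform q \<gamma> n) \<longlonglongrightarrow> ennreal L * killed_transform q \<gamma>"
    using killed_transform_le_1[OF q \<gamma>(1)]
    by (intro tendsto_mult_ennreal H grid_transform_tendsto q \<gamma>) (auto simp: top_unique)
  moreover have "(\<lambda>n. H n * grid_transform q \<gamma> n) \<longlonglongrightarrow>
      (\<integral>\<^sup>+s. exp_weight q s * drift_transform \<gamma> c s v \<partial>lborel)"
    unfolding eq[symmetric] by (rule geometric_to_exponential(2)[where a = a and q = q]) (use q a_le a_lim in auto)
  ultimately show "(\<integral>\<^sup>+s. exp_weight q s * drift_transform \<gamma> c s v \<partial>lborel) =
      killed_transform q \<gamma> * ennreal ((rate q * G \<gamma> - \<gamma> * G (rate q)) / (rate q - \<gamma>))"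
    unfolding r_def[symmetric] L_def[symmetric] by (simp add: LIMSEQ_unique mult.commute)
  show "(\<lambda>s. drift_transform \<gamma> c s v * indicator {0..} s) \<in> borel_measurable borel"
    by (rule geometric_to_exponential(1)[where a = a and q = q]) (use q a_le a_lim in auto)
qed

end

section \<open>The supremum at an exponential time\<close>

text \<open>The coefficients may have opposite signs, so the combination cannot be split within
  \<open>ennreal\<close>. It is split as a Bochner integral under the exponential law
  \<open>N\<close> and carried back.\<close>

lemma
  fixes f g :: "real \<Rightarrow> real"
  assumes q: "0 < q"
    and f: "(\<lambda>v. ennreal (f v) * indicator {0..} v) \<in> borel_measurable borel" "\<And>v. 0 \<le> v \<Longrightarrow> 0 \<le> f v \<and> f v \<le> 1"
    and g: "(\<lambda>v. ennreal (g v) * indicator {0..} v) \<in> borel_measurable borel" "\<And>v. 0 \<le> v \<Longrightarrow> 0 \<le> g v \<and> g v \<le> 1"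
    and nonneg: "\<And>v. 0 \<le> v \<Longrightarrow> 0 \<le> a * f v + b * g v"
  shows nn_integral_exponential_linear:
    "(\<integral>\<^sup>+v. exp_weight q v * ennreal (a * f v + b * g v) \<partial>lborel) =
    ennreal (a * enn2real (\<integral>\<^sup>+v. exp_weight q v * ennreal (f v) \<partial>lborel) +
      b * enn2real (\<integral>\<^sup>+v. exp_weight q v * ennreal (g v) \<partial>lborel))"
    and nn_integral_exponential_linear_nonneg:
    "0 \<le> a * enn2real (\<integral>\<^sup>+v. exp_weight q v * ennreal (f v) \<partial>lborel) +
      b * enn2real (\<integral>\<^sup>+v. exp_weight q v * ennreal (g v) \<partial>lborel)"
proof -
  define N where "N = density lborel (\<lambda>v. ennreal (exponential_density q v))"
  interpret N: prob_space N unfolding N_def by (rule prob_space_exponential_density[OF q])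
  have nn: "(\<integral>\<^sup>+v. exp_weight q v * ennreal (h v) \<partial>lborel) =
      (\<integral>\<^sup>+v. ennreal (h v * indicator {0..} v) \<partial>N)" if "(\<lambda>v. h v * indicator {0..} v) \<in> borel_measurable borel" for h
    unfolding N_def using that
    by (subst nn_integral_density) (auto intro!: nn_integral_cong simp: exponential_density_def indicator_def mult.commute)
  have fm: "(\<lambda>v. f v * indicator {0..} v) \<in> borel_measurable borel"
  proof -
    have "(\<lambda>v. f v * indicator {0..} v) = (\<lambda>v. enn2real (ennreal (f v) * indicator {0..} v))"
      using f(2) by (auto simp: fun_eq_iff indicator_def)
    then show ?thesis using f(1) by simp
  qed
  have gm: "(\<lambda>v. g v * indicator {0..} v) \<in> borel_measurable borel"
  proof -
    have "(\<lambda>v. g v * indicator {0..} v) = (\<lambda>v. enn2real (ennreal (g v) * indicator {0..} v))"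
      using g(2) by (auto simp: fun_eq_iff indicator_def)
    then show ?thesis using g(1) by simp
  qed
  have fi: "integrable N (\<lambda>v. f v * indicator {0..} v)"
    using fm f(2) by (intro N.integrable_const_bound[of _ 1]) (auto simp: N_def indicator_def)
  have gi: "integrable N (\<lambda>v. g v * indicator {0..} v)"
    using gm g(2) by (intro N.integrable_const_bound[of _ 1]) (auto simp: N_def indicator_def)
  have F: "(\<integral>\<^sup>+v. exp_weight q v * ennreal (f v) \<partial>lborel) =
      ennreal (\<integral>v. f v * indicator {0..} v \<partial>N)"
    unfolding nn[OF fm] using f(2) by (intro nn_integral_eq_integral fi) (auto simp: indicator_def)
  have G: "(\<integral>\<^sup>+v. exp_weight q v * ennreal (g v) \<partial>lborel) =
      ennreal (\<integral>v. g v * indicator {0..} v \<partial>N)"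
    unfolding nn[OF gm] using g(2) by (intro nn_integral_eq_integral gi) (auto simp: indicator_def)
  have F0: "0 \<le> (\<integral>v. f v * indicator {0..} v \<partial>N)" using f(2) by (intro integral_nonneg_AE) (auto simp: indicator_def)
  have G0: "0 \<le> (\<integral>v. g v * indicator {0..} v \<partial>N)" using g(2) by (intro integral_nonneg_AE) (auto simp: indicator_def)
  have eq: "(a * f v + b * g v) * indicator {0..} v = a * (f v * indicator {0..} v) + b * (g v * indicator {0..} v)" for v
    by (simp add: algebra_simps)
  have "(\<integral>\<^sup>+v. exp_weight q v * ennreal (a * f v + b * g v) \<partial>lborel) =
      (\<integral>\<^sup>+v. ennreal (a * (f v * indicator {0..} v) + b * (g v * indicator {0..} v)) \<partial>N)"
    unfolding eq[symmetric] by (rule nn) (unfold eq, intro borel_measurable_add borel_measurable_times fm gm borel_measurable_const)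
  also have "\<dots> = ennreal (\<integral>v. a * (f v * indicator {0..} v) + b * (g v * indicator {0..} v) \<partial>N)"
    using fi gi nonneg by (intro nn_integral_eq_integral) (auto simp: indicator_def)
  also have I: "(\<integral>v. a * (f v * indicator {0..} v) + b * (g v * indicator {0..} v) \<partial>N) =
      a * (\<integral>v. f v * indicator {0..} v \<partial>N) + b * (\<integral>v. g v * indicator {0..} v \<partial>N)"
    using fi gi by simp
  finally show "(\<integral>\<^sup>+v. exp_weight q v * ennreal (a * f v + b * g v) \<partial>lborel) =
    ennreal (a * enn2real (\<integral>\<^sup>+v. exp_weight q v * ennreal (f v) \<partial>lborel) +
      b * enn2real (\<integral>\<^sup>+v. exp_weight q v * ennreal (g v) \<partial>lborel))"
    unfolding F G using F0 G0 by simp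
  have "0 \<le> (\<integral>v. a * (f v * indicator {0..} v) + b * (g v * indicator {0..} v) \<partial>N)"
    using nonneg by (intro integral_nonneg_AE) (auto simp: indicator_def)
  then show "0 \<le> a * enn2real (\<integral>\<^sup>+v. exp_weight q v * ennreal (f v) \<partial>lborel) +
      b * enn2real (\<integral>\<^sup>+v. exp_weight q v * ennreal (g v) \<partial>lborel)"
    unfolding F G I using F0 G0 by simp
qed

text \<open>With S the supremum of \<open>y\<close> this says exp(- x S) = exp(- S) powr x, and it
  holds also for infinite S, where both sides are 0. The dependence on \<open>x\<close> becomes that
  of a power with fixed base.\<close>

lemma INF_exp_powr:
  fixes y :: "'b \<Rightarrow> real"
  assumes "A \<noteq> {}" "0 < x"
  shows "(INF s\<in>A. exp (- x * y s)) = (INF s\<in>A. exp (- y s)) powr x"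
proof -
  \<comment> \<open>Truncation at 0 makes the power monotone and continuous on the whole
    line.\<close>
  let ?f = "\<lambda>t :: real. max 0 t powr x"
  have bdd: "bdd_below ((\<lambda>s. exp (- y s)) ` A)" by (intro bdd_belowI2[of _ 0]) simp
  have "?f (Inf ((\<lambda>s. exp (- y s)) ` A)) = (INF t\<in>(\<lambda>s. exp (- y s)) ` A. ?f t)"
  proof (rule continuous_at_Inf_mono)
    show "mono ?f" using assms(2) by (auto simp: mono_def intro!: powr_mono2)
    have "continuous_on UNIV ?f"
      using assms(2) by (intro continuous_on_powr' continuous_intros) auto
    then show "continuous (at_right (INF s\<in>A. exp (- y s))) ?f"
      by (simp add: continuous_on_eq_continuous_at continuous_at_imp_continuous_within)
  qed (use assms bdd in auto)
  moreover have "0 \<le> (INF s\<in>A. exp (- y s))" using assms(1) by (intro cINF_greatest) auto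
  moreover have "?f (exp (- y s)) = exp (- x * y s)" for s by (simp add: max_def powr_def)
  ultimately show ?thesis by (simp only: image_image max_absorb2)
qed

lemma INF_atLeastAtMost_tendsto:
  fixes h :: "real \<Rightarrow> real"
  assumes h: "\<And>t. 0 \<le> t \<Longrightarrow> 0 \<le> h t" and v: "filterlim v at_top sequentially" "\<And>m. 0 \<le> v m"
  shows "(\<lambda>m. INF t\<in>{0..v m}. h t) \<longlonglongrightarrow> (INF t\<in>{0..}. h t)"
proof (rule order_tendstoI)
  have bdd: "bdd_below (h ` {0..})" "bdd_below (h ` {0..v m})" for m
    by (rule bdd_belowI2[of _ 0], simp add: h)+
  fix c
  {
    assume "c < (INF t\<in>{0..}. h t)"
    moreover have "(INF t\<in>{0..}. h t) \<le> (INF t\<in>{0..v m}. h t)" for m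
      using v(2)[of m] bdd by (intro cINF_superset_mono) auto
    ultimately show "\<forall>\<^sub>F m in sequentially. c < (INF t\<in>{0..v m}. h t)"
      by (intro always_eventually allI) (rule less_le_trans)
  }
  {
    assume "(INF t\<in>{0..}. h t) < c"
    then obtain t where t: "0 \<le> t" "h t < c" using bdd by (subst (asm) cINF_less_iff) auto
    have "\<forall>\<^sub>F m in sequentially. t \<le> v m" using v(1) by (simp add: filterlim_at_top)
    then show "\<forall>\<^sub>F m in sequentially. (INF t\<in>{0..v m}. h t) < c"
    proof eventually_elim
      case (elim m)
      then have "(INF t\<in>{0..v m}. h t) \<le> h t" using bdd t by (intro cINF_lower) auto
      then show ?case using t by simp
    qed
  }
qed

section \<open>Dependence of the transforms on horizon and argument\<close>

context normalized_levy_process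
begin

lemma sup_transform_real:
  assumes "0 \<le> t"
  shows "sup_transform \<gamma> t = ennreal (enn2real (sup_transform \<gamma> t))" "0 \<le> enn2real (sup_transform \<gamma> t)"
    "enn2real (sup_transform \<gamma> t) \<le> 1"
proof -
  have "sup_transform \<gamma> t < \<top>" using sup_transform_le_1[OF assms, of \<gamma>] by (auto intro: le_less_trans)
  then show *: "sup_transform \<gamma> t = ennreal (enn2real (sup_transform \<gamma> t))" by simp
  have "ennreal (enn2real (sup_transform \<gamma> t)) \<le> ennreal 1"
    unfolding *[symmetric] using sup_transform_le_1[OF assms] by simp
  then show "enn2real (sup_transform \<gamma> t) \<le> 1" by (simp only: ennreal_le_iff zero_le_one)
qed simp

lemma killed_transform_real:
  "killed_transform q \<gamma> = (\<integral>\<^sup>+v. exp_weight q v * ennreal (enn2real (sup_transform \<gamma> v)) \<partial>lborel)"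
  unfolding killed_transform_def using sup_transform_real(1)
  by (intro nn_integral_cong) (simp add: indicator_def)

definition total_transform :: "real \<Rightarrow> ennreal" where
  "total_transform \<gamma> = (\<integral>\<^sup>+\<omega>. ennreal (INF t\<in>{0..}. exp (- \<gamma> * X t \<omega>)) \<partial>M)"

lemma sup_transform_tendsto_total:
  assumes "0 \<le> \<gamma>" "filterlim v at_top sequentially" "\<And>m. 0 \<le> v m"
  shows "(\<lambda>m. sup_transform \<gamma> (v m)) \<longlonglongrightarrow> total_transform \<gamma>"
proof -
  have lim: "(\<lambda>m. inf_exp \<gamma> (v m) \<omega>) \<longlonglongrightarrow> (INF t\<in>{0..}. exp (- \<gamma> * X t \<omega>))" for \<omega>
    unfolding inf_exp_def using assms by (intro INF_atLeastAtMost_tendsto) auto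
  show ?thesis
    unfolding sup_transform_def total_transform_def
    by (rule nn_integral_tendsto_le_1[OF _ inf_exp_bounds(2) lim]) (use assms in auto)
qed

text \<open>An exponential time of mean m + 1 is (m + 1) u with u standard exponential. After this
  substitution the density is fixed and, for each u > 0, the horizon tends to infinity.\<close>

lemma killed_transform_tendsto_total:
  assumes "0 \<le> \<gamma>"
  shows "(\<lambda>m. killed_transform (1 / real (Suc m)) \<gamma>) \<longlonglongrightarrow> total_transform \<gamma>"
proof -
  define s where "s t = sup_transform \<gamma> t * indicator {0..} t" for t
  have [measurable]: "s \<in> borel_measurable borel"
    unfolding s_def[abs_def] using assms by (intro measurable_sup_transform[of 1]) auto
  have eq: "killed_transform (1 / real (Suc m)) \<gamma> = (\<integral>\<^sup>+u. ennreal (exponential_density 1 u) * s (real (Suc m) * u) \<partial>lborel)" for m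
  proof -
    have "killed_transform (1 / real (Suc m)) \<gamma> =
        (\<integral>\<^sup>+t. ennreal (1 / real (Suc m) * exp (- (1 / real (Suc m)) * t)) * s t \<partial>lborel)"
      unfolding killed_transform_def s_def by (intro nn_integral_cong) (simp add: indicator_def)
    also have "\<dots> = ennreal (real (Suc m)) * (\<integral>\<^sup>+u. ennreal (1 / real (Suc m) * exp (- (1 / real (Suc m)) * (0 + real (Suc m) * u))) * s (0 + real (Suc m) * u) \<partial>lborel)"
      by (subst nn_integral_real_affine[where c = "real (Suc m)" and t = 0]) auto
    also have "\<dots> = (\<integral>\<^sup>+u. ennreal (real (Suc m)) * (ennreal (1 / real (Suc m) * exp (- (1 / real (Suc m)) * (0 + real (Suc m) * u))) * s (0 + real (Suc m) * u)) \<partial>lborel)"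
      by (subst nn_integral_cmult) auto
    also have "\<dots> = (\<integral>\<^sup>+u. ennreal (exponential_density 1 u) * s (real (Suc m) * u) \<partial>lborel)"
    proof (rule nn_integral_cong)
      fix u :: real
      have "ennreal (real (Suc m)) * ennreal (1 / real (Suc m) * exp (- (1 / real (Suc m)) * (real (Suc m) * u))) = ennreal (exp (- u))"
        by (subst ennreal_mult'[symmetric]) (simp_all del: of_nat_Suc)
      moreover have "s (real (Suc m) * u) = 0" if "u < 0"
        using that by (simp add: s_def indicator_def mult_less_0_iff zero_le_mult_iff del: of_nat_Suc)
      ultimately show "ennreal (real (Suc m)) * (ennreal (1 / real (Suc m) * exp (- (1 / real (Suc m)) * (0 + real (Suc m) * u))) * s (0 + real (Suc m) * u)) =
          ennreal (exponential_density 1 u) * s (real (Suc m) * u)"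
        by (cases "u < 0") (simp_all add: exponential_density_def del: of_nat_Suc flip: mult.assoc)
    qed
    finally show ?thesis .
  qed
  note [simp] = nn_integral_exponential_density[of 1, simplified]
  have "(\<lambda>m. \<integral>\<^sup>+u. ennreal (exponential_density 1 u) * s (real (Suc m) * u) \<partial>lborel) \<longlonglongrightarrow>
      (\<integral>\<^sup>+u. ennreal (exponential_density 1 u) * total_transform \<gamma> \<partial>lborel)"
  proof (rule nn_integral_dominated_convergence[where w = "\<lambda>u. ennreal (exponential_density 1 u)"])
    have s_le: "s t \<le> 1" for t unfolding s_def using sup_transform_le_1[of t \<gamma>] by (simp add: indicator_def)
    show "AE u in lborel. ennreal (exponential_density 1 u) * s (real (Suc m) * u) \<le> ennreal (exponential_density 1 u)" for m
      using mult_left_mono[OF s_le] by (intro AE_I2) fastforce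
    show "AE u in lborel. (\<lambda>m. ennreal (exponential_density 1 u) * s (real (Suc m) * u)) \<longlonglongrightarrow>
        ennreal (exponential_density 1 u) * total_transform \<gamma>"
    proof (rule eventually_mono[OF AE_lborel_singleton[of 0]])
      fix u :: real assume "u \<noteq> 0"
      show "(\<lambda>m. ennreal (exponential_density 1 u) * s (real (Suc m) * u)) \<longlonglongrightarrow> ennreal (exponential_density 1 u) * total_transform \<gamma>"
      proof (cases "u < 0")
        case True
        then show ?thesis by (simp add: exponential_density_def)
      next
        case False
        with \<open>u \<noteq> 0\<close> have u: "0 < u" by simp
        have "filterlim (\<lambda>m. real (Suc m) * u) at_top sequentially"
          by (rule filterlim_at_top_mult_tendsto_pos[OF tendsto_const u])
             (rule filterlim_compose[OF filterlim_real_sequentially filterlim_Suc])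
        then have "(\<lambda>m. sup_transform \<gamma> (real (Suc m) * u)) \<longlonglongrightarrow> total_transform \<gamma>"
          using u by (intro sup_transform_tendsto_total assms) auto
        moreover have "s (real (Suc m) * u) = sup_transform \<gamma> (real (Suc m) * u)" for m
          using u by (simp add: s_def indicator_def)
        ultimately show ?thesis by (intro ennreal_tendsto_cmult) auto
      qed
    qed
  qed auto
  then show ?thesis unfolding eq by (simp add: nn_integral_multc)
qed

text \<open>Continuity supplies the values of the formula at its removable singularities. Test
  sequences are cut off at \<open>x / 2\<close> so that all exponents stay positive.\<close>

lemma killed_transform_continuous:
  assumes q: "0 < q" and x: "0 < x"
  shows "((\<lambda>y. enn2real (killed_transform q y)) \<longlongrightarrow> enn2real (killed_transform q x)) (at x)"
proof -
  have "(\<lambda>n. enn2real (killed_transform q (max (x / 2) (y n)))) \<longlonglongrightarrow> enn2real (killed_transform q x)"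
    if y: "y \<longlonglongrightarrow> x" for y :: "nat \<Rightarrow> real"
  proof -
    define z where "z n = max (x / 2) (y n)" for n
    have z0: "0 < z n" for n using x by (simp add: z_def less_max_iff_disj)
    have "z \<longlonglongrightarrow> max (x / 2) x" unfolding z_def by (intro tendsto_intros y)
    then have z: "z \<longlonglongrightarrow> x" using x by (simp add: max_def)
    have lim: "(\<lambda>n. inf_exp (z n) t \<omega>) \<longlonglongrightarrow> inf_exp x t \<omega>" if "0 \<le> t" for t \<omega>
    proof -
      define I where "I = (INF s\<in>{0..t}. exp (- X s \<omega>))"
      have "inf_exp c t \<omega> = I powr c" if "0 < c" for c
        unfolding inf_exp_def I_def using that \<open>0 \<le> t\<close> by (intro INF_exp_powr) auto
      then have "inf_exp (z n) t \<omega> = I powr z n" "inf_exp x t \<omega> = I powr x" for n using z0 x by auto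
      moreover have "(\<lambda>n. I powr z n) \<longlonglongrightarrow> I powr x"
      proof (cases "I = 0")
        case False
        then show ?thesis by (intro tendsto_powr tendsto_const z)
      qed simp
      ultimately show ?thesis by simp
    qed
    have sup: "(\<lambda>n. sup_transform (z n) t) \<longlonglongrightarrow> sup_transform x t" if "0 \<le> t" for t
      unfolding sup_transform_def
      by (rule nn_integral_tendsto_le_1[OF _ inf_exp_bounds(2) lim]) (use less_imp_le[OF z0] that in auto)
    have meas: "(\<lambda>t. sup_transform c t * indicator {0..} t) \<in> borel_measurable borel" if "0 < c" for c
      using measurable_sup_transform[of 1 c] that by simp
    have "(\<lambda>n. killed_transform q (z n)) \<longlonglongrightarrow> killed_transform q x"
      unfolding killed_transform_def
      by (rule nn_integral_exponential_tendsto(2)[OF q meas[OF z0] sup_transform_le_1 sup])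
    moreover have "killed_transform q x \<noteq> \<top>"
      using killed_transform_le_1[OF q, of x] x by (auto simp: top_unique)
    ultimately show ?thesis
      unfolding z_def[symmetric] by (intro tendsto_enn2real) (simp_all add: less_top)
  qed
  then have "((\<lambda>y. enn2real (killed_transform q (max (x / 2) y))) \<longlongrightarrow> enn2real (killed_transform q x)) (at x)"
    by (subst tendsto_at_iff_sequentially) (auto simp: comp_def)
  moreover have "\<forall>\<^sub>F y in at x. enn2real (killed_transform q (max (x / 2) y)) = enn2real (killed_transform q y)"
    using order_tendstoD(1)[OF tendsto_ident_at, of "x / 2" x UNIV] x
    by (auto elim!: eventually_mono simp: max_def)
  ultimately show ?thesis by (rule Lim_transform_eventually)
qed

end

section \<open>The transform at an exponential time for all arguments\<close>

context invertible_spectrally_positive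
begin

text \<open>Take \<open>drift_master\<close> with drift 0 and first clock Exp(p), mix the second leg
  over Exp(q), and recognise the sum of the clocks by \<open>exponential_resolvent\<close>. As
  \<gamma> < \<open>rate p\<close>, the transform at p is known. The equation is left undivided by q
  - \<open>exponent \<gamma>\<close>, so that \<gamma> = \<open>rate q\<close> remains
  admissible.\<close>

lemma killed_transform_resolvent:
  assumes q: "0 < q" and p: "q < p" and \<gamma>: "0 \<le> \<gamma>" "\<gamma> < rate p"
  shows "rate p * enn2real (killed_transform q \<gamma>) * (q - exponent \<gamma>) =
    (rate p - \<gamma>) * q - (p - q) * \<gamma> * enn2real (killed_transform q (rate p))"
proof -
  define R where "R = rate p"
  have p0: "0 < p" using q p by simp
  have R: "0 < R" "\<gamma> < R" using rate(1)[OF p0] \<gamma> by (auto simp: R_def)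
  define F where "F t = sup_transform \<gamma> t * indicator {0..} t" for t
  define f where "f x v = enn2real (sup_transform x v)" for x v
  have Fm [measurable]: "F \<in> borel_measurable borel"
    unfolding F_def[abs_def] using measurable_sup_transform[OF q \<gamma>(1)] .
  have fm: "(\<lambda>v. ennreal (f x v) * indicator {0..} v) \<in> borel_measurable borel" if "0 \<le> x" for x
  proof -
    have "(\<lambda>v. ennreal (f x v) * indicator {0..} v) = (\<lambda>v. sup_transform x v * indicator {0..} v)"
      unfolding f_def using sup_transform_real(1) by (auto simp: fun_eq_iff indicator_def)
    then show ?thesis using measurable_sup_transform[OF q that] by simp
  qed
  have f01: "0 \<le> f x v \<and> f x v \<le> 1" if "0 \<le> v" for x v
    unfolding f_def using sup_transform_real[OF that] by auto
  have dm: "drift_transform x 0 s v = sup_transform x (s + v)" for x s v by (rule drift_transform_0)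
  have master: "0 \<le> (R * f \<gamma> v - \<gamma> * f R v) / (R - \<gamma>)"
      "(\<integral>\<^sup>+s. exp_weight p s * F (s + v) \<partial>lborel) =
        killed_transform p \<gamma> * ennreal ((R * f \<gamma> v - \<gamma> * f R v) / (R - \<gamma>))" if v: "0 \<le> v" for v
  proof -
    note m = drift_master(1,2)[OF p0 \<gamma>(1) _ v, of 0, unfolded dm, folded R_def f_def]
    show "0 \<le> (R * f \<gamma> v - \<gamma> * f R v) / (R - \<gamma>)" using m(1) R by simp
    have "(\<integral>\<^sup>+s. exp_weight p s * F (s + v) \<partial>lborel) =
        (\<integral>\<^sup>+s. exp_weight p s * sup_transform \<gamma> (s + v) \<partial>lborel)"
      using v by (intro nn_integral_cong) (auto simp: F_def indicator_def)
    then show "(\<integral>\<^sup>+s. exp_weight p s * F (s + v) \<partial>lborel) =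
        killed_transform p \<gamma> * ennreal ((R * f \<gamma> v - \<gamma> * f R v) / (R - \<gamma>))"
      using m(2) R by simp
  qed
  define L where "L x = enn2real (killed_transform q x)" for x
  define A where "A = enn2real (killed_transform p \<gamma>)"
  have A: "A = p * (R - \<gamma>) / (R * (p - exponent \<gamma>))"
    unfolding A_def R_def by (rule killed_transform_below_rate[OF p0 \<gamma>])
  have pe: "exponent \<gamma> < p" by (rule exponent_less[OF p0 \<gamma>])
  have kt: "killed_transform a x = ennreal (enn2real (killed_transform a x))" if "0 < a" "0 \<le> x" for a x
    using neq_top_trans[OF _ killed_transform_le_1[OF that]] by (simp add: less_top)
  define a where "a = R / (R - \<gamma>)"
  define b where "b = - \<gamma> / (R - \<gamma>)"
  have ab: "(R * f \<gamma> v - \<gamma> * f R v) / (R - \<gamma>) = a * f \<gamma> v + b * f R v" for v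
    by (simp add: a_def b_def diff_divide_distrib)
  have "(\<integral>\<^sup>+v. exp_weight q v *
        (\<integral>\<^sup>+s. exp_weight p s * F (s + v) \<partial>lborel) \<partial>lborel) =
      (\<integral>\<^sup>+v. killed_transform p \<gamma> * (exp_weight q v * ennreal (a * f \<gamma> v + b * f R v)) \<partial>lborel)"
    unfolding ab[symmetric] using master(2) by (intro nn_integral_cong) (auto simp: indicator_def mult_ac)
  also have "\<dots> = killed_transform p \<gamma> * (\<integral>\<^sup>+v. exp_weight q v * ennreal (a * f \<gamma> v + b * f R v) \<partial>lborel)"
  proof (rule nn_integral_cmult)
    have "(\<lambda>v. f x v * indicator {0..} v) \<in> borel_measurable borel" if "0 \<le> x" for x
    proof -
      have "(\<lambda>v. f x v * indicator {0..} v) = (\<lambda>v. enn2real (ennreal (f x v) * indicator {0..} v))"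
        using f01 by (auto simp: fun_eq_iff indicator_def)
      then show ?thesis using fm[OF that] by simp
    qed
    note [measurable] = this[OF \<gamma>(1)] this[OF less_imp_le[OF R(1)]]
    have "(\<lambda>v. exp_weight q v * ennreal (a * f \<gamma> v + b * f R v)) =
        (\<lambda>v. exp_weight q v * ennreal (a * (f \<gamma> v * indicator {0..} v) + b * (f R v * indicator {0..} v)))"
      by (auto simp: fun_eq_iff indicator_def)
    also have "\<dots> \<in> borel_measurable lborel" by measurable
    finally show "(\<lambda>v. exp_weight q v * ennreal (a * f \<gamma> v + b * f R v)) \<in> borel_measurable lborel" .
  qed
  also have "(\<integral>\<^sup>+v. exp_weight q v * ennreal (a * f \<gamma> v + b * f R v) \<partial>lborel) =
      ennreal (a * L \<gamma> + b * L R)"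
    unfolding L_def killed_transform_real[of q, folded f_def]
    using R \<gamma> f01 master(1) unfolding ab by (intro nn_integral_exponential_linear[OF q] fm) auto
  finally have D: "(\<integral>\<^sup>+v. exp_weight q v *
        (\<integral>\<^sup>+s. exp_weight p s * F (s + v) \<partial>lborel) \<partial>lborel) =
      ennreal (A * (a * L \<gamma> + b * L R))"
    unfolding A_def using kt[OF p0 \<gamma>(1)] by (metis ennreal_mult' enn2real_nonneg)
  have nonneg: "0 \<le> a * L \<gamma> + b * L R"
    unfolding L_def killed_transform_real[of q, folded f_def]
    using R \<gamma> f01 master(1) unfolding ab by (intro nn_integral_exponential_linear_nonneg[OF q] fm) auto
  have KF: "(\<integral>\<^sup>+t. exp_weight x t * F t \<partial>lborel) = killed_transform x \<gamma>" for x
    unfolding killed_transform_def F_def by (intro nn_integral_cong) (simp add: indicator_def)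
  have "ennreal (p - q) * ennreal (A * (a * L \<gamma> + b * L R)) + ennreal q * ennreal A = ennreal p * ennreal (L \<gamma>)"
    using exponential_resolvent[OF Fm q p] unfolding D KF A_def L_def
    using kt[OF p0 \<gamma>(1)] kt[OF q \<gamma>(1)] by simp
  moreover have A0: "0 \<le> A" "0 \<le> L \<gamma>" by (simp_all add: A_def L_def)
  ultimately have "ennreal ((p - q) * (A * (a * L \<gamma> + b * L R)) + q * A) = ennreal (p * L \<gamma>)"
    using p q nonneg by (simp add: ennreal_mult' ennreal_plus mult_nonneg_nonneg)
  then have u: "(p - q) * (A * (a * L \<gamma> + b * L R)) + q * A = p * L \<gamma>"
    using A0 p q nonneg by (subst (asm) ennreal_inj) (auto intro!: add_nonneg_nonneg mult_nonneg_nonneg)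
  have w: "(R - \<gamma>) * (a * L \<gamma> + b * L R) = R * L \<gamma> - \<gamma> * L R"
    using R by (simp add: a_def b_def flip: diff_divide_distrib)
  have "x * A * ((R - \<gamma>) * W) + q * A * (R - \<gamma>) = (R - \<gamma>) * (x * (A * W) + q * A)" for x W
    by (simp add: algebra_simps)
  from this[of "p - q" "a * L \<gamma> + b * L R"]
  have E: "(p - q) * A * (R * L \<gamma> - \<gamma> * L R) + q * A * (R - \<gamma>) = p * (R - \<gamma>) * L \<gamma>"
    unfolding u w by (simp only: mult_ac)
  have ARp: "p * (R - \<gamma>) = A * R * (p - exponent \<gamma>)" unfolding A using R pe by simp
  have "A \<noteq> 0" unfolding A using R pe p0 by simp
  moreover have "A * ((p - q) * (R * L \<gamma> - \<gamma> * L R) + q * (R - \<gamma>)) = A * (R * (p - exponent \<gamma>) * L \<gamma>)"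
    using E unfolding ARp by (simp add: algebra_simps)
  ultimately have "(p - q) * (R * L \<gamma> - \<gamma> * L R) + q * (R - \<gamma>) = R * (p - exponent \<gamma>) * L \<gamma>"
    by (rule mult_left_cancel[THEN iffD1])
  then show ?thesis unfolding R_def[symmetric] L_def[symmetric] by (simp add: algebra_simps)
qed

theorem killed_transform_eq:
  assumes q: "0 < q" and \<gamma>: "0 \<le> \<gamma>" "\<gamma> \<noteq> rate q"
  shows "enn2real (killed_transform q \<gamma>) = q * (rate q - \<gamma>) / (rate q * (q - exponent \<gamma>))"
proof (cases "\<gamma> < rate q")
  case True
  then show ?thesis by (rule killed_transform_below_rate[OF q \<gamma>(1)])
next
  case False
  define r where "r = rate q"
  have r: "0 < r" "r < \<gamma>" "exponent r = q" using rate[OF q] False \<gamma> by (auto simp: r_def)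
  have e: "q < exponent \<gamma>" by (rule exponent_greater[OF q]) (use r in \<open>simp add: r_def\<close>)
  obtain p where p: "q < p" "\<gamma> < rate p" using rate_unbounded[of q \<gamma>] by auto
  define R where "R = rate p"
  define LR where "LR = enn2real (killed_transform q R)"
  define L where "L = enn2real (killed_transform q \<gamma>)"
  \<comment> \<open>At the argument \<open>rate q\<close> the left side of the equation vanishes,
    which determines the unknown \<open>LR\<close>.\<close>
  have 1: "(R - r) * q = (p - q) * r * LR"
    using killed_transform_resolvent[OF q p(1), of r] r p(2) unfolding R_def[symmetric] LR_def[symmetric] by simp
  have 2: "R * L * (q - exponent \<gamma>) = (R - \<gamma>) * q - (p - q) * \<gamma> * LR"
    using killed_transform_resolvent[OF q p(1) \<gamma>(1) p(2)] unfolding R_def[symmetric] LR_def[symmetric] L_def[symmetric] by simp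
  have "r * (R * L * (q - exponent \<gamma>)) = r * ((R - \<gamma>) * q) - \<gamma> * ((p - q) * r * LR)"
    unfolding 2 by (simp add: algebra_simps)
  also have "\<dots> = R * (q * (r - \<gamma>))" unfolding 1[symmetric] by (simp add: algebra_simps)
  finally have "R * (r * L * (q - exponent \<gamma>)) = R * (q * (r - \<gamma>))" by (simp only: mult_ac)
  moreover have "R \<noteq> 0" using r p(2) by (simp add: R_def)
  ultimately have "r * L * (q - exponent \<gamma>) = q * (r - \<gamma>)" by simp
  then show ?thesis
    unfolding r_def[symmetric] L_def[symmetric] using r e by (simp add: field_simps)
qed

end

section \<open>Reduction to measurable functionals of the data\<close>

context invertible_spectrally_positive
begin

text \<open>Convexity gives \<open>exponent y\<close> \<ge> d y \<ge> 0. If the exponent vanished at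
  x, it would vanish at x / 2 as well, so E (exp(- x X / 2) - 1)^2 = 0 for the value X at time 1.
  Then X = 0 almost surely and the exponent is identically 0, against its surjectivity.\<close>

lemma exponent_pos:
  assumes d: "(exponent has_real_derivative d) (at 0 within {0..})" "0 \<le> d" and x: "0 < x"
  shows "0 < exponent x"
proof -
  have ge: "0 \<le> exponent y" if "0 < y" for y
  proof -
    have "((\<lambda>z. (exponent z - exponent 0) / (z - 0)) \<longlongrightarrow> d) (at 0 within {0..})"
      using d(1) by (simp add: has_field_derivative_iff)
    moreover have "filterlim (\<lambda>n. y / real (Suc n)) (at 0 within {0..}) sequentially"
    proof -
      have "(\<lambda>n. y * inverse (real (Suc n))) \<longlonglongrightarrow> y * 0"
        by (intro tendsto_mult tendsto_const LIMSEQ_inverse_real_of_nat)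
      then have "(\<lambda>n. y / real (Suc n)) \<longlonglongrightarrow> 0" by (simp add: divide_inverse)
      then show ?thesis using that by (simp add: filterlim_at)
    qed
    ultimately have "(\<lambda>n. (exponent (y / real (Suc n)) - exponent 0) / (y / real (Suc n) - 0)) \<longlonglongrightarrow> d"
      by (rule filterlim_compose)
    moreover have "(exponent (y / real (Suc n)) - exponent 0) / (y / real (Suc n) - 0) \<le> exponent y / y" for n
    proof -
      have "exponent (1 / real (Suc n) * y) \<le> 1 / real (Suc n) * exponent y"
        using that by (intro exponent_convex) auto
      then have "exponent (y / real (Suc n)) / (y / real (Suc n)) \<le> (exponent y / real (Suc n)) / (y / real (Suc n))"
        using that by (intro divide_right_mono) (auto simp del: of_nat_Suc)
      then show ?thesis by (simp del: of_nat_Suc)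
    qed
    ultimately have "d \<le> exponent y / y" by (intro LIMSEQ_le_const2) auto
    then have "0 \<le> exponent y / y" using d(2) by simp
    then show ?thesis using that by (simp add: zero_le_divide_iff)
  qed
  have "exponent x \<noteq> 0"
  proof
    assume 0: "exponent x = 0"
    have "exponent (1 / 2 * x) \<le> 1 / 2 * exponent x" using x by (intro exponent_convex) auto
    then have half: "exponent (x / 2) = 0" using 0 ge[of "x / 2"] x by simp
    have m1: "(\<integral>\<^sup>+\<omega>. ennreal (exp (- x * X 1 \<omega>)) \<partial>M) = 1"
      using mgf_eq_exp[of x] 0 x by (simp add: mgf_def)
    have m2: "(\<integral>\<^sup>+\<omega>. ennreal (exp (- (x / 2) * X 1 \<omega>)) \<partial>M) = 1"
      using mgf_eq_exp[of "x / 2"] half x by (simp add: mgf_def)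
    have i1: "integrable M (\<lambda>\<omega>. exp (- x * X 1 \<omega>))"
      using m1 by (intro integrableI_nonneg) auto
    have i2: "integrable M (\<lambda>\<omega>. exp (- (x / 2) * X 1 \<omega>))"
      using m2 by (intro integrableI_nonneg) auto
    have e1: "(\<integral>\<omega>. exp (- x * X 1 \<omega>) \<partial>M) = 1" using m1 by (subst integral_eq_nn_integral) auto
    have e2: "(\<integral>\<omega>. exp (- (x / 2) * X 1 \<omega>) \<partial>M) = 1" using m2 by (subst integral_eq_nn_integral) auto
    have sq: "(exp (- (x / 2) * X 1 \<omega>) - 1)\<^sup>2 = exp (- x * X 1 \<omega>) - 2 * exp (- (x / 2) * X 1 \<omega>) + 1" for \<omega>
      by (simp add: power2_eq_square algebra_simps flip: exp_add)
    have "integrable M (\<lambda>\<omega>. (exp (- (x / 2) * X 1 \<omega>) - 1)\<^sup>2)"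
      unfolding sq using i1 i2 by (intro Bochner_Integration.integrable_add Bochner_Integration.integrable_diff integrable_mult_right) auto
    moreover have "(\<integral>\<omega>. (exp (- (x / 2) * X 1 \<omega>) - 1)\<^sup>2 \<partial>M) = 0"
      unfolding sq using i1 i2 e1 e2 by (simp add: prob_space)
    ultimately have "AE \<omega> in M. (exp (- (x / 2) * X 1 \<omega>) - 1)\<^sup>2 = 0"
      by (subst (asm) integral_nonneg_eq_0_iff_AE) auto
    then have "AE \<omega> in M. X 1 \<omega> = 0" using x by (auto elim!: eventually_mono)
    then have "mgf \<beta> 0 = (\<integral>\<^sup>+\<omega>. 1 \<partial>M)" for \<beta>
      unfolding mgf_def by (intro nn_integral_cong_AE) (auto elim!: eventually_mono)
    then have "exponent \<beta> = 0" for \<beta> by (simp add: exponent_def emeasure_space_1)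
    with exponent_onto[of 1] show False by simp
  qed
  with ge[OF x] show ?thesis by simp
qed

text \<open>Let the killing rate \<theta> tend to 0 in \<open>killed_transform_eq\<close>.
  Positivity of the exponent makes \<open>rate\<close> tend to 0 as well, and \<theta> /
  \<open>rate \<theta>\<close> is a difference quotient of the exponent at 0, with limit
  \<open>d\<close>.\<close>

lemma total_transform_eq:
  assumes d: "(exponent has_real_derivative d) (at 0 within {0..})" "0 \<le> d" and x: "0 < x"
  shows "enn2real (total_transform x) = d * x / exponent x"
proof -
  define \<theta> where "\<theta> m = 1 / real (Suc m)" for m
  have \<theta>0: "0 < \<theta> m" for m by (simp add: \<theta>_def)
  have \<theta>: "\<theta> \<longlonglongrightarrow> 0"
    unfolding \<theta>_def[abs_def] using LIMSEQ_inverse_real_of_nat by (simp add: inverse_eq_divide)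
  define r where "r m = rate (\<theta> m)" for m
  have r: "0 < r m" "exponent (r m) = \<theta> m" for m using rate[OF \<theta>0] by (auto simp: r_def)
  have ex: "0 < exponent y" if "0 < y" for y by (rule exponent_pos[OF d that])
  have r_lim: "r \<longlonglongrightarrow> 0"
  proof (rule order_tendstoI)
    fix e :: real assume "0 < e"
    have "\<forall>\<^sub>F m in sequentially. \<theta> m < exponent e" using \<theta> ex[OF \<open>0 < e\<close>] by (rule order_tendstoD)
    then show "\<forall>\<^sub>F m in sequentially. r m < e"
    proof eventually_elim
      case (elim m)
      show ?case
      proof (rule ccontr)
        assume "\<not> r m < e"
        then consider "e < rate (\<theta> m)" | "e = r m" by (fastforce simp: r_def)
        then show False
        proof cases
          case 1
          then show False using exponent_less[OF \<theta>0 less_imp_le[OF \<open>0 < e\<close>]] elim by fastforce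
        next
          case 2
          then show False using r(2)[of m] elim by simp
        qed
      qed
    qed
  qed (use r in \<open>auto intro: always_eventually less_trans\<close>)
  have ratio: "(\<lambda>m. \<theta> m / r m) \<longlonglongrightarrow> d"
  proof -
    have "((\<lambda>z. (exponent z - exponent 0) / (z - 0)) \<longlongrightarrow> d) (at 0 within {0..})"
      using d(1) by (simp add: has_field_derivative_iff)
    moreover have "filterlim r (at 0 within {0..}) sequentially"
      using r_lim r(1) by (simp add: filterlim_at less_imp_le less_imp_neq[symmetric])
    ultimately have "(\<lambda>m. (exponent (r m) - exponent 0) / (r m - 0)) \<longlonglongrightarrow> d" by (rule filterlim_compose)
    then show ?thesis by (simp add: r)
  qed
  have "(\<lambda>m. \<theta> m / r m * ((r m - x) / (\<theta> m - exponent x))) \<longlonglongrightarrow> d * ((0 - x) / (0 - exponent x))"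
    using ex[OF x] by (intro tendsto_mult ratio tendsto_divide tendsto_diff r_lim \<theta> tendsto_const) auto
  moreover have "\<forall>\<^sub>F m in sequentially. \<theta> m / r m * ((r m - x) / (\<theta> m - exponent x)) = enn2real (killed_transform (\<theta> m) x)"
    using order_tendstoD(2)[OF r_lim x]
  proof eventually_elim
    case (elim m)
    then show ?case
      using killed_transform_eq[OF \<theta>0 less_imp_le[OF x], of m] by (simp add: r_def)
  qed
  ultimately have "(\<lambda>m. enn2real (killed_transform (\<theta> m) x)) \<longlonglongrightarrow> d * ((0 - x) / (0 - exponent x))"
    by (rule Lim_transform_eventually)
  moreover have "(\<lambda>m. enn2real (killed_transform (\<theta> m) x)) \<longlonglongrightarrow> enn2real (total_transform x)"
  proof (rule tendsto_enn2real)
    have lim: "(\<lambda>m. killed_transform (\<theta> m) x) \<longlonglongrightarrow> total_transform x"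
      unfolding \<theta>_def using x by (intro killed_transform_tendsto_total) simp
    have "total_transform x \<le> 1"
      using lim by (rule LIMSEQ_le_const2) (use killed_transform_le_1 \<theta>0 x in auto)
    then have "total_transform x \<noteq> \<top>" by (auto simp: top_unique)
    then show "(\<lambda>m. killed_transform (\<theta> m) x) \<longlonglongrightarrow> ennreal (enn2real (total_transform x))"
      using lim by (simp add: less_top)
  qed simp
  ultimately show ?thesis using LIMSEQ_unique by fastforce
qed

text \<open>Away from the rate the quotient equals \<open>k\<close> times a continuous transform, so
  its continuation at the rate is the value of that product.\<close>

lemma quot_ext_killed_transform:
  assumes q: "0 < q" and x: "0 < x"
    and uv: "\<And>y. 0 < y \<Longrightarrow> y \<noteq> rate q \<Longrightarrow> u y / v y = k y * enn2real (killed_transform q y)"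
    and v: "v x = 0 \<longleftrightarrow> x = rate q" and k: "isCont k x"
  shows "quot_ext u v x = k x * enn2real (killed_transform q x)"
proof (cases "v x = 0")
  case False
  then show ?thesis using uv[OF x] v by (simp add: quot_ext_def)
next
  case True
  have "((\<lambda>y. k y * enn2real (killed_transform q y)) \<longlongrightarrow> k x * enn2real (killed_transform q x)) (at x)"
    using k by (intro tendsto_mult killed_transform_continuous[OF q x]) (simp add: isCont_def)
  moreover have "\<forall>\<^sub>F y in at x. k y * enn2real (killed_transform q y) = u y / v y"
    using order_tendstoD(1)[OF tendsto_ident_at x, of UNIV] eventually_neq_at_within[of x x UNIV]
    by eventually_elim (use uv v True in auto)
  ultimately have "((\<lambda>y. u y / v y) \<longlongrightarrow> k x * enn2real (killed_transform q x)) (at x)"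
    by (rule Lim_transform_eventually)
  then show ?thesis using True by (simp add: quot_ext_def tendsto_Lim)
qed

end

section \<open>Independence, exponential clocks and measurability\<close>

lemma indep_random_elements_distr:
  assumes "prob_space M" "indep_random_elements M A Y B Z"
  shows "distr M (A \<Otimes>\<^sub>M B) (\<lambda>\<omega>. (Y \<omega>, Z \<omega>)) = distr M A Y \<Otimes>\<^sub>M distr M B Z"
proof -
  interpret prob_space M by fact
  have Y [measurable]: "Y \<in> measurable M A" and Z [measurable]: "Z \<in> measurable M B"
    and ind: "indep_set (sets (vimage_algebra (space M) Y A)) (sets (vimage_algebra (space M) Z B))"
    using assms(2) by (auto simp: indep_random_elements_def)
  interpret Y: prob_space "distr M A Y" by (rule prob_space_distr) fact
  interpret Z: prob_space "distr M B Z" by (rule prob_space_distr) fact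
  show ?thesis
  proof (rule pair_measure_eqI[symmetric])
    fix a b assume "a \<in> sets (distr M A Y)" "b \<in> sets (distr M B Z)"
    then have a [measurable]: "a \<in> sets A" and b [measurable]: "b \<in> sets B" by auto
    have "prob ((Y -` a \<inter> space M) \<inter> (Z -` b \<inter> space M)) = prob (Y -` a \<inter> space M) * prob (Z -` b \<inter> space M)"
      using ind by (rule indep_setD) (auto intro: in_vimage_algebra)
    moreover have "(\<lambda>\<omega>. (Y \<omega>, Z \<omega>)) -` (a \<times> b) \<inter> space M = (Y -` a \<inter> space M) \<inter> (Z -` b \<inter> space M)" by auto
    ultimately show "emeasure (distr M A Y) a * emeasure (distr M B Z) b =
        emeasure (distr M (A \<Otimes>\<^sub>M B) (\<lambda>\<omega>. (Y \<omega>, Z \<omega>))) (a \<times> b)"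
      by (simp add: emeasure_distr emeasure_eq_measure ennreal_mult)
  qed (auto intro: Y.sigma_finite_measure_axioms Z.sigma_finite_measure_axioms)
qed

lemma exponential_distr:
  assumes T: "distributed M lborel T (exponential_density l)" and l: "0 < l"
  shows "T \<in> borel_measurable M"
    and "f \<in> borel_measurable borel \<Longrightarrow>
      (\<integral>\<^sup>+s. f s \<partial>distr M borel T) = (\<integral>\<^sup>+s. exp_weight l s * f s \<partial>lborel)"
proof -
  show "T \<in> borel_measurable M" using distributed_measurable[OF T] by simp
  assume [measurable]: "f \<in> borel_measurable borel"
  have "distr M borel T = distr M lborel T" by (rule distr_cong) auto
  also have "\<dots> = density lborel (exponential_density l)" using T by (simp add: distributed_def)
  finally have "(\<integral>\<^sup>+s. f s \<partial>distr M borel T) = (\<integral>\<^sup>+s. ennreal (exponential_density l s) * f s \<partial>lborel)"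
    by (simp add: nn_integral_density)
  also have "\<dots> = (\<integral>\<^sup>+s. exp_weight l s * f s \<partial>lborel)"
    by (intro nn_integral_cong) (simp add: exponential_density_def indicator_def mult.commute)
  finally show "(\<integral>\<^sup>+s. f s \<partial>distr M borel T) = (\<integral>\<^sup>+s. exp_weight l s * f s \<partial>lborel)" .
qed

text \<open>The decreasing continuous map exp(- \<gamma> s) turns the supremum into an infimum, and
  an infinite supremum corresponds to the infimum 0. Positivity of \<open>r\<close> puts time 0 into
  the time set, so the value for an empty set does not arise.\<close>

lemma exp_neg_sup_before:
  assumes "0 < \<gamma>" "0 < r"
  shows "exp_neg \<gamma> (sup_before f r) = (INF t\<in>{t. 0 \<le> t \<and> ereal t < r}. exp (- \<gamma> * f t))"
proof -
  define A where "A = {t. 0 \<le> t \<and> ereal t < r}"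
  have A: "A \<noteq> {}" using assms(2) by (auto simp: A_def zero_ereal_def intro!: exI[of _ 0])
  have sb: "sup_before f r = (SUP t\<in>A. ereal (f t))" by (simp add: sup_before_def A_def)
  show ?thesis
  proof (cases "bdd_above (f ` A)")
    case True
    have "exp (- \<gamma> * Sup (f ` A)) = (INF s\<in>f ` A. exp (- \<gamma> * s))"
    proof (rule continuous_at_Sup_antimono)
      show "antimono (\<lambda>s. exp (- \<gamma> * s))" using assms(1) by (auto simp: antimono_def)
    qed (use A True in \<open>auto intro!: continuous_intros\<close>)
    moreover have "(SUP t\<in>A. ereal (f t)) = ereal (Sup (f ` A))"
    proof -
      obtain t0 where t0: "t0 \<in> A" using A by blast
      obtain b where b: "\<And>t. t \<in> A \<Longrightarrow> f t \<le> b" using True by (auto simp: bdd_above_def)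
      have "(SUP t\<in>A. ereal (f t)) \<le> ereal b" using b by (intro SUP_least) auto
      moreover have "ereal (f t0) \<le> (SUP t\<in>A. ereal (f t))" using t0 by (rule SUP_upper)
      ultimately have "\<bar>SUP t\<in>A. ereal (f t)\<bar> \<noteq> \<infinity>" by auto
      then show ?thesis by (simp add: ereal_SUP image_image)
    qed
    ultimately show ?thesis unfolding sb A_def[symmetric] by (simp add: exp_neg_def image_image)
  next
    case False
    have "(SUP t\<in>A. ereal (f t)) = \<infinity>"
    proof (rule ereal_top)
      fix b :: real
      from False obtain t where "t \<in> A" "b \<le> f t" by (auto simp: bdd_above_def not_le) (meson less_imp_le)
      then show "ereal b \<le> (SUP t\<in>A. ereal (f t))" by (intro SUP_upper2[of t]) auto
    qed
    moreover have "(INF t\<in>A. exp (- \<gamma> * f t)) = 0"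
    proof (rule antisym)
      show "0 \<le> (INF t\<in>A. exp (- \<gamma> * f t))" using A by (intro cINF_greatest) auto
      show "(INF t\<in>A. exp (- \<gamma> * f t)) \<le> 0"
      proof (rule field_le_epsilon)
        fix e :: real assume e: "0 < e"
        from False obtain t where t: "t \<in> A" "- ln e / \<gamma> \<le> f t" by (auto simp: bdd_above_def not_le) (meson less_imp_le)
        have "(INF t\<in>A. exp (- \<gamma> * f t)) \<le> exp (- \<gamma> * f t)" using t by (intro cINF_lower bdd_belowI2[of _ 0]) auto
        also have "- \<gamma> * f t \<le> ln e" using t(2) assms(1) by (simp add: field_simps)
        then have "exp (- \<gamma> * f t) \<le> e" using e by (metis exp_le_cancel_iff exp_ln)
        finally show "(INF t\<in>A. exp (- \<gamma> * f t)) \<le> 0 + e" by simp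
      qed
    qed
    ultimately show ?thesis unfolding sb A_def[symmetric] by (simp add: exp_neg_def)
  qed
qed

text \<open>A version of the functional that only looks at rational times, and is therefore measurable on the path space.\<close>

definition rational_inf :: "real \<Rightarrow> real \<Rightarrow> real \<Rightarrow> (real \<Rightarrow> real) \<Rightarrow> real \<Rightarrow> ereal \<Rightarrow> real" where
  "rational_inf \<gamma> c1 c2 p s r = (if r \<le> 0 then 1 else
     INF t\<in>\<rat> \<inter> {0..}. if ereal t < r then exp (- \<gamma> * (p t - piecewise_drift c1 c2 s t))
       else exp (- \<gamma> * (p 0 - piecewise_drift c1 c2 s 0)))"

text \<open>Right-continuity lets rational times just after \<open>t\<close>, still below
  \<open>r\<close>, take the place of \<open>t\<close>. Rational times not below \<open>r\<close>
  repeat the value at time 0, which is itself admissible; in this way the index set is the same for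
  all \<open>r\<close>.\<close>

lemma rational_inf_eq:
  assumes p: "\<And>t. 0 \<le> t \<Longrightarrow> continuous (at_right t) p" and r: "0 < r"
  shows "rational_inf \<gamma> c1 c2 p s r =
    (INF t\<in>{t. 0 \<le> t \<and> ereal t < r}. exp (- \<gamma> * (p t - piecewise_drift c1 c2 s t)))"
proof -
  define g where "g t = exp (- \<gamma> * (p t - piecewise_drift c1 c2 s t))" for t
  define A where "A = {t. 0 \<le> t \<and> ereal t < r}"
  have A0: "0 \<in> A" using r by (simp add: A_def zero_ereal_def)
  have rc: "continuous (at_right t) g" if "0 \<le> t" for t
  proof -
    have "piecewise_drift c1 c2 s = (\<lambda>t. c1 * min t s + c2 * max 0 (t - s))"
      by (auto simp: piecewise_drift_def fun_eq_iff min_def max_def)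
    then show ?thesis unfolding g_def using p[OF that] by (auto intro!: continuous_intros)
  qed
  have bdd: "bdd_below (g ` A)" "bdd_below ((\<lambda>t. if ereal t < r then g t else g 0) ` (\<rat> \<inter> {0..}))"
    by (auto intro!: bdd_belowI2[of _ 0] simp: g_def)
  have "(INF t\<in>\<rat> \<inter> {0..}. if ereal t < r then g t else g 0) = (INF t\<in>A. g t)"
  proof (rule antisym)
    show "(INF t\<in>A. g t) \<le> (INF t\<in>\<rat> \<inter> {0..}. if ereal t < r then g t else g 0)"
      using A0 bdd by (intro cINF_greatest) (auto intro!: cINF_lower exI[of _ 0] simp: A_def)
    show "(INF t\<in>\<rat> \<inter> {0..}. if ereal t < r then g t else g 0) \<le> (INF t\<in>A. g t)"
    proof (rule cINF_greatest)
      fix t assume "t \<in> A"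
      then have t: "0 \<le> t" "ereal t < r" by (auto simp: A_def)
      show "(INF t\<in>\<rat> \<inter> {0..}. if ereal t < r then g t else g 0) \<le> g t"
      proof (rule field_le_epsilon)
        fix e :: real assume "0 < e"
        then obtain d where d: "0 < d" "\<And>u. t \<le> u \<Longrightarrow> u < t + d \<Longrightarrow> \<bar>g u - g t\<bar> < e"
          using continuous_at_right_eps[OF rc[OF t(1)]] by blast
        obtain b where b: "t < b" "ereal b \<le> r"
          using t(2) by (cases r) (auto intro: that[of "t + 1"])
        obtain u where u: "u \<in> \<rat>" "t < u" "u < min b (t + d)"
          using Rats_dense_in_real[of t "min b (t + d)"] b(1) d(1) by auto
        have "ereal u < r" using u(3) b(2) by (auto intro: less_le_trans[of _ "ereal b"])
        then have "(INF t\<in>\<rat> \<inter> {0..}. if ereal t < r then g t else g 0) \<le> g u"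
          using u t(1) bdd by (intro order_trans[OF cINF_lower[of _ _ u]]) auto
        moreover have "\<bar>g u - g t\<bar> < e" using u by (intro d(2)) auto
        ultimately show "(INF t\<in>\<rat> \<inter> {0..}. if ereal t < r then g t else g 0) \<le> g t + e" by linarith
      qed
    qed (use A0 in auto)
  qed
  then show ?thesis using r by (simp add: rational_inf_def g_def A_def)
qed

lemma measurable_rational_inf:
  assumes [measurable]: "p \<in> measurable N path_space" "s \<in> borel_measurable N" "r \<in> borel_measurable N"
  shows "(\<lambda>x. rational_inf \<gamma> c1 c2 (p x) (s x) (r x)) \<in> borel_measurable N"
proof -
  have [measurable]: "(\<lambda>x. p x t) \<in> borel_measurable N" if "0 \<le> t" for t
    using measurable_compose[OF assms(1) measurable_component_singleton[of t "{0..}" "\<lambda>_. borel"]] that by simp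
  have [measurable]: "(\<lambda>x. piecewise_drift c1 c2 (s x) t) \<in> borel_measurable N" for t
    unfolding piecewise_drift_def by measurable
  have "(\<lambda>x. INF t\<in>\<rat> \<inter> {0..}. if ereal t < r x then exp (- \<gamma> * (p x t - piecewise_drift c1 c2 (s x) t))
       else exp (- \<gamma> * (p x 0 - piecewise_drift c1 c2 (s x) 0))) \<in> borel_measurable N"
    by (intro borel_measurable_cINF_real countable_Int1 countable_rat) auto
  then show ?thesis unfolding rational_inf_def by measurable
qed

section \<open>Removing the starting value and a linear drift\<close>

context spectrally_positive_levy_process
begin

text \<open>Subtracting \<open>X 0\<close> makes every path start exactly at 0, as the normalised
  locale demands. Almost surely this changes nothing.\<close>

definition reduced :: "real \<Rightarrow> real \<Rightarrow> 'a \<Rightarrow> real" where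
  "reduced c t \<omega> = X t \<omega> - X 0 \<omega> - c * t"

lemma normalized_reduced: "normalized_spectrally_positive M (reduced c)"
proof -
  have [measurable]: "X t \<in> borel_measurable M" if "0 \<le> t" for t using measurable_X[OF that] .
  have red [measurable]: "reduced c t \<in> borel_measurable M" if "0 \<le> t" for t
    unfolding reduced_def[abs_def] using that by measurable
  show ?thesis
  proof unfold_locales
    show "reduced c t \<in> borel_measurable M" if "0 \<le> t" for t by (rule red[OF that])
    show "AE \<omega> in M. reduced c 0 \<omega> = 0" by (simp add: reduced_def)
    show "reduced c 0 \<omega> = 0" for \<omega> by (simp add: reduced_def)
    show "indep_vars (\<lambda>_. borel) (\<lambda>i \<omega>. reduced c (t (Suc i)) \<omega> - reduced c (t i) \<omega>) {..<n}"
      if t: "0 \<le> t 0" "\<And>i. i < n \<Longrightarrow> t i < t (Suc i)" for n :: nat and t :: "nat \<Rightarrow> real"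
    proof -
      have "indep_vars (\<lambda>_. borel) (\<lambda>i \<omega>. (\<lambda>x. x - c * (t (Suc i) - t i)) (X (t (Suc i)) \<omega> - X (t i) \<omega>)) {..<n}"
        by (rule indep_vars_compose2[OF indep_increments[OF t]]) auto
      then show ?thesis by (simp add: reduced_def algebra_simps)
    qed
    show "distr M borel (\<lambda>\<omega>. reduced c (s + h) \<omega> - reduced c s \<omega>) = distr M borel (reduced c h)"
      if sh: "0 \<le> s" "0 \<le> h" for s h
    proof -
      have "distr M borel (\<lambda>\<omega>. reduced c (s + h) \<omega> - reduced c s \<omega>) =
          distr M borel ((\<lambda>x. x - c * h) \<circ> (\<lambda>\<omega>. X (s + h) \<omega> - X s \<omega>))"
        by (intro distr_cong) (auto simp: reduced_def algebra_simps)
      also have "\<dots> = distr (distr M borel (\<lambda>\<omega>. X (s + h) \<omega> - X s \<omega>)) borel (\<lambda>x. x - c * h)"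
        using sh by (intro distr_distr[symmetric]) auto
      also have "\<dots> = distr (distr M borel (X h)) borel (\<lambda>x. x - c * h)"
        using stationary_increments[OF sh] by simp
      also have "\<dots> = distr M borel ((\<lambda>x. x - c * h) \<circ> X h)"
        using sh by (intro distr_distr) auto
      also have "\<dots> = distr M borel (reduced c h)"
        using sh start_zero by (intro distr_cong_AE) (auto simp: reduced_def elim!: eventually_mono)
      finally show ?thesis .
    qed
    show "continuous (at_right t) (\<lambda>s. reduced c s \<omega>)" if "\<omega> \<in> space M" "0 \<le> t" for \<omega> t
      unfolding reduced_def using right_continuous[OF that] by (intro continuous_intros)
    show "\<exists>l. ((\<lambda>s. reduced c s \<omega>) \<longlongrightarrow> l) (at_left t)" if "\<omega> \<in> space M" "0 < t" for \<omega> t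
    proof -
      obtain l where "((\<lambda>s. X s \<omega>) \<longlongrightarrow> l) (at_left t)" using left_limits[OF \<open>\<omega> \<in> space M\<close> \<open>0 < t\<close>] ..
      then have "((\<lambda>s. reduced c s \<omega>) \<longlongrightarrow> l - X 0 \<omega> - c * t) (at_left t)"
        unfolding reduced_def by (intro tendsto_intros)
      then show ?thesis ..
    qed
    show "AE \<omega> in M. \<forall>t>0. \<forall>l. ((\<lambda>s. reduced c s \<omega>) \<longlongrightarrow> l) (at_left t) \<longrightarrow> l \<le> reduced c t \<omega>"
      using no_negative_jumps
    proof eventually_elim
      case (elim \<omega>)
      show ?case
      proof (intro allI impI)
        fix t l :: real assume t: "0 < t" and l: "((\<lambda>s. reduced c s \<omega>) \<longlongrightarrow> l) (at_left t)"
        have "((\<lambda>s. reduced c s \<omega> + X 0 \<omega> + c * s) \<longlongrightarrow> l + X 0 \<omega> + c * t) (at_left t)"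
          by (intro tendsto_intros l)
        then have "((\<lambda>s. X s \<omega>) \<longlongrightarrow> l + X 0 \<omega> + c * t) (at_left t)" by (simp add: reduced_def)
        then have "l + X 0 \<omega> + c * t \<le> X t \<omega>" using elim t by blast
        then show "l \<le> reduced c t \<omega>" by (simp add: reduced_def)
      qed
    qed
  qed
qed

lemma exponent_reduced:
  assumes "0 \<le> \<gamma>"
  shows "normalized_spectrally_positive.exponent M (reduced c) \<gamma> = laplace_exponent M X c \<gamma>"
proof -
  interpret R: normalized_spectrally_positive M "reduced c" by (rule normalized_reduced)
  have [measurable]: "X 1 \<in> borel_measurable M" "X 0 \<in> borel_measurable M" by (auto intro: measurable_X)
  have "(\<integral>\<omega>. exp (- \<gamma> * (reduced c 1 \<omega> - 0)) \<partial>M) = (\<integral>\<omega>. exp (- \<gamma> * (X 1 \<omega> - c)) \<partial>M)"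
    by (rule integral_cong_AE) (use start_zero in \<open>auto simp: reduced_def elim!: eventually_mono\<close>)
  then show ?thesis unfolding R.exponent_eq_laplace_exponent[OF assms] by (simp add: laplace_exponent_def)
qed

lemma invertible_reduced:
  assumes "inverse_defined (laplace_exponent M X c)"
  shows "invertible_spectrally_positive M (reduced c)"
proof -
  interpret R: normalized_spectrally_positive M "reduced c" by (rule normalized_reduced)
  show ?thesis
  proof unfold_locales
    fix q :: real assume "0 < q"
    then have "q \<in> laplace_exponent M X c ` {0..}" using assms by (auto simp: inverse_defined_def)
    then show "\<exists>\<beta>\<ge>0. R.exponent \<beta> = q" using exponent_reduced by force
  qed
qed

text \<open>The two exponents are known to agree for non-negative arguments only. These are the only
  ones over which \<open>inv_into {0..}\<close> chooses, so the two choices coincide.\<close>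

lemma rate_reduced:
  assumes "inverse_defined (laplace_exponent M X c)"
  shows "invertible_spectrally_positive.rate M (reduced c) q = inv_into {0..} (laplace_exponent M X c) q"
proof -
  interpret R: invertible_spectrally_positive M "reduced c" by (rule invertible_reduced[OF assms])
  have "y \<in> {0..} \<and> R.exponent y = q \<longleftrightarrow> y \<in> {0..} \<and> laplace_exponent M X c y = q" for y
    using exponent_reduced by auto
  then show ?thesis unfolding R.rate_def inv_into_def by simp
qed

end

section \<open>Two drifts\<close>

locale two_drift_process = spectrally_positive_levy_process +
  fixes c1 c2 :: real
  assumes inverse1: "inverse_defined (laplace_exponent M X c1)"
    and inverse2: "inverse_defined (laplace_exponent M X c2)"
begin

interpretation Y1: invertible_spectrally_positive M "reduced c1"
  by (rule invertible_reduced[OF inverse1])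

interpretation Y2: invertible_spectrally_positive M "reduced c2"
  by (rule invertible_reduced[OF inverse2])

abbreviation net_path :: "real \<Rightarrow> 'a \<Rightarrow> real \<Rightarrow> real" where
  "net_path s \<omega> \<equiv> \<lambda>t. X t \<omega> - piecewise_drift c1 c2 s t"

lemma exp_neg_eq_rational_inf:
  assumes \<omega>: "\<omega> \<in> space M" and \<gamma>: "0 < \<gamma>"
  shows "exp_neg \<gamma> (sup_before (net_path s \<omega>) r) =
    rational_inf \<gamma> c1 c2 (trajectory X \<omega>) s r"
proof -
  have "rational_inf \<gamma> c1 c2 (trajectory X \<omega>) s r = rational_inf \<gamma> c1 c2 (\<lambda>t. X t \<omega>) s r"
    unfolding rational_inf_def trajectory_def by (intro if_cong refl INF_cong) auto
  also have "\<dots> = exp_neg \<gamma> (sup_before (net_path s \<omega>) r)"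
  proof (cases "r \<le> 0")
    \<comment> \<open>The time set is empty: the supremum is - \<infinity>, its real value is 0 by
      convention, and both sides are 1.\<close>
    case True
    then have empty: "{t. 0 \<le> t \<and> ereal t < r} = {}"
      by (auto simp: not_less intro: order_trans)
    show ?thesis
      using True unfolding rational_inf_def exp_neg_def sup_before_def empty by (simp add: bot_ereal_def)
  next
    case False
    then show ?thesis
      using \<omega> \<gamma> right_continuous by (subst rational_inf_eq) (auto simp: exp_neg_sup_before)
  qed
  finally show ?thesis by simp
qed

text \<open>The expectation over the path alone, with the change point \<open>s\<close> and the
  horizon \<open>r\<close> frozen. It is the inner integral after Fubini.\<close>

definition mean_inf :: "real \<Rightarrow> real \<Rightarrow> ereal \<Rightarrow> ennreal" where
  "mean_inf \<gamma> s r = (\<integral>\<^sup>+\<omega>. ennreal (rational_inf \<gamma> c1 c2 (trajectory X \<omega>) s r) \<partial>M)"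

lemma rational_inf_reduced:
  assumes \<omega>: "\<omega> \<in> space M" "X 0 \<omega> = 0" and s: "0 \<le> s" and \<gamma>: "0 < \<gamma>" and r: "0 < r"
  shows "rational_inf \<gamma> c1 c2 (trajectory X \<omega>) s r =
    (INF t\<in>{t. 0 \<le> t \<and> ereal t < r}. exp (- \<gamma> * (reduced c1 t \<omega> - (c2 - c1) * max 0 (t - s))))"
proof -
  have "X t \<omega> - piecewise_drift c1 c2 s t = reduced c1 t \<omega> - (c2 - c1) * max 0 (t - s)" for t
    using \<omega> by (auto simp: reduced_def piecewise_drift_def max_def algebra_simps)
  then show ?thesis
    unfolding exp_neg_eq_rational_inf[OF \<omega>(1) \<gamma>, symmetric] exp_neg_sup_before[OF \<gamma> r] by simp
qed

text \<open>The half-open time interval lies between closed ones, [0, s + v'] and [0, s + v], and a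
  larger time set has a smaller infimum.\<close>

lemma mean_inf_bounds:
  assumes s: "0 \<le> s" and \<gamma>: "0 < \<gamma>" and v: "0 \<le> v'" "v' < v"
  shows "Y1.drift_transform \<gamma> (c2 - c1) s v \<le> mean_inf \<gamma> s (ereal (s + v))"
    and "mean_inf \<gamma> s (ereal (s + v)) \<le> Y1.drift_transform \<gamma> (c2 - c1) s v'"
proof -
  have r: "0 < ereal (s + v)" using s v by (simp add: zero_ereal_def)
  have sub: "{t. 0 \<le> t \<and> ereal t < ereal (s + v)} \<subseteq> {0..s + v}" "{0..s + v'} \<subseteq> {t. 0 \<le> t \<and> ereal t < ereal (s + v)}"
    using v by auto
  have ne: "{t. 0 \<le> t \<and> ereal t < ereal (s + v)} \<noteq> {}" "{0..s + v'} \<noteq> {}" using s v by (auto intro!: exI[of _ 0])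
  show "Y1.drift_transform \<gamma> (c2 - c1) s v \<le> mean_inf \<gamma> s (ereal (s + v))"
    unfolding Y1.drift_transform_def mean_inf_def Y1.drift_exp_def
  proof (rule nn_integral_mono_AE)
    show "AE \<omega> in M. ennreal (INF t\<in>{0..s + v}. exp (- \<gamma> * (reduced c1 t \<omega> - (c2 - c1) * max 0 (t - s)))) \<le>
        ennreal (rational_inf \<gamma> c1 c2 (trajectory X \<omega>) s (ereal (s + v)))"
      using start_zero AE_space
    proof eventually_elim
      case (elim \<omega>)
      show ?case
        unfolding rational_inf_reduced[OF elim(2,1) s \<gamma> r]
        by (intro ennreal_leI cINF_superset_mono bdd_belowI2[of _ 0] ne sub) auto
    qed
  qed
  show "mean_inf \<gamma> s (ereal (s + v)) \<le> Y1.drift_transform \<gamma> (c2 - c1) s v'"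
    unfolding Y1.drift_transform_def mean_inf_def Y1.drift_exp_def
  proof (rule nn_integral_mono_AE)
    show "AE \<omega> in M. ennreal (rational_inf \<gamma> c1 c2 (trajectory X \<omega>) s (ereal (s + v))) \<le>
        ennreal (INF t\<in>{0..s + v'}. exp (- \<gamma> * (reduced c1 t \<omega> - (c2 - c1) * max 0 (t - s))))"
      using start_zero AE_space
    proof eventually_elim
      case (elim \<omega>)
      show ?case
        unfolding rational_inf_reduced[OF elim(2,1) s \<gamma> r]
        by (intro ennreal_leI cINF_superset_mono bdd_belowI2[of _ 0] ne sub) auto
    qed
  qed
qed

lemma mean_inf_infinity:
  assumes s: "0 \<le> s" and \<gamma>: "0 < \<gamma>"
  shows "(\<lambda>m. Y1.drift_transform \<gamma> (c2 - c1) s (real m)) \<longlonglongrightarrow> mean_inf \<gamma> s \<infinity>"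
proof -
  define I where "I \<omega> = (INF t\<in>{0..}. exp (- \<gamma> * (reduced c1 t \<omega> - (c2 - c1) * max 0 (t - s))))" for \<omega>
  have set: "{t. 0 \<le> t \<and> ereal t < \<infinity>} = {0..}" by auto
  have "mean_inf \<gamma> s \<infinity> = (\<integral>\<^sup>+\<omega>. ennreal (I \<omega>) \<partial>M)"
    unfolding mean_inf_def
  proof (rule nn_integral_cong_AE)
    show "AE \<omega> in M. ennreal (rational_inf \<gamma> c1 c2 (trajectory X \<omega>) s \<infinity>) = ennreal (I \<omega>)"
      using start_zero AE_space
    proof eventually_elim
      case (elim \<omega>)
      show ?case using rational_inf_reduced[OF elim(2,1) s \<gamma>, of \<infinity>] unfolding set by (simp add: I_def)
    qed
  qed
  moreover have lim: "(\<lambda>m. Y1.drift_exp \<gamma> (c2 - c1) s (real m) \<omega>) \<longlonglongrightarrow> I \<omega>" for \<omega>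
    unfolding Y1.drift_exp_def I_def
  proof (rule INF_atLeastAtMost_tendsto)
    show "filterlim (\<lambda>m. s + real m) at_top sequentially"
      by (rule filterlim_tendsto_add_at_top[OF tendsto_const filterlim_real_sequentially])
  qed (use s in auto)
  moreover have "(\<lambda>m. Y1.drift_transform \<gamma> (c2 - c1) s (real m)) \<longlonglongrightarrow> (\<integral>\<^sup>+\<omega>. ennreal (I \<omega>) \<partial>M)"
    unfolding Y1.drift_transform_def
    by (rule nn_integral_tendsto_le_1[OF _ Y1.drift_exp_bounds(2) lim])
       (use s \<gamma> in \<open>auto intro!: Y1.measurable_drift_exp\<close>)
  ultimately show ?thesis by simp
qed

text \<open>With the change at time 0 the extra drift c2 - c1 acts throughout, which turns the
  process reduced by c1 into the one reduced by c2.\<close>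

lemma drift_transform_0_eq:
  assumes "0 \<le> v"
  shows "Y1.drift_transform x (c2 - c1) 0 v = Y2.sup_transform x v"
  unfolding Y1.drift_transform_def Y2.sup_transform_def Y1.drift_exp_def Y2.inf_exp_def
  by (intro nn_integral_cong arg_cong[where f = ennreal] INF_cong) (auto simp: reduced_def algebra_simps)

text \<open>The right side of \<open>drift_master\<close> with \<open>killed_transform_eq\<close>
  inserted and \<open>Y1.rate l - \<gamma>\<close> cancelled. Keeping it as a linear combination of
  two transforms of the second process lets limits and mixtures over \<open>v\<close> act on each
  term.\<close>

definition leg_transform :: "real \<Rightarrow> real \<Rightarrow> real \<Rightarrow> real" where
  "leg_transform l \<gamma> v = l / (l - Y1.exponent \<gamma>) * enn2real (Y2.sup_transform \<gamma> v)
     + - \<gamma> * l / (Y1.rate l * (l - Y1.exponent \<gamma>)) * enn2real (Y2.sup_transform (Y1.rate l) v)"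

lemma leg_transform:
  assumes l: "0 < l" and \<gamma>: "Y1.rate l < \<gamma>" and v: "0 \<le> v"
  shows "0 \<le> leg_transform l \<gamma> v"
    and "(\<integral>\<^sup>+s. exp_weight l s * Y1.drift_transform \<gamma> (c2 - c1) s v \<partial>lborel) = ennreal (leg_transform l \<gamma> v)"
proof -
  define r where "r = Y1.rate l"
  define e where "e = Y1.exponent \<gamma>"
  have r: "0 < r" "r < \<gamma>" using Y1.rate(1)[OF l] \<gamma> by (auto simp: r_def)
  have e: "l < e" unfolding e_def by (rule Y1.exponent_greater[OF l \<gamma>])
  define a where "a = enn2real (Y2.sup_transform \<gamma> v)"
  define b where "b = enn2real (Y2.sup_transform r v)"
  have \<gamma>0: "0 \<le> \<gamma>" "\<gamma> \<noteq> Y1.rate l" using r by (auto simp: r_def)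
  note m = Y1.drift_master(1,2)[OF l \<gamma>0 v, of "c2 - c1", unfolded drift_transform_0_eq[OF v], folded r_def, folded a_def b_def]
  define K where "K = enn2real (Y1.killed_transform l \<gamma>)"
  have K: "Y1.killed_transform l \<gamma> = ennreal K" "0 \<le> K"
    using neq_top_trans[OF _ Y1.killed_transform_le_1[OF l \<gamma>0(1)]] by (simp_all add: K_def less_top)
  have K_eq: "K = l * (r - \<gamma>) / (r * (l - e))"
    unfolding K_def e_def r_def by (rule Y1.killed_transform_eq[OF l \<gamma>0])
  have "K * ((r * a - \<gamma> * b) / (r - \<gamma>)) = l * (r * a - \<gamma> * b) / (r * (l - e))"
    unfolding K_eq using r by simp
  also have "\<dots> = l * (r * a) / (r * (l - e)) - l * (\<gamma> * b) / (r * (l - e))"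
    by (simp add: right_diff_distrib diff_divide_distrib)
  also have "\<dots> = leg_transform l \<gamma> v"
    unfolding leg_transform_def r_def[symmetric] e_def[symmetric] a_def[symmetric] b_def[symmetric] using r by simp
  finally have eq: "K * ((r * a - \<gamma> * b) / (r - \<gamma>)) = leg_transform l \<gamma> v" .
  show "0 \<le> leg_transform l \<gamma> v" unfolding eq[symmetric] using K(2) m(1) by (rule mult_nonneg_nonneg)
  show "(\<integral>\<^sup>+s. exp_weight l s * Y1.drift_transform \<gamma> (c2 - c1) s v \<partial>lborel) = ennreal (leg_transform l \<gamma> v)"
    unfolding m(2) K(1) eq[symmetric] using K(2) by (simp only: ennreal_mult')
qed

lemma expectation_infinite:
  assumes l: "0 < l" and \<gamma>: "Y1.rate l < \<gamma>"
    and T: "distributed M lborel T (exponential_density l)"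
    and indep: "indep_random_elements M path_space (trajectory X) borel T"
    and d: "(Y2.exponent has_real_derivative d) (at 0 within {0..})" "0 \<le> d"
  shows "(\<integral>\<omega>. exp_neg \<gamma> (sup_before (net_path (T \<omega>) \<omega>) \<infinity>) \<partial>M) =
    l / (l - Y1.exponent \<gamma>) * (d * \<gamma> / Y2.exponent \<gamma>)
     + - \<gamma> * l / (Y1.rate l * (l - Y1.exponent \<gamma>)) * (d * Y1.rate l / Y2.exponent (Y1.rate l))"
proof -
  define r where "r = Y1.rate l"
  have r: "0 < r" "r < \<gamma>" using Y1.rate(1)[OF l] \<gamma> by (auto simp: r_def)
  have \<gamma>0: "0 < \<gamma>" using r by simp
  have traj [measurable]: "trajectory X \<in> measurable M path_space" using indep by (simp add: indep_random_elements_def)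
  have Tm [measurable]: "T \<in> borel_measurable M" by (rule exponential_distr(1)[OF T l])
  define H where "H x = ennreal (rational_inf \<gamma> c1 c2 (fst x) (snd x) \<infinity>)" for x
  have Hm [measurable]: "H \<in> borel_measurable (path_space \<Otimes>\<^sub>M borel)"
    unfolding H_def[abs_def] by (intro measurable_compose[OF measurable_rational_inf measurable_ennreal]) auto
  interpret P: prob_space "distr M path_space (trajectory X)" by (rule prob_space_distr) simp
  interpret D: prob_space "distr M borel T" by (rule prob_space_distr) simp
  interpret PD: pair_sigma_finite "distr M path_space (trajectory X)" "distr M borel T" ..
  have "(\<integral>\<^sup>+\<omega>. ennreal (exp_neg \<gamma> (sup_before (net_path (T \<omega>) \<omega>) \<infinity>)) \<partial>M) =
      (\<integral>\<^sup>+\<omega>. H (trajectory X \<omega>, T \<omega>) \<partial>M)"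
    unfolding H_def by (intro nn_integral_cong) (simp add: exp_neg_eq_rational_inf[OF _ \<gamma>0])
  also have "\<dots> = (\<integral>\<^sup>+x. H x \<partial>distr M (path_space \<Otimes>\<^sub>M borel) (\<lambda>\<omega>. (trajectory X \<omega>, T \<omega>)))"
    by (subst nn_integral_distr) auto
  also have "\<dots> = (\<integral>\<^sup>+x. H x \<partial>(distr M path_space (trajectory X) \<Otimes>\<^sub>M distr M borel T))"
    by (simp only: indep_random_elements_distr[OF prob_space_axioms indep])
  also have "\<dots> = (\<integral>\<^sup>+s. (\<integral>\<^sup>+p. H (p, s) \<partial>distr M path_space (trajectory X)) \<partial>distr M borel T)"
    by (rule PD.nn_integral_snd[symmetric]) simp
  also have "\<dots> = (\<integral>\<^sup>+s. mean_inf \<gamma> s \<infinity> \<partial>distr M borel T)"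
  proof (rule nn_integral_cong)
    fix s :: real
    show "(\<integral>\<^sup>+p. H (p, s) \<partial>distr M path_space (trajectory X)) = mean_inf \<gamma> s \<infinity>"
      unfolding mean_inf_def by (subst nn_integral_distr)
        (auto simp: H_def intro!: measurable_compose[OF measurable_rational_inf measurable_ennreal])
  qed
  also have "\<dots> = (\<integral>\<^sup>+s. exp_weight l s * mean_inf \<gamma> s \<infinity> \<partial>lborel)"
  proof (rule exponential_distr(2)[OF T l])
    have "(\<lambda>s. \<integral>\<^sup>+p. H (p, s) \<partial>distr M path_space (trajectory X)) \<in> borel_measurable borel" by measurable
    moreover have "(\<integral>\<^sup>+p. H (p, s) \<partial>distr M path_space (trajectory X)) = mean_inf \<gamma> s \<infinity>" for s
      unfolding mean_inf_def by (subst nn_integral_distr)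
        (auto simp: H_def intro!: measurable_compose[OF measurable_rational_inf measurable_ennreal])
    ultimately show "(\<lambda>s. mean_inf \<gamma> s \<infinity>) \<in> borel_measurable borel" by simp
  qed
  finally have E: "(\<integral>\<^sup>+\<omega>. ennreal (exp_neg \<gamma> (sup_before (net_path (T \<omega>) \<omega>) \<infinity>)) \<partial>M) =
      (\<integral>\<^sup>+s. exp_weight l s * mean_inf \<gamma> s \<infinity> \<partial>lborel)" .
  have dm: "(\<lambda>s. Y1.drift_transform \<gamma> (c2 - c1) s (real m) * indicator {0..} s) \<in> borel_measurable borel" for m
    using r by (intro Y1.drift_master(3)[OF l]) (auto simp: r_def)
  have "(\<lambda>m. \<integral>\<^sup>+s. exp_weight l s * Y1.drift_transform \<gamma> (c2 - c1) s (real m) \<partial>lborel) \<longlonglongrightarrow>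
      (\<integral>\<^sup>+s. exp_weight l s * mean_inf \<gamma> s \<infinity> \<partial>lborel)"
    by (rule nn_integral_exponential_tendsto(2)[OF l dm Y1.drift_transform_le_1 mean_inf_infinity[OF _ \<gamma>0]]) auto
  then have lim: "(\<lambda>m. ennreal (leg_transform l \<gamma> (real m))) \<longlonglongrightarrow>
      (\<integral>\<^sup>+\<omega>. ennreal (exp_neg \<gamma> (sup_before (net_path (T \<omega>) \<omega>) \<infinity>)) \<partial>M)"
    unfolding E leg_transform(2)[OF l \<gamma> of_nat_0_le_iff] .
  \<comment> \<open>Both terms of \<open>leg_transform\<close> converge separately as the second leg
    grows, each to a value given by \<open>total_transform_eq\<close>.\<close>
  have tot: "(\<lambda>m. enn2real (Y2.sup_transform x (real m))) \<longlonglongrightarrow> d * x / Y2.exponent x" if "0 < x" for x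
    unfolding Y2.total_transform_eq[OF d that, symmetric]
  proof (rule tendsto_enn2real)
    have lim: "(\<lambda>m. Y2.sup_transform x (real m)) \<longlonglongrightarrow> Y2.total_transform x"
      using that by (intro Y2.sup_transform_tendsto_total filterlim_real_sequentially) auto
    have "Y2.total_transform x \<le> 1"
      using lim by (rule LIMSEQ_le_const2) (use Y2.sup_transform_le_1 in auto)
    then have "Y2.total_transform x \<noteq> \<top>" by (auto simp: top_unique)
    then show "(\<lambda>m. Y2.sup_transform x (real m)) \<longlonglongrightarrow> ennreal (enn2real (Y2.total_transform x))"
      using lim by (simp add: less_top)
  qed simp
  have "(\<lambda>m. leg_transform l \<gamma> (real m)) \<longlonglongrightarrow> l / (l - Y1.exponent \<gamma>) * (d * \<gamma> / Y2.exponent \<gamma>)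
     + - \<gamma> * l / (r * (l - Y1.exponent \<gamma>)) * (d * r / Y2.exponent r)" (is "_ \<longlonglongrightarrow> ?L")
    unfolding leg_transform_def r_def[symmetric] by (intro tendsto_add tendsto_mult tendsto_const tot \<gamma>0 r)
  moreover from this have "0 \<le> ?L" by (rule LIMSEQ_le_const) (use leg_transform(1)[OF l \<gamma>] in auto)
  ultimately have "(\<integral>\<^sup>+\<omega>. ennreal (exp_neg \<gamma> (sup_before (net_path (T \<omega>) \<omega>) \<infinity>)) \<partial>M) = ennreal ?L"
    using lim LIMSEQ_unique tendsto_ennrealI by blast
  moreover have "(\<lambda>\<omega>. exp_neg \<gamma> (sup_before (net_path (T \<omega>) \<omega>) \<infinity>)) \<in> borel_measurable M"
    by (subst measurable_cong[OF exp_neg_eq_rational_inf[OF _ \<gamma>0]]) (auto intro!: measurable_rational_inf)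
  ultimately show ?thesis
    using \<open>0 \<le> ?L\<close> unfolding r_def by (subst integral_eq_nn_integral) (auto simp: exp_neg_def)
qed

lemma expectation_exponential:
  assumes l: "0 < l" and \<gamma>: "Y1.rate l < \<gamma>" and \<theta>: "0 < \<theta>"
    and T: "distributed M lborel T (exponential_density l)"
    and indep: "indep_random_elements M path_space (trajectory X) borel T"
    and V: "distributed M lborel V (exponential_density \<theta>)"
    and indepV: "indep_random_elements M (path_space \<Otimes>\<^sub>M borel) (\<lambda>\<omega>. (trajectory X \<omega>, T \<omega>)) borel V"
  shows "(\<integral>\<omega>. exp_neg \<gamma> (sup_before (net_path (T \<omega>) \<omega>) (ereal (T \<omega> + V \<omega>))) \<partial>M) =
    l / (l - Y1.exponent \<gamma>) * enn2real (Y2.killed_transform \<theta> \<gamma>)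
     + - \<gamma> * l / (Y1.rate l * (l - Y1.exponent \<gamma>)) * enn2real (Y2.killed_transform \<theta> (Y1.rate l))"
proof -
  define r where "r = Y1.rate l"
  have r: "0 < r" "r < \<gamma>" using Y1.rate(1)[OF l] \<gamma> by (auto simp: r_def)
  have \<gamma>0: "0 < \<gamma>" using r by simp
  have traj [measurable]: "trajectory X \<in> measurable M path_space" using indep by (simp add: indep_random_elements_def)
  have Tm [measurable]: "T \<in> borel_measurable M" by (rule exponential_distr(1)[OF T l])
  have Vm [measurable]: "V \<in> borel_measurable M" by (rule exponential_distr(1)[OF V \<theta>])
  define H where "H x = ennreal (rational_inf \<gamma> c1 c2 (fst (fst x)) (snd (fst x)) (ereal (snd (fst x) + snd x)))" for x
  have Hm [measurable]: "H \<in> borel_measurable ((path_space \<Otimes>\<^sub>M borel) \<Otimes>\<^sub>M borel)"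
    unfolding H_def[abs_def] by (intro measurable_compose[OF measurable_rational_inf measurable_ennreal]) measurable
  let ?P = "distr M path_space (trajectory X)" and ?T = "distr M borel T" and ?V = "distr M borel V"
  interpret P: prob_space ?P by (rule prob_space_distr) simp
  interpret D: prob_space ?T by (rule prob_space_distr) simp
  interpret DV: prob_space ?V by (rule prob_space_distr) simp
  interpret PD: pair_sigma_finite ?P ?T ..
  interpret PT: pair_prob_space ?P ?T ..
  interpret PTV: pair_sigma_finite "?P \<Otimes>\<^sub>M ?T" ?V ..
  define W where "W s v = mean_inf \<gamma> s (ereal (s + v))" for s v
  have W: "(\<integral>\<^sup>+p. H ((p, s), v) \<partial>?P) = W s v" for s v
    unfolding W_def mean_inf_def by (subst nn_integral_distr)
        (auto simp: H_def intro!: measurable_compose[OF measurable_rational_inf measurable_ennreal])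
  have W_meas: "(\<lambda>(s, v). W s v) \<in> borel_measurable (borel \<Otimes>\<^sub>M borel)"
    unfolding W[symmetric] by measurable
  note [measurable] = W_meas
  have "(\<integral>\<^sup>+\<omega>. ennreal (exp_neg \<gamma> (sup_before (net_path (T \<omega>) \<omega>) (ereal (T \<omega> + V \<omega>)))) \<partial>M) =
      (\<integral>\<^sup>+\<omega>. H ((trajectory X \<omega>, T \<omega>), V \<omega>) \<partial>M)"
    unfolding H_def by (intro nn_integral_cong) (simp add: exp_neg_eq_rational_inf[OF _ \<gamma>0])
  also have "\<dots> = (\<integral>\<^sup>+x. H x \<partial>distr M ((path_space \<Otimes>\<^sub>M borel) \<Otimes>\<^sub>M borel) (\<lambda>\<omega>. ((trajectory X \<omega>, T \<omega>), V \<omega>)))"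
    by (subst nn_integral_distr) auto
  also have "\<dots> = (\<integral>\<^sup>+x. H x \<partial>((?P \<Otimes>\<^sub>M ?T) \<Otimes>\<^sub>M ?V))"
    by (simp only: indep_random_elements_distr[OF prob_space_axioms indepV] indep_random_elements_distr[OF prob_space_axioms indep])
  also have "\<dots> = (\<integral>\<^sup>+v. (\<integral>\<^sup>+x. H (x, v) \<partial>(?P \<Otimes>\<^sub>M ?T)) \<partial>?V)"
    by (rule PTV.nn_integral_snd[symmetric]) simp
  also have "\<dots> = (\<integral>\<^sup>+v. (\<integral>\<^sup>+s. W s v \<partial>?T) \<partial>?V)"
  proof (rule nn_integral_cong)
    fix v :: real
    have "(\<integral>\<^sup>+x. H (x, v) \<partial>(?P \<Otimes>\<^sub>M ?T)) = (\<integral>\<^sup>+s. (\<integral>\<^sup>+p. H ((p, s), v) \<partial>?P) \<partial>?T)"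
      by (rule PD.nn_integral_snd[symmetric]) simp
    then show "(\<integral>\<^sup>+x. H (x, v) \<partial>(?P \<Otimes>\<^sub>M ?T)) = (\<integral>\<^sup>+s. W s v \<partial>?T)" unfolding W .
  qed
  also have "\<dots> = (\<integral>\<^sup>+v. (\<integral>\<^sup>+s. exp_weight l s * W s v \<partial>lborel) \<partial>?V)"
    by (intro nn_integral_cong exponential_distr(2)[OF T l]) measurable
  also have "\<dots> = (\<integral>\<^sup>+v. exp_weight \<theta> v *
      (\<integral>\<^sup>+s. exp_weight l s * W s v \<partial>lborel) \<partial>lborel)"
    by (rule exponential_distr(2)[OF V \<theta>]) measurable
  \<comment> \<open>The left side uses the interval open at s + v, the right side the closed one.
    The closed value is monotone in \<open>v\<close>, so it is continuous off a countable null set,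
    and at a continuity point the bounds from both sides meet.\<close>
  also have "\<dots> = (\<integral>\<^sup>+v. exp_weight \<theta> v * ennreal (leg_transform l \<gamma> v) \<partial>lborel)"
  proof (rule nn_integral_cong_AE)
    define G where "G v = (\<integral>\<^sup>+s. exp_weight l s * W s v \<partial>lborel)" for v
    have lo: "ennreal (leg_transform l \<gamma> v) \<le> G v" if "0 < v" for v
      unfolding leg_transform(2)[OF l \<gamma> less_imp_le[OF that], symmetric] G_def W_def
      using mean_inf_bounds(1)[OF _ \<gamma>0 order_refl that] by (intro nn_integral_mono) (simp add: indicator_def mult_left_mono)
    have hi: "G v \<le> ennreal (leg_transform l \<gamma> v')" if "0 \<le> v'" "v' < v" for v v'
      unfolding leg_transform(2)[OF l \<gamma> that(1), symmetric] G_def W_def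
      using mean_inf_bounds(2)[OF _ \<gamma>0 that] by (intro nn_integral_mono) (simp add: indicator_def mult_left_mono)
    have "mono_on {0..} (\<lambda>v. - leg_transform l \<gamma> v)"
    proof (rule mono_onI)
      fix v' v :: real assume v: "v' \<in> {0..}" "v \<in> {0..}" "v' \<le> v"
      show "- leg_transform l \<gamma> v' \<le> - leg_transform l \<gamma> v"
      proof (cases "v' = v")
        case False
        then have "ennreal (leg_transform l \<gamma> v) \<le> ennreal (leg_transform l \<gamma> v')"
          using v by (intro order_trans[OF lo hi]) auto
        then show ?thesis using leg_transform(1)[OF l \<gamma>, of v'] v by (simp add: ennreal_le_iff)
      qed simp
    qed
    then have "countable {v \<in> {0..}. \<not> continuous (at v within {0..}) (\<lambda>v. - leg_transform l \<gamma> v)}"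
      by (rule mono_on_ctble_discont)
    then have "AE v in lborel. v \<notin> {v \<in> {0..}. \<not> continuous (at v within {0..}) (\<lambda>v. - leg_transform l \<gamma> v)}"
      by (intro AE_not_in countable_imp_null_set_lborel)
    then have "AE v in lborel. 0 \<le> v \<longrightarrow> G v = ennreal (leg_transform l \<gamma> v)"
      using AE_lborel_singleton[of 0]
    proof eventually_elim
      case (elim v)
      show ?case
      proof
        assume "0 \<le> v"
        then have v: "0 < v" and cont: "continuous (at v within {0..}) (\<lambda>v. - leg_transform l \<gamma> v)" using elim by auto
        \<comment> \<open>These points approach \<open>v\<close> strictly from below and never
          become negative; the index starts at 2 so that they also stay away from 0.\<close>
        have seq: "(\<lambda>n. v - v / real (Suc (Suc n))) \<longlonglongrightarrow> v"
        proof -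
          have "(\<lambda>n. v - v * inverse (real (Suc (Suc n)))) \<longlonglongrightarrow> v - v * 0"
            by (intro tendsto_diff tendsto_mult tendsto_const LIMSEQ_Suc[OF LIMSEQ_inverse_real_of_nat])
          then show ?thesis by (simp add: divide_inverse)
        qed
        have le: "0 \<le> v - v / real (Suc (Suc n))" "v - v / real (Suc (Suc n)) < v" for n
          using v by (auto simp: divide_le_eq mult_le_cancel_left1)
        have "(\<lambda>n. - leg_transform l \<gamma> (v - v / real (Suc (Suc n)))) \<longlonglongrightarrow> - leg_transform l \<gamma> v"
          using cont seq le unfolding continuous_within_sequentially comp_def by auto
        then have "(\<lambda>n. leg_transform l \<gamma> (v - v / real (Suc (Suc n)))) \<longlonglongrightarrow> leg_transform l \<gamma> v"
          using tendsto_minus_cancel_left tendsto_minus by fastforce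
        then have "(\<lambda>n. ennreal (leg_transform l \<gamma> (v - v / real (Suc (Suc n))))) \<longlonglongrightarrow> ennreal (leg_transform l \<gamma> v)"
          by (rule tendsto_ennrealI)
        then have "G v \<le> ennreal (leg_transform l \<gamma> v)" by (rule LIMSEQ_le_const) (use hi le in auto)
        with lo[OF v] show "G v = ennreal (leg_transform l \<gamma> v)" by (rule antisym[rotated])
      qed
    qed
    then show "AE v in lborel. exp_weight \<theta> v *
        (\<integral>\<^sup>+s. exp_weight l s * W s v \<partial>lborel) =
        exp_weight \<theta> v * ennreal (leg_transform l \<gamma> v)"
      unfolding G_def by eventually_elim (auto simp: indicator_def)
  qed
  finally have E: "(\<integral>\<^sup>+\<omega>. ennreal (exp_neg \<gamma> (sup_before (net_path (T \<omega>) \<omega>) (ereal (T \<omega> + V \<omega>)))) \<partial>M) =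
      (\<integral>\<^sup>+v. exp_weight \<theta> v * ennreal (leg_transform l \<gamma> v) \<partial>lborel)" .
  have fm: "(\<lambda>v. ennreal (enn2real (Y2.sup_transform x v)) * indicator {0..} v) \<in> borel_measurable borel" if "0 < x" for x
  proof -
    have "(\<lambda>v. ennreal (enn2real (Y2.sup_transform x v)) * indicator {0..} v) = (\<lambda>v. Y2.sup_transform x v * indicator {0..} v)"
      using Y2.sup_transform_real(1) by (auto simp: fun_eq_iff indicator_def)
    then show ?thesis using Y2.measurable_sup_transform[OF \<theta>, of x] that by simp
  qed
  have f01: "0 \<le> enn2real (Y2.sup_transform x v) \<and> enn2real (Y2.sup_transform x v) \<le> 1" if "0 \<le> v" for x v
    using Y2.sup_transform_real[OF that] by auto
  have leg0: "0 \<le> l / (l - Y1.exponent \<gamma>) * enn2real (Y2.sup_transform \<gamma> v) + - \<gamma> * l / (r * (l - Y1.exponent \<gamma>)) * enn2real (Y2.sup_transform r v)"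
    if "0 \<le> v" for v using leg_transform(1)[OF l \<gamma> that] unfolding leg_transform_def r_def .
  let ?R = "l / (l - Y1.exponent \<gamma>) * enn2real (Y2.killed_transform \<theta> \<gamma>)
     + - \<gamma> * l / (r * (l - Y1.exponent \<gamma>)) * enn2real (Y2.killed_transform \<theta> r)"
  have R: "(\<integral>\<^sup>+v. exp_weight \<theta> v * ennreal (leg_transform l \<gamma> v) \<partial>lborel) = ennreal ?R"
    unfolding leg_transform_def r_def[symmetric] Y2.killed_transform_real[of \<theta>]
    by (rule nn_integral_exponential_linear[OF \<theta> fm[OF \<gamma>0] f01 fm[OF r(1)] f01 leg0])
  have R0: "0 \<le> ?R"
    unfolding Y2.killed_transform_real[of \<theta>]
    by (rule nn_integral_exponential_linear_nonneg[OF \<theta> fm[OF \<gamma>0] f01 fm[OF r(1)] f01 leg0])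
  have "(\<lambda>\<omega>. exp_neg \<gamma> (sup_before (net_path (T \<omega>) \<omega>) (ereal (T \<omega> + V \<omega>)))) \<in> borel_measurable M"
    by (subst measurable_cong[OF exp_neg_eq_rational_inf[OF _ \<gamma>0]]) (auto intro!: measurable_rational_inf)
  then show ?thesis
    using R0 E unfolding R r_def by (subst integral_eq_nn_integral) (auto simp: exp_neg_def)
qed

end

text \<open>In the second part a quotient degenerates to 0 / 0 when \<open>\<psi>1 lam\<close> or
  \<gamma> equals \<open>\<psi>2 \<theta>\<close>. Both quotients are explicit multiples of one
  continuous transform, that of the supremum of the second process at an Exp(\<theta>) time, so the
  continuous extension has the correct value.\<close>

theorem corollary3:
  fixes M :: "'a measure" and X :: "real \<Rightarrow> 'a \<Rightarrow> real" and T :: "'a \<Rightarrow> real"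
    and c1 c2 lam \<gamma> :: real and \<phi>1 \<phi>2 \<psi>1 \<psi>2 :: "real \<Rightarrow> real"
  assumes X: "spectrally_positive_levy_process M X"
    and c: "0 \<le> c1" "0 \<le> c2"
    and lam: "0 < lam"
    and T: "distributed M lborel T (exponential_density lam)"
    and indep_T: "indep_random_elements M path_space (trajectory X) borel T"
    and exponents: "\<phi>1 = laplace_exponent M X c1" "\<phi>2 = laplace_exponent M X c2"
    and inverse_exists: "inverse_defined \<phi>1" "inverse_defined \<phi>2"
    and inverses: "\<psi>1 = inv_into {0..} \<phi>1" "\<psi>2 = inv_into {0..} \<phi>2"
    and gamma: "\<psi>1 lam < \<gamma>"
  shows "(\<forall>d. (\<phi>2 has_real_derivative d) (at 0 within {0..}) \<and> 0 \<le> d \<longrightarrow>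
            (\<integral>\<omega>. exp_neg \<gamma> (sup_before (\<lambda>t. X t \<omega> - piecewise_drift c1 c2 (T \<omega>) t) \<infinity>) \<partial>M)
            = \<gamma> * lam * d * (\<phi>2 \<gamma> - \<phi>2 (\<psi>1 lam)) / (\<phi>2 \<gamma> * (\<phi>1 \<gamma> - lam) * \<phi>2 (\<psi>1 lam)))
       \<and> (\<forall>(V :: 'a \<Rightarrow> real) \<theta>. 0 < \<theta> \<and>
            distributed M lborel V (exponential_density \<theta>) \<and>
            indep_random_elements M (path_space \<Otimes>\<^sub>M borel) (\<lambda>\<omega>. (trajectory X \<omega>, T \<omega>)) borel V \<longrightarrow>
            (\<integral>\<omega>. exp_neg \<gamma> (sup_before (\<lambda>t. X t \<omega> - piecewise_drift c1 c2 (T \<omega>) t)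
                                 (ereal (T \<omega> + V \<omega>))) \<partial>M)
            = \<gamma> * lam * \<theta> *
              ((quot_ext (\<lambda>x. \<psi>2 \<theta> - x) (\<lambda>x. \<theta> - \<phi>2 x) (\<psi>1 lam)
                - quot_ext (\<lambda>x. \<psi>1 lam * (\<psi>2 \<theta> - x)) (\<lambda>x. x * (\<theta> - \<phi>2 x)) \<gamma>)
               / (\<psi>1 lam * \<psi>2 \<theta> * (\<phi>1 \<gamma> - lam))))"
proof -
  interpret spectrally_positive_levy_process M X by fact
  have inv: "inverse_defined (laplace_exponent M X c1)" "inverse_defined (laplace_exponent M X c2)"
    using inverse_exists unfolding exponents .
  interpret two_drift_process M X c1 c2 by unfold_locales (fact inv)+
  interpret Y1: invertible_spectrally_positive M "reduced c1" by (rule invertible_reduced[OF inv(1)])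
  interpret Y2: invertible_spectrally_positive M "reduced c2" by (rule invertible_reduced[OF inv(2)])
  define b where "b = \<psi>1 lam"
  have rate1: "Y1.rate q = \<psi>1 q" and rate2: "Y2.rate q = \<psi>2 q" for q
    unfolding inverses exponents by (rule rate_reduced[OF inv(1)], rule rate_reduced[OF inv(2)])
  have exp1: "Y1.exponent x = \<phi>1 x" and exp2: "Y2.exponent x = \<phi>2 x" if "0 \<le> x" for x
    unfolding exponents by (rule exponent_reduced[OF that])+
  have b: "0 < b" "b < \<gamma>" using Y1.rate(1)[OF lam] gamma by (auto simp: rate1 b_def)
  have g: "Y1.rate lam < \<gamma>" using gamma by (simp add: rate1)
  have e: "lam < \<phi>1 \<gamma>" using Y1.exponent_greater[OF lam g] b exp1[of \<gamma>] by simp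
  show ?thesis
  proof (intro conjI allI impI; elim conjE)
    fix d :: real assume d: "(\<phi>2 has_real_derivative d) (at 0 within {0..})" "0 \<le> d"
    \<comment> \<open>The one-sided derivative sees only non-negative arguments, where the two
      exponents agree.\<close>
    have d': "(Y2.exponent has_real_derivative d) (at 0 within {0..})"
      using d(1) by (rule has_field_derivative_transform_within[where d = 1]) (auto simp: exp2)
    have pos: "0 < \<phi>2 x" if "0 < x" for x
      using Y2.exponent_pos[OF d' d(2) that] exp2[of x] that by simp
    show "(\<integral>\<omega>. exp_neg \<gamma> (sup_before (\<lambda>t. X t \<omega> - piecewise_drift c1 c2 (T \<omega>) t) \<infinity>) \<partial>M)
        = \<gamma> * lam * d * (\<phi>2 \<gamma> - \<phi>2 (\<psi>1 lam)) / (\<phi>2 \<gamma> * (\<phi>1 \<gamma> - lam) * \<phi>2 (\<psi>1 lam))"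
      unfolding expectation_infinite[OF lam g T indep_T d' d(2)]
      unfolding rate1 b_def[symmetric] using b e pos[of b] pos[of \<gamma>]
      by (simp add: exp1 exp2 divide_simps) (simp add: algebra_simps)
  next
    fix V :: "'a \<Rightarrow> real" and \<theta> :: real
    assume \<theta>: "0 < \<theta>" and V: "distributed M lborel V (exponential_density \<theta>)"
      and indep_V: "indep_random_elements M (path_space \<Otimes>\<^sub>M borel) (\<lambda>\<omega>. (trajectory X \<omega>, T \<omega>)) borel V"
    define K where "K x = enn2real (Y2.killed_transform \<theta> x)" for x
    define r where "r = \<psi>2 \<theta>"
    have r: "0 < r" "\<phi>2 r = \<theta>" using Y2.rate(1,2)[OF \<theta>] exp2[of r] by (auto simp: r_def rate2)
    have eq_iff: "\<theta> = \<phi>2 x \<longleftrightarrow> x = r" if "0 < x" for x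
    proof (cases x r rule: linorder_cases)
      case less
      then show ?thesis using Y2.exponent_less[OF \<theta>, of x] that exp2[of x] by (simp add: rate2 r_def)
    next
      case greater
      then show ?thesis using Y2.exponent_greater[OF \<theta>, of x] that exp2[of x] by (simp add: rate2 r_def)
    qed (use r in simp)
    have K: "K x = \<theta> * (r - x) / (r * (\<theta> - \<phi>2 x))" if "0 < x" "x \<noteq> r" for x
      unfolding K_def using Y2.killed_transform_eq[OF \<theta>, of x] that by (simp add: rate2 r_def exp2)
    \<comment> \<open>The constant \<open>r / \<theta>\<close> comes from solving the formula for
      \<open>K x\<close> for the quotient (r - x) / (\<theta> - \<open>\<phi>2 x\<close>).\<close>
    have q1: "quot_ext (\<lambda>x. r - x) (\<lambda>x. \<theta> - \<phi>2 x) b = r / \<theta> * K b"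
      unfolding K_def
    proof (rule Y2.quot_ext_killed_transform[OF \<theta> b(1)])
      show "(r - y) / (\<theta> - \<phi>2 y) = r / \<theta> * enn2real (Y2.killed_transform \<theta> y)" if "0 < y" "y \<noteq> Y2.rate \<theta>" for y
        using K[of y] that r \<theta> unfolding K_def rate2 r_def[symmetric] by simp
    qed (use eq_iff[OF b(1)] in \<open>auto simp: rate2 r_def\<close>)
    have q2: "quot_ext (\<lambda>x. b * (r - x)) (\<lambda>x. x * (\<theta> - \<phi>2 x)) \<gamma> = b / \<gamma> * (r / \<theta>) * K \<gamma>"
      unfolding K_def
    proof (rule Y2.quot_ext_killed_transform[OF \<theta>, where k = "\<lambda>x. b / x * (r / \<theta>)"])
      show "b * (r - y) / (y * (\<theta> - \<phi>2 y)) = b / y * (r / \<theta>) * enn2real (Y2.killed_transform \<theta> y)" if "0 < y" "y \<noteq> Y2.rate \<theta>" for y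
        using K[of y] that r \<theta> unfolding K_def rate2 r_def[symmetric] by simp
    qed (use eq_iff[of \<gamma>] b \<theta> in \<open>auto simp: rate2 r_def intro!: continuous_intros\<close>)
    have "(\<integral>\<omega>. exp_neg \<gamma> (sup_before (\<lambda>t. X t \<omega> - piecewise_drift c1 c2 (T \<omega>) t) (ereal (T \<omega> + V \<omega>))) \<partial>M) =
        lam / (lam - \<phi>1 \<gamma>) * K \<gamma> + - \<gamma> * lam / (b * (lam - \<phi>1 \<gamma>)) * K b"
      using expectation_exponential[OF lam g \<theta> T indep_T V indep_V] b
      unfolding rate1 b_def[symmetric] K_def by (simp add: exp1)
    also have "\<dots> = \<gamma> * lam * \<theta> * ((r / \<theta> * K b - b / \<gamma> * (r / \<theta>) * K \<gamma>) / (b * r * (\<phi>1 \<gamma> - lam)))"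
      using b e r \<theta> by (simp add: divide_simps) (simp add: algebra_simps)
    finally show "(\<integral>\<omega>. exp_neg \<gamma> (sup_before (\<lambda>t. X t \<omega> - piecewise_drift c1 c2 (T \<omega>) t)
                                 (ereal (T \<omega> + V \<omega>))) \<partial>M)
            = \<gamma> * lam * \<theta> *
              ((quot_ext (\<lambda>x. \<psi>2 \<theta> - x) (\<lambda>x. \<theta> - \<phi>2 x) (\<psi>1 lam)
                - quot_ext (\<lambda>x. \<psi>1 lam * (\<psi>2 \<theta> - x)) (\<lambda>x. x * (\<theta> - \<phi>2 x)) \<gamma>)
               / (\<psi>1 lam * \<psi>2 \<theta> * (\<phi>1 \<gamma> - lam)))"
      unfolding b_def[symmetric] r_def[symmetric] q1 q2 .
  qed
qed

end
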